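(* For any constants $\varepsilon>0$, $k$, $d$, the problem of deciding whether a uniform $d$-bounded-degree stoquastic $k$-local Hamiltonian $H$ is frustration-free or $\varepsilon$-frustrated (promised that one of the two holds) is in $\mathrm{NP}$.
   Context: Let $\Sigma=\{0,\dots,q-1\}$ be a fixed finite alphabet. An $n$-qudit state is a unit vector in $(\mathbb C^{\Sigma})^{\otimes n}$, with computational basis $\{|x\rangle : x\in\Sigma^n\}$. For a nonempty set $T$ of strings, $|T\rangle := |T|^{-1/2}\sum_{x\in T}|x\rangle$ is the subset-state of $T$. Input: Hermitian terms $H_1,\dots,H_m$ given by their matrices (entries with polynomially many bits), where $m$ is polynomial in $n$ and $m\ge n$. Each $H_i$ acts on a set $Q_i$ of $k$ of the $n$ qudits, $0\le H_i\le I$, and every qudit is acted on non-trivially by at most $d$ terms ("$d$-bounded degree"). Put $\tilde H_i=H_i\otimes I$ (identity on the other qudits) and $H=\frac1m\sum_{i=1}^m \tilde H_i$. $H$ is stoquastic if all off-diagonal entries of each $H_i$ in the computational basis are non-positive. $P_i$ is the orthogonal projector onto the groundspace (eigenspace of the minimal eigenvalue) of $H_i$. $H$ is uniform if each $P_i=\sum_j |T_{i,j}\rangle\langle T_{i,j}|$ with pairwise disjoint nonempty sets $T_{i,j}\subseteq\Sigma^k$. $H$ is frustration-free if there is a state $|\psi\rangle$ with $\langle\psi|\tilde H_i|\psi\rangle=0$ for all $i$. It is $\varepsilon$-frustrated if $\langle\psi|H|\psi\rangle\ge\varepsilon$ for all states $|\psi\rangle$. Yes-instances are the frustration-free ones,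 no-instances the $\varepsilon$-frustrated ones. $\mathrm{NP}$ is taken as a class of promise problems. *)

theory Defs
  imports Complex_Main "HOL-Library.Disjoint_Sets" "HOL-Computational_Algebra.Polynomial"
begin

section \<open>Deterministic multi-tape Turing machines\<close>

text \<open>
  Tapes are two-way infinite. Tape symbols and control states are initial segments of the natural
  numbers; symbol 0 is the blank, symbols 1 and 2 are the bits False and True.
\<close>

datatype dir = MoveL | Stay | MoveR

type_synonym tape = "int \<times> (int \<Rightarrow> nat)" \<comment> \<open>head position and contents\<close>
type_synonym config = "nat \<times> tape list"

record tm =
  num_tapes :: nat
  num_syms :: nat
  num_states :: nat
  start_state :: nat
  acc_state :: nat
  rej_state :: nat
  trans :: "nat \<Rightarrow> nat list \<Rightarrow> nat \<times> (nat \<times> dir) list"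
    \<comment> \<open>state and scanned symbols to new state and, per tape, symbol written and head move\<close>

definition wf_tm :: "tm \<Rightarrow> bool" where
  "wf_tm M \<longleftrightarrow>
     num_tapes M \<ge> 2 \<and> num_syms M \<ge> 3 \<and>
     start_state M < num_states M \<and> acc_state M < num_states M \<and> rej_state M < num_states M \<and>
     acc_state M \<noteq> rej_state M \<and>
     (\<forall>s rs. s < num_states M \<and> length rs = num_tapes M \<and> set rs \<subseteq> {..<num_syms M} \<longrightarrow>
        fst (trans M s rs) < num_states M \<and>
        length (snd (trans M s rs)) = num_tapes M \<and>
        fst ` set (snd (trans M s rs)) \<subseteq> {..<num_syms M})"

fun scan :: "tape \<Rightarrow> nat" where
  "scan (h, c) = c h"

fun move :: "dir \<Rightarrow> int \<Rightarrow> int" where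
  "move MoveL h = h - 1"
| "move Stay h = h"
| "move MoveR h = h + 1"

fun act :: "tape \<Rightarrow> nat \<times> dir \<Rightarrow> tape" where
  "act (h, c) (a, D) = (move D h, c(h := a))"

definition halting :: "tm \<Rightarrow> config \<Rightarrow> bool" where
  "halting M C \<longleftrightarrow> fst C \<in> {acc_state M, rej_state M}"

definition step :: "tm \<Rightarrow> config \<Rightarrow> config" where
  "step M C =
     (if halting M C then C
      else let (s, as) = trans M (fst C) (map scan (snd C)) in (s, map2 act (snd C) as))"

definition tape_of :: "bool list \<Rightarrow> tape" where
  "tape_of bs =
     (0, \<lambda>i. if 0 \<le> i \<and> i < int (length bs) then (if bs ! nat i then 2 else 1) else 0)"

text \<open>A verifier gets the instance on its first tape and the witness on its second tape.\<close>

definition init_config :: "tm \<Rightarrow> bool list \<Rightarrow> bool list \<Rightarrow> config" where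
  "init_config M x w =
     (start_state M, tape_of x # tape_of w # replicate (num_tapes M - 2) (tape_of []))"

definition run :: "tm \<Rightarrow> bool list \<Rightarrow> bool list \<Rightarrow> nat \<Rightarrow> config" where
  "run M x w t = (step M ^^ t) (init_config M x w)"

definition accepts :: "tm \<Rightarrow> bool list \<Rightarrow> bool list \<Rightarrow> bool" where
  "accepts M x w \<longleftrightarrow> (\<exists>t. fst (run M x w t) = acc_state M)"

definition polytime :: "tm \<Rightarrow> bool" where
  "polytime M \<longleftrightarrow>
     (\<exists>p :: nat poly. \<forall>x w. halting M (run M x w (poly p (length x + length w))))"


section \<open>NP as a class of promise problems\<close>

type_synonym promise_problem = "bool list set \<times> bool list set" \<comment> \<open>yes- and no-instances\<close>

definition NP :: "promise_problem set" where
  "NP = {(Yes, No). \<exists>M (r :: nat poly). wf_tm M \<and> polytime M \<and>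
     (\<forall>x\<in>Yes. \<exists>w. length w \<le> poly r (length x) \<and> accepts M x w) \<and>
     (\<forall>x\<in>No. \<forall>w. length w \<le> poly r (length x) \<longrightarrow> \<not> accepts M x w)}"


section \<open>Qudit states and operators\<close>

text \<open>
  The alphabet is \<open>{0, ..., q-1}\<close>. Vectors and matrices are indexed by strings; vectors vanish, by
  convention, outside the computational basis, and matrices are only relevant on it.
\<close>

type_synonym qvec = "nat list \<Rightarrow> complex"
type_synonym qmat = "nat list \<Rightarrow> nat list \<Rightarrow> complex"

definition strings :: "nat \<Rightarrow> nat \<Rightarrow> nat list set" where
  "strings q n = {x. length x = n \<and> set x \<subseteq> {..<q}}"

definition vecs :: "nat \<Rightarrow> nat \<Rightarrow> qvec set" where
  "vecs q n = {v. \<forall>x. x \<notin> strings q n \<longrightarrow> v x = 0}"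

definition iprod :: "nat \<Rightarrow> nat \<Rightarrow> qvec \<Rightarrow> qvec \<Rightarrow> complex" where
  "iprod q n u v = (\<Sum>x\<in>strings q n. cnj (u x) * v x)"

definition mapply :: "nat \<Rightarrow> nat \<Rightarrow> qmat \<Rightarrow> qvec \<Rightarrow> qvec" where
  "mapply q n A v = (\<lambda>x. if x \<in> strings q n then \<Sum>y\<in>strings q n. A x y * v y else 0)"

definition expect :: "nat \<Rightarrow> nat \<Rightarrow> qmat \<Rightarrow> qvec \<Rightarrow> complex" where
  "expect q n A v = iprod q n v (mapply q n A v)"

definition states :: "nat \<Rightarrow> nat \<Rightarrow> qvec set" where
  "states q n = {v \<in> vecs q n. iprod q n v v = 1}"

definition subset_state :: "nat list set \<Rightarrow> qvec" where
  "subset_state T = (\<lambda>x. if x \<in> T then of_real (1 / sqrt (real (card T))) else 0)"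

definition hermitian :: "nat \<Rightarrow> nat \<Rightarrow> qmat \<Rightarrow> bool" where
  "hermitian q n A \<longleftrightarrow> (\<forall>x\<in>strings q n. \<forall>y\<in>strings q n. A x y = cnj (A y x))"

definition psd :: "nat \<Rightarrow> nat \<Rightarrow> qmat \<Rightarrow> bool" where
  "psd q n A \<longleftrightarrow> hermitian q n A \<and> (\<forall>v\<in>vecs q n. Re (expect q n A v) \<ge> 0)"

definition mat_le :: "nat \<Rightarrow> nat \<Rightarrow> qmat \<Rightarrow> qmat \<Rightarrow> bool" where
  "mat_le q n A B \<longleftrightarrow> psd q n (\<lambda>x y. B x y - A x y)"

definition zero_mat :: qmat where
  "zero_mat = (\<lambda>x y. 0)"

definition id_mat :: qmat where
  "id_mat = (\<lambda>x y. if x = y then 1 else 0)"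

definition eigenspace :: "nat \<Rightarrow> nat \<Rightarrow> qmat \<Rightarrow> real \<Rightarrow> qvec set" where
  "eigenspace q n A l = {v \<in> vecs q n. mapply q n A v = (\<lambda>x. of_real l * v x)}"

definition is_eigenvalue :: "nat \<Rightarrow> nat \<Rightarrow> qmat \<Rightarrow> real \<Rightarrow> bool" where
  "is_eigenvalue q n A l \<longleftrightarrow> (\<exists>v\<in>eigenspace q n A l. v \<noteq> (\<lambda>x. 0))"

definition is_min_eigenvalue :: "nat \<Rightarrow> nat \<Rightarrow> qmat \<Rightarrow> real \<Rightarrow> bool" where
  "is_min_eigenvalue q n A l \<longleftrightarrow>
     is_eigenvalue q n A l \<and> (\<forall>l'. is_eigenvalue q n A l' \<longrightarrow> l \<le> l')"

definition groundspace :: "nat \<Rightarrow> nat \<Rightarrow> qmat \<Rightarrow> qvec set" where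
  "groundspace q n A = {v. \<exists>l. is_min_eigenvalue q n A l \<and> v \<in> eigenspace q n A l}"

definition is_orth_projector :: "nat \<Rightarrow> nat \<Rightarrow> qmat \<Rightarrow> qvec set \<Rightarrow> bool" where
  "is_orth_projector q n P W \<longleftrightarrow>
     (\<forall>v\<in>W. mapply q n P v = v) \<and>
     (\<forall>v\<in>vecs q n. (\<forall>w\<in>W. iprod q n w v = 0) \<longrightarrow> mapply q n P v = (\<lambda>x. 0))"

definition stoquastic_mat :: "nat \<Rightarrow> nat \<Rightarrow> qmat \<Rightarrow> bool" where
  "stoquastic_mat q n A \<longleftrightarrow>
     (\<forall>x\<in>strings q n. \<forall>y\<in>strings q n. x \<noteq> y \<longrightarrow> A x y \<in> \<real> \<and> Re (A x y) \<le> 0)"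

definition uniform_mat :: "nat \<Rightarrow> nat \<Rightarrow> qmat \<Rightarrow> bool" where
  "uniform_mat q n A \<longleftrightarrow>
     (\<exists>\<T>. (\<forall>T\<in>\<T>. T \<noteq> {} \<and> T \<subseteq> strings q n) \<and> disjoint \<T> \<and>
        is_orth_projector q n (\<lambda>x y. \<Sum>T\<in>\<T>. subset_state T x * cnj (subset_state T y))
          (groundspace q n A))"

text \<open>\<open>A = I \<otimes> B\<close> with the identity on the qudit at position \<open>p\<close>.\<close>

definition remove_pos :: "nat \<Rightarrow> 'a list \<Rightarrow> 'a list" where
  "remove_pos p x = take p x @ drop (Suc p) x"

definition acts_trivially_at :: "nat \<Rightarrow> nat \<Rightarrow> qmat \<Rightarrow> nat \<Rightarrow> bool" where
  "acts_trivially_at q n A p \<longleftrightarrow>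
     (\<exists>B :: qmat. \<forall>x\<in>strings q n. \<forall>y\<in>strings q n.
        A x y = (if x ! p = y ! p then B (remove_pos p x) (remove_pos p y) else 0))"


section \<open>Local Hamiltonians\<close>

text \<open>
  A matrix entry is a Gaussian rational \<open>(a + b \<i>) / c\<close>, given by integers \<open>a\<close>, \<open>b\<close> and a positive
  integer \<open>c\<close>. The list \<open>qudits\<close> enumerates the set \<open>Q\<^sub>i\<close> in the order in which the matrix
  refers to the tensor factors.
\<close>

type_synonym entry = "int \<times> int \<times> nat"

fun entry_val :: "entry \<Rightarrow> complex" where
  "entry_val (a, b, c) = Complex (of_int a / of_nat c) (of_int b / of_nat c)"

record local_term =
  qudits :: "nat list"
  entries :: "nat list \<Rightarrow> nat list \<Rightarrow> entry"

record hamiltonian =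
  num_qudits :: nat
  local_terms :: "local_term list"

definition term_mat :: "local_term \<Rightarrow> qmat" where
  "term_mat t = (\<lambda>x y. entry_val (entries t x y))"

definition lift_mat :: "nat \<Rightarrow> nat list \<Rightarrow> qmat \<Rightarrow> qmat" where
  "lift_mat n Q A = (\<lambda>x y.
     if \<forall>j<n. j \<notin> set Q \<longrightarrow> x ! j = y ! j then A (map ((!) x) Q) (map ((!) y) Q) else 0)"

definition lifted_term :: "hamiltonian \<Rightarrow> local_term \<Rightarrow> qmat" where
  "lifted_term H t = lift_mat (num_qudits H) (qudits t) (term_mat t)"

definition ham_mat :: "hamiltonian \<Rightarrow> qmat" where
  "ham_mat H = (\<lambda>x y.
     (\<Sum>t\<leftarrow>local_terms H. lifted_term H t x y) / of_nat (length (local_terms H)))"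

definition acts_nontrivially_on :: "nat \<Rightarrow> nat \<Rightarrow> local_term \<Rightarrow> nat \<Rightarrow> bool" where
  "acts_nontrivially_on q k t v \<longleftrightarrow>
     (\<exists>p<k. qudits t ! p = v \<and> \<not> acts_trivially_at q k (term_mat t) p)"

definition bounded_degree :: "nat \<Rightarrow> nat \<Rightarrow> nat \<Rightarrow> hamiltonian \<Rightarrow> bool" where
  "bounded_degree q k d H \<longleftrightarrow>
     (\<forall>v<num_qudits H.
        card {i. i < length (local_terms H) \<and> acts_nontrivially_on q k (local_terms H ! i) v} \<le> d)"

definition local_term_ok :: "nat \<Rightarrow> nat \<Rightarrow> nat \<Rightarrow> local_term \<Rightarrow> bool" where
  "local_term_ok q k n t \<longleftrightarrow>
     length (qudits t) = k \<and> distinct (qudits t) \<and> set (qudits t) \<subseteq> {..<n} \<and>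
     (\<forall>x\<in>strings q k. \<forall>y\<in>strings q k. snd (snd (entries t x y)) > 0) \<and>
     hermitian q k (term_mat t) \<and>
     mat_le q k zero_mat (term_mat t) \<and> mat_le q k (term_mat t) id_mat"

definition stoquastic :: "nat \<Rightarrow> nat \<Rightarrow> hamiltonian \<Rightarrow> bool" where
  "stoquastic q k H \<longleftrightarrow> (\<forall>t\<in>set (local_terms H). stoquastic_mat q k (term_mat t))"

definition uniform :: "nat \<Rightarrow> nat \<Rightarrow> hamiltonian \<Rightarrow> bool" where
  "uniform q k H \<longleftrightarrow> (\<forall>t\<in>set (local_terms H). uniform_mat q k (term_mat t))"

definition frustration_free :: "nat \<Rightarrow> hamiltonian \<Rightarrow> bool" where
  "frustration_free q H \<longleftrightarrow>
     (\<exists>\<psi>\<in>states q (num_qudits H). \<forall>t\<in>set (local_terms H).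
        expect q (num_qudits H) (lifted_term H t) \<psi> = 0)"

definition frustrated :: "nat \<Rightarrow> real \<Rightarrow> hamiltonian \<Rightarrow> bool" where
  "frustrated q \<epsilon> H \<longleftrightarrow>
     (\<forall>\<psi>\<in>states q (num_qudits H). Re (expect q (num_qudits H) (ham_mat H) \<psi>) \<ge> \<epsilon>)"


section \<open>Encoding of instances\<close>

text \<open>
  A bit \<open>b\<close> of the payload is written as the pair \<open>0b\<close>; the pair \<open>11\<close> ends a number. Hence numbers
  are self-delimiting, and since every term contributes the same number of numbers (determined by
  \<open>q\<close> and \<open>k\<close>), the encoding is uniquely decodable and the number of terms need not be stored.
\<close>

fun binary :: "nat \<Rightarrow> bool list" where \<comment> \<open>least significant bit first, no leading zeros\<close>
  "binary n = (if n = 0 then [] else odd n # binary (n div 2))"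

declare binary.simps [simp del]

definition enc_nat :: "nat \<Rightarrow> bool list" where
  "enc_nat n = concat (map (\<lambda>b. [False, b]) (binary n)) @ [True, True]"

definition enc_int :: "int \<Rightarrow> bool list" where
  "enc_int z = [False, z < 0] @ enc_nat (nat \<bar>z\<bar>)"

fun enc_entry :: "entry \<Rightarrow> bool list" where
  "enc_entry (a, b, c) = enc_int a @ enc_int b @ enc_nat c"

definition enc_term :: "nat \<Rightarrow> nat \<Rightarrow> local_term \<Rightarrow> bool list" where
  "enc_term q k t =
     concat (map enc_nat (qudits t)) @
     concat (map (\<lambda>x. concat (map (\<lambda>y. enc_entry (entries t x y)) (List.n_lists k [0..<q])))
       (List.n_lists k [0..<q]))"

definition encode :: "nat \<Rightarrow> nat \<Rightarrow> hamiltonian \<Rightarrow> bool list" where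
  "encode q k H = enc_nat (num_qudits H) @ concat (map (enc_term q k) (local_terms H))"


section \<open>The promise problem\<close>

text \<open>
  The polynomials \<open>a\<close> and \<open>b\<close> bound, in terms of the number of qudits, the number of terms and the
  number of bits of each matrix entry.
\<close>

definition instances :: "nat \<Rightarrow> nat \<Rightarrow> nat \<Rightarrow> nat poly \<Rightarrow> nat poly \<Rightarrow> hamiltonian set" where
  "instances q k d a b = {H.
     num_qudits H \<le> length (local_terms H) \<and>
     length (local_terms H) \<le> poly a (num_qudits H) \<and>
     (\<forall>t\<in>set (local_terms H). local_term_ok q k (num_qudits H) t \<and>
        (\<forall>x\<in>strings q k. \<forall>y\<in>strings q k.
           length (enc_entry (entries t x y)) \<le> poly b (num_qudits H))) \<and>
     bounded_degree q k d H \<and> stoquastic q k H \<and> uniform q k H}"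

definition uniform_stoquastic_problem ::
  "nat \<Rightarrow> real \<Rightarrow> nat \<Rightarrow> nat \<Rightarrow> nat poly \<Rightarrow> nat poly \<Rightarrow> promise_problem" where
  "uniform_stoquastic_problem q \<epsilon> k d a b =
     (encode q k ` {H \<in> instances q k d a b. frustration_free q H},
      encode q k ` {H \<in> instances q k d a b. frustrated q \<epsilon> H})"

end

(* A subset state |S> has as energy the average over S of the row sums of the terms, restricted to S.
   If all row sums on S are small but the energy is not, many terms can be used to leave S. Applying
   one such term after the other, each time one whose support is disjoint from those already used,
   multiplies the size of S by a factor exponential in m in a single layer of non-overlapping terms;
   since m >= n, only constantly many layers are possible. Hence for an epsilon-frustrated Hamiltonian a
   string with a large row sum can be reached from every string, and by a light-cone argument in a
   constant number L of moves. For a frustration-free one the support of a groundstate is closed under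
   moves and all its row sums vanish.

   The witness is a string in that support, given by its restriction to each term (a marked row of
   the matrix). The verifier runs over all (L+1)-tuples of terms; whether L moves can lead to a bad row
   depends only on a bounded amount of data: equalities between qudit indices, marks, signs of entries
   and their values up to a constant precision 1/D. *)

theory Submission
  imports Defs
begin

section \<open>Structured programs for Turing machines\<close>

text \<open>A layer contains linearly many moves, far too many to be followed one by one. What saves
  the argument is that only views count: a row sum depends on \<open>k\<close> qudits, a move on the
  support of its term. As the supports within a layer are disjoint, a view of \<open>e\<close>
  qudits depends on at most \<open>e\<close> moves of the layer and on \<open>(k + 1) * e\<close>
  qudits before it, which stays bounded over \<open>T\<close> layers. With overlapping supports the
  chain of dependencies could be as long as the layer itself.

  The threshold \<epsilon>/4 for row sums comes from a budget: small row sums, compatible terms with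
  few strings leaving S, and terms in conflict with the layer each account for a quarter of the
  energy, so a quarter is left for the contradiction.

  The machine model shapes the verifier. The marks are witness bits aligned with the instance, so no
  addresses are computed; that all marks come from one string is again a condition on pairs of
  terms. An entry a/c is compared with j/D by testing D a \<le> j c with a bounded carry, and the
  gap between 0 and \<epsilon>/4 makes such comparisons sufficient.\<close>

datatype 'r prog =
    Act "'r \<Rightarrow> nat list \<Rightarrow> 'r \<times> (nat \<times> dir) list"
  | Seq "'r prog" "'r prog"
  | Cond "'r \<Rightarrow> nat list \<Rightarrow> bool" "'r prog" "'r prog"
  | While "'r \<Rightarrow> nat list \<Rightarrow> bool" "'r prog"

definition idle :: "nat list \<Rightarrow> (nat \<times> dir) list" where
  "idle syms = map (\<lambda>s. (s, Stay)) syms"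

text \<open>One machine step on a stack of pending programs. Control constructs take a step of their
  own that leaves the tapes unchanged, so a transition depends only on the top of the stack, the
  register and the scanned symbols.\<close>

fun unwind :: "'r prog list \<Rightarrow> 'r \<Rightarrow> nat list \<Rightarrow> 'r prog list \<times> 'r \<times> (nat \<times> dir) list" where
  "unwind [] r syms = ([], r, idle syms)"
| "unwind (Act f # cs) r syms = (cs, f r syms)"
| "unwind (Seq P Q # cs) r syms = (P # Q # cs, r, idle syms)"
| "unwind (Cond b P Q # cs) r syms = ((if b r syms then P else Q) # cs, r, idle syms)"
| "unwind (While b P # cs) r syms = (if b r syms then P # While b P # cs else cs, r, idle syms)"

text \<open>Programs have no recursion, so the depth of the stack is bounded by their nesting and
  finitely many stacks suffice. Together with the registers these stacks become the control states
  of the machine.\<close>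

primrec conts :: "'r prog \<Rightarrow> 'r prog list set" where
  "conts (Act f) = {[Act f]}"
| "conts (Seq P Q) = insert [Seq P Q] ((\<lambda>c. c @ [Q]) ` conts P \<union> conts Q)"
| "conts (Cond b P Q) = insert [Cond b P Q] (conts P \<union> conts Q)"
| "conts (While b P) = insert [While b P] ((\<lambda>c. c @ [While b P]) ` conts P)"

definition stacks :: "'r prog \<Rightarrow> 'r prog list set" where
  "stacks P = insert [] (conts P)"

lemma finite_stacks: "finite (stacks P)"
proof -
  have "finite (conts P)" by (induction P) auto
  then show ?thesis by (simp add: stacks_def)
qed

lemma self_in_conts: "[P] \<in> conts P"
  by (cases P) auto

lemma conts_nonempty: "[] \<notin> conts P"
  by (induction P) auto

lemma unwind_append:
  "c \<noteq> [] \<Longrightarrow> fst (unwind (c @ cs) r syms) = fst (unwind c r syms) @ cs"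
  by (cases "(c, r, syms)" rule: unwind.cases) auto

lemma unwind_conts: "c \<in> conts P \<Longrightarrow> fst (unwind c r syms) \<in> stacks P"
proof (induction P arbitrary: c)
  case (Act f)
  then show ?case by (simp add: stacks_def)
next
  case (Seq P Q)
  consider "c = [Seq P Q]" | c' where "c' \<in> conts P" "c = c' @ [Q]" | "c \<in> conts Q"
    using Seq.prems by auto
  then show ?case
  proof cases
    case 1
    then show ?thesis using self_in_conts[of P] by (auto simp: stacks_def image_iff)
  next
    case 2
    then have "c' \<noteq> []" using conts_nonempty by metis
    then show ?thesis using 2 Seq.IH(1)[OF 2(1)] self_in_conts[of Q]
      by (auto simp: stacks_def unwind_append)
  next
    case 3
    then show ?thesis using Seq.IH(2) by (auto simp: stacks_def)
  qed
next
  case (Cond b P Q)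
  then show ?case using self_in_conts[of P] self_in_conts[of Q] by (auto simp: stacks_def)
next
  case (While b P)
  consider "c = [While b P]" | c' where "c' \<in> conts P" "c = c' @ [While b P]"
    using While.prems by auto
  then show ?case
  proof cases
    case 1
    then show ?thesis using self_in_conts[of P] by (auto simp: stacks_def image_iff)
  next
    case 2
    then have "c' \<noteq> []" using conts_nonempty by metis
    then show ?thesis using 2 While.IH[OF 2(1)]
      by (auto simp: stacks_def unwind_append)
  qed
qed

lemma unwind_stacks: "c \<in> stacks P \<Longrightarrow> fst (unwind c r syms) \<in> stacks P"
  using unwind_conts[of c P] by (auto simp: stacks_def)

section \<open>Timed executions and their compilation to Turing machines\<close>

locale programs =
  fixes nt ns :: nat and RS :: "'r set"
  assumes finite_RS: "finite RS" and nt: "nt \<ge> 2" and ns: "ns \<ge> 3"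
begin

text \<open>The requirements on an action are imposed only where it is executed. An action may
  therefore misbehave on registers and symbols that never occur.\<close>

inductive exec :: "'r prog \<Rightarrow> 'r \<times> tape list \<Rightarrow> nat \<Rightarrow> 'r \<times> tape list \<Rightarrow> bool" where
  exec_Act: "f r (map scan tps) = (r', as) \<Longrightarrow> r' \<in> RS \<Longrightarrow> length as = nt \<Longrightarrow>
     (set (map scan tps) \<subseteq> {..<ns} \<Longrightarrow> fst ` set as \<subseteq> {..<ns}) \<Longrightarrow>
     exec (Act f) (r, tps) (Suc 0) (r', map2 act tps as)"
| exec_Seq: "exec P s t1 s' \<Longrightarrow> exec Q s' t2 s'' \<Longrightarrow> exec (Seq P Q) s (Suc (t1 + t2)) s''"
| exec_CondT: "b r (map scan tps) \<Longrightarrow> exec P (r, tps) t s' \<Longrightarrow> exec (Cond b P Q) (r, tps) (Suc t) s'"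
| exec_CondF: "\<not> b r (map scan tps) \<Longrightarrow> exec Q (r, tps) t s' \<Longrightarrow> exec (Cond b P Q) (r, tps) (Suc t) s'"
| exec_WhileF: "\<not> b r (map scan tps) \<Longrightarrow> exec (While b P) (r, tps) (Suc 0) (r, tps)"
| exec_WhileT: "b r (map scan tps) \<Longrightarrow> exec P (r, tps) t1 s' \<Longrightarrow> exec (While b P) s' t2 s'' \<Longrightarrow>
     exec (While b P) (r, tps) (Suc (t1 + t2)) s''"

definition space :: "'r prog \<Rightarrow> ('r prog list \<times> 'r) set" where
  "space P = stacks P \<times> RS"

text \<open>Stacks contain functions, so no explicit numbering is at hand; any bijection from the
  finite set of stacks and registers to an initial segment will do.\<close>

definition code :: "'r prog \<Rightarrow> 'r prog list \<times> 'r \<Rightarrow> nat" where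
  "code P = (SOME f. bij_betw f (space P) {..<card (space P)})"

lemma finite_space: "finite (space P)"
  by (simp add: space_def finite_stacks finite_RS)

lemma bij_code: "bij_betw (code P) (space P) {..<card (space P)}"
proof -
  have "\<exists>f. bij_betw f (space P) {..<card (space P)}"
    using ex_bij_betw_finite_nat[OF finite_space] by (simp add: lessThan_atLeast0)
  then show ?thesis unfolding code_def by (rule someI_ex)
qed

lemma code_less: "c \<in> space P \<Longrightarrow> code P c < card (space P)"
  using bij_code[of P] by (auto simp: bij_betw_def)

lemma decode: "c \<in> space P \<Longrightarrow> inv_into (space P) (code P) (code P c) = c"
  using bij_code[of P] by (auto simp: bij_betw_def)

text \<open>An empty stack halts with the verdict of \<open>accept\<close>. A transition that would
  leave \<open>space P\<close> or the alphabet is redirected to rejection, so every program yields a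
  well-formed machine and correctness is a matter of \<open>exec\<close> alone.\<close>

definition compile :: "'r prog \<Rightarrow> 'r \<Rightarrow> ('r \<Rightarrow> bool) \<Rightarrow> tm" where
  "compile P r0 accept = \<lparr>
     num_tapes = nt, num_syms = ns, num_states = card (space P) + 2,
     start_state = code P ([P], r0), acc_state = card (space P), rej_state = Suc (card (space P)),
     trans = (\<lambda>s syms.
       if s < card (space P) then
         let (cs, r) = inv_into (space P) (code P) s;
             (cs', r', as) = unwind cs r syms
         in if cs = [] then (if accept r then card (space P) else Suc (card (space P)), idle syms)
            else if (cs', r') \<in> space P \<and> (length syms = nt \<longrightarrow> length as = nt) \<and>
                    (set syms \<subseteq> {..<ns} \<longrightarrow> fst ` set as \<subseteq> {..<ns})
            then (code P (cs', r'), as) else (Suc (card (space P)), idle syms)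
       else (Suc (card (space P)), idle syms)) \<rparr>"

lemma wf_compile: "r0 \<in> RS \<Longrightarrow> wf_tm (compile P r0 accept)"
proof -
  assume r0: "r0 \<in> RS"
  have start: "([P], r0) \<in> space P"
    using r0 self_in_conts[of P] by (simp add: space_def stacks_def)
  have idle: "length (idle syms) = length syms" "fst ` set (idle syms) = set syms"
    "(a, b) \<in> set (idle syms) \<Longrightarrow> a \<in> set syms" for syms a b
    by (auto simp: idle_def image_iff)
  show ?thesis
    unfolding wf_tm_def compile_def
    using code_less[OF start] nt ns
    by (auto simp: Let_def idle(1,2) simp del: inv_into_f_f split: prod.splits if_splits dest: code_less dest!: idle(3))
qed

lemma map2_act_idle: "map2 act tps (idle (map scan tps)) = tps"
proof -
  have "act tp (scan tp, Stay) = tp" for tp by (cases tp) auto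
  then show ?thesis by (simp add: idle_def map2_map_map[of act "\<lambda>x. x", simplified] comp_def map_idI)
qed

lemma step_compile:
  assumes "(cs, r) \<in> space P" "cs \<noteq> []" "unwind cs r (map scan tps) = (cs', r', as)"
    and "r' \<in> RS" "length tps = nt" "length as = nt"
    and "set (map scan tps) \<subseteq> {..<ns} \<Longrightarrow> fst ` set as \<subseteq> {..<ns}"
  shows "step (compile P r0 accept) (code P (cs, r), tps) = (code P (cs', r'), map2 act tps as)"
    "(cs', r') \<in> space P"
proof -
  have "cs' \<in> stacks P"
    using unwind_stacks[of cs P r "map scan tps"] assms(1,3) by (simp add: space_def)
  then show *: "(cs', r') \<in> space P" using assms by (simp add: space_def)
  have "\<not> halting (compile P r0 accept) (code P (cs, r), tps)"
    using code_less[OF assms(1)] by (simp add: halting_def compile_def)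
  moreover have "trans (compile P r0 accept) (code P (cs, r)) (map scan tps) = (code P (cs', r'), as)"
    using code_less[OF assms(1)] decode[OF assms(1)] assms *
    by (simp add: compile_def)
  ultimately show "step (compile P r0 accept) (code P (cs, r), tps) = (code P (cs', r'), map2 act tps as)"
    by (simp add: step_def)
qed

lemma step_compile_idle:
  assumes "(cs, r) \<in> space P" "cs \<noteq> []" "unwind cs r (map scan tps) = (cs', r, idle (map scan tps))"
    and "length tps = nt"
  shows "step (compile P r0 accept) (code P (cs, r), tps) = (code P (cs', r), tps)"
    "(cs', r) \<in> space P"
  using step_compile[OF assms(1-3)] assms(1,4) map2_act_idle[of tps]
  by (auto simp: idle_def space_def image_iff subset_iff)

lemma funpow_split: "(f ^^ Suc (a + b)) x = (f ^^ b) ((f ^^ a) (f x))"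
  by (metis add.commute funpow_add comp_apply funpow_Suc_right)

text \<open>The continuation \<open>cs\<close> is arbitrary because the parts of a sequence and the
  body of a loop run with the rest of that program below them on the stack.\<close>

lemma exec_compile:
  assumes "exec P s t s'" "(P # cs, fst s) \<in> space P0" "length (snd s) = nt"
  shows "(step (compile P0 r0 accept) ^^ t) (code P0 (P # cs, fst s), snd s)
      = (code P0 (cs, fst s'), snd s') \<and> (cs, fst s') \<in> space P0 \<and> length (snd s') = nt"
  using assms
proof (induction arbitrary: cs)
  case (exec_Act f r tps r' as)
  show ?case
    using step_compile[of "Act f # cs" r P0 tps cs r' as] exec_Act by simp
next
  case (exec_Seq P s t1 s' Q t2 s'')
  obtain r tps where s: "s = (r, tps)" by (cases s)
  have 1: "step (compile P0 r0 accept) (code P0 (Seq P Q # cs, r), tps) = (code P0 (P # Q # cs, r), tps)"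
      "(P # Q # cs, r) \<in> space P0"
    using step_compile_idle[of "Seq P Q # cs" r P0 tps "P # Q # cs"] exec_Seq.prems s by auto
  note 2 = exec_Seq.IH(1)[of "Q # cs", unfolded s, simplified, OF 1(2)]
  then show ?case using exec_Seq.IH(2)[of cs] exec_Seq.prems 1 s
    by (simp add: funpow_split s del: funpow.simps)
next
  case (exec_CondT b r tps P t s' Q)
  then show ?case
    using step_compile_idle[of "Cond b P Q # cs" r P0 tps "P # cs"]
    by (simp add: funpow_Suc_right del: funpow.simps)
next
  case (exec_CondF b r tps Q t s' P)
  then show ?case
    using step_compile_idle[of "Cond b P Q # cs" r P0 tps "Q # cs"]
    by (simp add: funpow_Suc_right del: funpow.simps)
next
  case (exec_WhileF b r tps P)
  then show ?case
    using step_compile_idle[of "While b P # cs" r P0 tps "cs"]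
    by simp
next
  case (exec_WhileT b r tps P t1 s' t2 s'')
  have 1: "step (compile P0 r0 accept) (code P0 (While b P # cs, r), tps) = (code P0 (P # While b P # cs, r), tps)"
      "(P # While b P # cs, r) \<in> space P0"
    using step_compile_idle[of "While b P # cs" r P0 tps "P # While b P # cs"] exec_WhileT by auto
  note 2 = exec_WhileT.IH(1)[of "While b P # cs", simplified, OF 1(2)]
  then show ?case using exec_WhileT.IH(2)[of cs] exec_WhileT.prems 1
    by (simp add: funpow_split del: funpow.simps)
qed

end

section \<open>Programs for several heads on copies of one word\<close>

lemma poly_nat_mono: "m \<le> n \<Longrightarrow> poly (p :: nat poly) m \<le> poly p n"
  by (induction p) (auto intro!: add_mono mult_mono)

definition cells :: "nat list \<Rightarrow> int \<Rightarrow> nat" where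
  "cells V = (\<lambda>i. if 0 \<le> i \<and> i < int (length V) then V ! nat i else 0)"

definition sym :: "nat list \<Rightarrow> nat \<Rightarrow> nat" where
  "sym V p = (if p < length V then V ! p else 0)"

lemma cells_sym [simp]: "cells V (int p) = sym V p"
  by (simp add: cells_def sym_def)

lemma cells_snoc: "(cells V)(int (length V) := a) = cells (V @ [a])"
  by (auto simp: cells_def fun_eq_iff nth_append)

lemma cells_idem [simp]: "(cells V)(int p := sym V p) = cells V"
  by (auto simp: fun_eq_iff)

fun mealy :: "('r \<Rightarrow> bool \<Rightarrow> bool \<Rightarrow> 'r \<times> nat option) \<Rightarrow> 'r \<Rightarrow> (bool \<times> bool) list \<Rightarrow> 'r \<times> nat list" where
  "mealy \<delta> r [] = (r, [])"
| "mealy \<delta> r ((b, c) # zs) =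
     (let (r', e) = \<delta> r b c; (r'', out) = mealy \<delta> r' zs
      in (r'', (case e of None \<Rightarrow> [] | Some a \<Rightarrow> [a]) @ out))"

text \<open>The witness is read in lockstep with the instance: missing bits count as False and
  surplus bits are dropped.\<close>

definition zip_pad :: "bool list \<Rightarrow> bool list \<Rightarrow> (bool \<times> bool) list" where
  "zip_pad x w = map (\<lambda>i. (x ! i, i < length w \<and> w ! i)) [0..<length x]"

type_synonym 'r sem = "nat list \<Rightarrow> 'r \<times> (nat \<Rightarrow> nat) \<Rightarrow> 'r \<times> (nat \<Rightarrow> nat)"

definition shift :: "(nat \<Rightarrow> dir) \<Rightarrow> (nat \<Rightarrow> nat) \<Rightarrow> nat \<Rightarrow> nat" where
  "shift M pos = (\<lambda>u. case M u of MoveL \<Rightarrow> pos u - 1 | Stay \<Rightarrow> pos u | MoveR \<Rightarrow> Suc (pos u))"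

text \<open>Besides the instance and witness tapes there are \<open>h\<close> tapes. After loading
  they all carry the same word and only their heads move, so they act as \<open>h\<close> read heads
  on one word.\<close>

locale heads =
  fixes h nt ns :: nat and RS :: "'r set"
  assumes finite_RS': "finite RS" and ns': "ns \<ge> 3" and h: "h \<ge> 1" and nt_h: "nt = h + 2"
begin

sublocale programs nt ns RS
  by unfold_locales (use finite_RS' ns' nt_h in auto)

definition lm :: nat where
  "lm = ns - 1"

text \<open>Blanks occur only beyond the word and \<open>lm\<close> only at its start, so both ends
  are recognised from the scanned symbol alone.\<close>

definition marked :: "nat list \<Rightarrow> bool" where
  "marked V \<longleftrightarrow> (\<exists>W. V = lm # W \<and> set W \<subseteq> {1..<lm})"

definition tps :: "tape list \<Rightarrow> nat list \<Rightarrow> (nat \<Rightarrow> nat) \<Rightarrow> tape list" where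
  "tps ab V pos = ab @ map (\<lambda>u. (int (pos u), cells V)) [0..<h]"

abbreviation conf :: "tape list \<Rightarrow> nat list \<Rightarrow> 'r \<times> (nat \<Rightarrow> nat) \<Rightarrow> 'r \<times> tape list" where
  "conf ab V s \<equiv> (fst s, tps ab V (snd s))"

definition scans :: "nat list \<Rightarrow> (nat \<Rightarrow> nat) \<Rightarrow> nat \<Rightarrow> nat" where
  "scans V pos = (\<lambda>u. if u < h then sym V (pos u) else 0)"

definition head_syms :: "nat list \<Rightarrow> nat \<Rightarrow> nat" where
  "head_syms syms = (\<lambda>u. if u < h then syms ! (u + 2) else 0)"

lemma scan_tps: "map scan (tps ab V pos) = map scan ab @ map (\<lambda>u. sym V (pos u)) [0..<h]"
  by (simp add: tps_def)

lemma head_syms_tps [simp]: "length ab = 2 \<Longrightarrow> head_syms (map scan (tps ab V pos)) = scans V pos"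
  by (auto simp: scan_tps head_syms_def scans_def fun_eq_iff nth_append)

lemma marked_facts:
  assumes "marked V"
  shows "sym V 0 = lm" "0 < p \<Longrightarrow> sym V p \<noteq> lm" "sym V p = 0 \<longleftrightarrow> length V \<le> p" "V \<noteq> []"
proof -
  obtain W where V: "V = lm # W" "set W \<subseteq> {1..<lm}" using assms by (auto simp: marked_def)
  have W: "W ! i \<in> {1..<lm}" if "i < length W" for i
    using V(2) that nth_mem by blast
  show "sym V 0 = lm" "V \<noteq> []" by (simp_all add: V sym_def)
  show "0 < p \<Longrightarrow> sym V p \<noteq> lm" using ns' W[of "p - 1"] by (cases p) (auto simp: V sym_def lm_def)
  show "sym V p = 0 \<longleftrightarrow> length V \<le> p"
    using ns' W[of "p - 1"] by (cases p) (auto simp: V sym_def lm_def)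
qed

definition Go :: "('r \<Rightarrow> (nat \<Rightarrow> nat) \<Rightarrow> 'r) \<Rightarrow> ((nat \<Rightarrow> nat) \<Rightarrow> nat \<Rightarrow> dir) \<Rightarrow> 'r prog" where
  "Go g M = Act (\<lambda>r syms. (g r (head_syms syms),
     map (\<lambda>i. (syms ! i, if i < 2 then Stay else M (head_syms syms) (i - 2))) [0..<nt]))"

lemma exec_Go:
  assumes ab: "length ab = 2"
    and left: "\<forall>u<h. M (scans V pos) u = MoveL \<longrightarrow> 0 < pos u"
    and r': "g r (scans V pos) \<in> RS"
  shows "exec (Go g M) (r, tps ab V pos) (Suc 0)
           (g r (scans V pos), tps ab V (shift (M (scans V pos)) pos))"
proof -
  let ?syms = "map scan (tps ab V pos)"
  let ?as = "map (\<lambda>i. (?syms ! i, if i < 2 then Stay else M (scans V pos) (i - 2))) [0..<nt]"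
  have len: "length (tps ab V pos) = nt" using ab nt_h by (simp add: tps_def)
  have stay: "act tp (scan tp, Stay) = tp" for tp by (cases tp) auto
  have "exec (Go g M) (r, tps ab V pos) (Suc 0) (g r (scans V pos), map2 act (tps ab V pos) ?as)"
    unfolding Go_def
  proof (rule exec_Act)
    show "(g r (head_syms ?syms),
      map (\<lambda>i. (?syms ! i, if i < 2 then Stay else M (head_syms ?syms) (i - 2))) [0..<nt]) =
      (g r (scans V pos), ?as)" using ab by simp
    show "g r (scans V pos) \<in> RS" by (fact r')
    show "length ?as = nt" by simp
    assume *: "set ?syms \<subseteq> {..<ns}"
    have "?syms ! i < ns" if "i < nt" for i
      using * len that by (metis length_map lessThan_iff nth_mem subsetD)
    then show "fst ` set ?as \<subseteq> {..<ns}" by auto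
  qed
  moreover have "map2 act (tps ab V pos) ?as = tps ab V (shift (M (scans V pos)) pos)"
  proof (rule nth_equalityI)
    show "length (map2 act (tps ab V pos) ?as) = length (tps ab V (shift (M (scans V pos)) pos))"
      using ab nt_h by (simp add: tps_def)
    fix i assume "i < length (map2 act (tps ab V pos) ?as)"
    then have i: "i < nt" using len by simp
    show "map2 act (tps ab V pos) ?as ! i = tps ab V (shift (M (scans V pos)) pos) ! i"
    proof (cases "i < 2")
      case True
      then show ?thesis using i ab len by (simp add: stay tps_def nth_append)
    next
      case False
      then have u: "i - 2 < h" using i nt_h by simp
      show ?thesis using False i ab len u left
        by (auto simp: tps_def nth_append shift_def of_nat_diff split: dir.splits)
    qed
  qed
  ultimately show ?thesis by simp
qed

lemma shift_simps [simp]: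
  "shift ((\<lambda>_. Stay)) pos = pos"
  "shift (M(u := MoveL)) pos = (shift M pos)(u := pos u - 1)"
  "shift (M(u := MoveR)) pos = (shift M pos)(u := Suc (pos u))"
  by (auto simp: shift_def fun_eq_iff)

text \<open>Head positions serve as counters: while \<open>u\<close> runs back to the left end,
  every head that \<open>D\<close> sends to the right gains \<open>pos u\<close>. Resetting a head
  and the two loops of a copy are instances.\<close>

lemma exec_mutual:
  assumes "marked V" "length ab = 2" "r \<in> RS" "u < h" "\<And>v. D v \<noteq> MoveL" "D u = Stay"
  shows "exec (While (\<lambda>r syms. head_syms syms u \<noteq> lm) (Go (\<lambda>r s. r) (\<lambda>s. D(u := MoveL))))
      (r, tps ab V pos) (2 * pos u + 1)
      (r, tps ab V (\<lambda>v. if v = u then 0 else if D v = MoveR then pos v + pos u else pos v))"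
  using assms
proof (induction "pos u" arbitrary: pos)
  case 0
  then have "(\<lambda>v. if v = u then 0 else if D v = MoveR then pos v + pos u else pos v) = pos" by auto
  then show ?case using 0 marked_facts(1)[of V]
    by (simp add: exec_WhileF scans_def)
next
  case (Suc p)
  then have p: "pos u - 1 = p" "0 < pos u" by simp_all
  have "sym V (pos u) \<noteq> lm" using p Suc.prems marked_facts(2)[of V "pos u"] by simp
  moreover have "shift (D(u := MoveL)) pos
      = (\<lambda>v. if v = u then p else if D v = MoveR then Suc (pos v) else pos v)" (is "_ = ?pos")
  proof
    fix v show "shift (D(u := MoveL)) pos v = ?pos v"
      using p Suc.prems(5)[of v] by (cases "D v") (auto simp: shift_def)
  qed
  then have "exec (Go (\<lambda>r s. r) (\<lambda>s. D(u := MoveL))) (r, tps ab V pos) (Suc 0)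
      (r, tps ab V ?pos)"
    using exec_Go[of ab "\<lambda>s. D(u := MoveL)" V pos "\<lambda>r s. r" r] p Suc.prems
    by (auto split: if_splits)
  moreover have "(\<lambda>v. if v = u then 0 else if D v = MoveR then ?pos v + ?pos u else ?pos v) =
      (\<lambda>v. if v = u then 0 else if D v = MoveR then pos v + pos u else pos v)"
    using p by auto
  then have "exec (While (\<lambda>r syms. head_syms syms u \<noteq> lm) (Go (\<lambda>r s. r) (\<lambda>s. D(u := MoveL))))
      (r, tps ab V ?pos) (2 * p + 1)
      (r, tps ab V (\<lambda>v. if v = u then 0 else if D v = MoveR then pos v + pos u else pos v))"
    using Suc.hyps(1)[of ?pos] Suc.prems by simp
  ultimately have "exec (While (\<lambda>r syms. head_syms syms u \<noteq> lm) (Go (\<lambda>r s. r) (\<lambda>s. D(u := MoveL))))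
      (r, tps ab V pos) (Suc (Suc 0 + (2 * p + 1)))
      (r, tps ab V (\<lambda>v. if v = u then 0 else if D v = MoveR then pos v + pos u else pos v))"
    using Suc.prems by (intro exec_WhileT) (auto simp: scans_def)
  then show ?case by (simp flip: Suc.hyps(2))
qed

definition To_lm :: "nat \<Rightarrow> 'r prog" where
  "To_lm u = While (\<lambda>r syms. head_syms syms u \<noteq> lm) (Go (\<lambda>r s. r) (\<lambda>s. (\<lambda>_. Stay)(u := MoveL)))"

lemma exec_To_lm:
  assumes "marked V" "length ab = 2" "r \<in> RS" "u < h"
  shows "exec (To_lm u) (r, tps ab V pos) (2 * pos u + 1) (r, tps ab V (pos(u := 0)))"
proof -
  have "(\<lambda>v. if v = u then 0 else if Stay = MoveR then pos v + pos u else pos v) = pos(u := 0)" by auto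
  then show ?thesis using exec_mutual[OF assms, where D = "\<lambda>_. Stay" and pos = pos] by (simp add: To_lm_def)
qed

text \<open>Head 0 is an auxiliary head: it records the position of \<open>u\<close> while \<open>u\<close> returns to the
  left end.\<close>

definition Copy :: "nat \<Rightarrow> nat \<Rightarrow> 'r prog" where
  "Copy v u = Seq (Seq (To_lm v) (To_lm 0))
     (Seq (While (\<lambda>r syms. head_syms syms u \<noteq> lm)
             (Go (\<lambda>r s. r) (\<lambda>s. (\<lambda>_. Stay)(0 := MoveR, u := MoveL))))
          (While (\<lambda>r syms. head_syms syms 0 \<noteq> lm)
             (Go (\<lambda>r s. r) (\<lambda>s. (\<lambda>_. Stay)(u := MoveR, v := MoveR, 0 := MoveL)))))"

lemma exec_Copy:
  assumes "marked V" "length ab = 2" "r \<in> RS" "u < h" "v < h" "u \<noteq> v" "u \<noteq> 0" "v \<noteq> 0"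
  shows "exec (Copy v u) (r, tps ab V pos) (2 * pos v + 2 * pos 0 + 4 * pos u + 7)
    (r, tps ab V (pos(v := pos u, 0 := 0)))"
proof -
  let ?pos = "pos(v := 0, 0 := 0)"
  have 1: "exec (Seq (To_lm v) (To_lm 0)) (r, tps ab V pos) (2 * pos v + 2 * pos 0 + 3) (r, tps ab V ?pos)"
    using exec_Seq[OF exec_To_lm[OF assms(1-3), of v pos] exec_To_lm[OF assms(1-3), of 0 "pos(v := 0)"]] assms h
    by (simp add: numeral_eq_Suc)
  have 2: "exec (While (\<lambda>r syms. head_syms syms u \<noteq> lm)
             (Go (\<lambda>r s. r) (\<lambda>s. (\<lambda>_. Stay)(0 := MoveR, u := MoveL)))) (r, tps ab V ?pos)
       (2 * pos u + 1) (r, tps ab V (pos(v := 0, 0 := pos u, u := 0)))"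
  proof -
    have "(\<lambda>w. if w = u then 0 else if ((\<lambda>_. Stay)(0 := MoveR)) w = MoveR then ?pos w + ?pos u else ?pos w)
        = pos(v := 0, 0 := pos u, u := 0)"
      using assms by auto
    then show ?thesis
      using exec_mutual[OF assms(1-4), of "(\<lambda>_. Stay)(0 := MoveR)" ?pos] assms by simp
  qed
  let ?pos' = "pos(v := 0, 0 := pos u, u := 0)"
  have 3: "exec (While (\<lambda>r syms. head_syms syms 0 \<noteq> lm)
             (Go (\<lambda>r s. r) (\<lambda>s. (\<lambda>_. Stay)(u := MoveR, v := MoveR, 0 := MoveL)))) (r, tps ab V ?pos')
       (2 * pos u + 1) (r, tps ab V (pos(v := pos u, 0 := 0)))"
  proof -
    have "(\<lambda>w. if w = 0 then 0 else if ((\<lambda>_. Stay)(u := MoveR, v := MoveR)) w = MoveR then ?pos' w + ?pos' 0 else ?pos' w)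
        = pos(v := pos u, 0 := 0)"
      using assms by auto
    then show ?thesis
      using exec_mutual[OF assms(1-3), of 0 "(\<lambda>_. Stay)(u := MoveR, v := MoveR)" ?pos'] assms h by simp
  qed
  have "Suc (2 * pos v + 2 * pos 0 + 3 + Suc (2 * pos u + 1 + (2 * pos u + 1))) =
      2 * pos v + 2 * pos 0 + 4 * pos u + 7" by simp
  then show ?thesis
    using exec_Seq[OF 1 exec_Seq[OF 2 3]] by (simp only: Copy_def)
qed

section \<open>Loops over the word and implementability in polynomial time\<close>

definition For :: "nat \<Rightarrow> 'r prog \<Rightarrow> 'r prog" where
  "For u P = Seq (To_lm u) (While (\<lambda>r syms. head_syms syms u \<noteq> 0)
     (Seq P (Go (\<lambda>r s. r) (\<lambda>s. (\<lambda>_. Stay)(u := MoveR)))))"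

definition for_step :: "nat \<Rightarrow> 'r sem \<Rightarrow> 'r sem" where
  "for_step u F V s = (let (r, pos) = F V s in (r, pos(u := Suc (pos u))))"

definition for_sem :: "nat \<Rightarrow> 'r sem \<Rightarrow> 'r sem" where
  "for_sem u F V s = (for_step u F V ^^ length V) (fst s, (snd s)(u := 0))"

definition copy_sem :: "nat \<Rightarrow> nat \<Rightarrow> 'r sem" where
  "copy_sem v u V s = (fst s, (snd s)(v := snd s u, 0 := 0))"

definition go_sem :: "('r \<Rightarrow> (nat \<Rightarrow> nat) \<Rightarrow> 'r) \<Rightarrow> ((nat \<Rightarrow> nat) \<Rightarrow> nat \<Rightarrow> bool) \<Rightarrow> 'r sem" where
  "go_sem g M V s = (g (fst s) (scans V (snd s)),
     \<lambda>u. if M (scans V (snd s)) u \<and> scans V (snd s) u \<noteq> 0 then Suc (snd s u) else snd s u)"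

definition in_range :: "nat list \<Rightarrow> 'r \<times> (nat \<Rightarrow> nat) \<Rightarrow> bool" where
  "in_range V s \<longleftrightarrow> fst s \<in> RS \<and> (\<forall>u<h. snd s u \<le> length V)"

definition runs :: "nat poly \<Rightarrow> 'r prog \<Rightarrow> 'r sem \<Rightarrow> nat list \<Rightarrow> tape list \<Rightarrow> 'r \<times> (nat \<Rightarrow> nat) \<Rightarrow> bool" where
  "runs p P F V ab s \<longleftrightarrow> in_range V (F V s) \<and>
     (\<exists>t \<le> poly p (length V). exec P (conf ab V s) t (conf ab V (F V s)))"

text \<open>The time bound is a polynomial in the length of the word alone, uniform in registers and
  positions in range. This is what makes the notion closed under sequencing, branching and
  \<open>For\<close>.\<close>

definition impl :: "'r prog \<Rightarrow> 'r sem \<Rightarrow> bool" where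
  "impl P F \<longleftrightarrow> (\<exists>p. \<forall>ab V s. length ab = 2 \<and> marked V \<and> in_range V s \<longrightarrow> runs p P F V ab s)"

lemma implI:
  assumes "\<And>(ab :: tape list) V s. length ab = 2 \<Longrightarrow> marked V \<Longrightarrow> in_range V s \<Longrightarrow> in_range V (F V s)"
    and "\<And>ab V s. length ab = 2 \<Longrightarrow> marked V \<Longrightarrow> in_range V s \<Longrightarrow> in_range V (F V s) \<Longrightarrow>
       \<exists>t \<le> poly p (length V). exec P (conf ab V s) t (conf ab V (F V s))"
  shows "impl P F"
  unfolding impl_def runs_def using assms by (intro exI[of _ p] allI impI conjI) auto

lemma implE:
  assumes "impl P F"
  obtains p where "\<And>ab V s. length ab = 2 \<Longrightarrow> marked V \<Longrightarrow> in_range V s \<Longrightarrow> runs p P F V ab s"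
  using assms unfolding impl_def by blast

text \<open>Heads move right only off a nonblank symbol, which confines every position to at most
  \<open>length V\<close>.\<close>

lemma impl_go:
  assumes "\<And>r s. r \<in> RS \<Longrightarrow> (\<And>u. s u < ns) \<Longrightarrow> g r s \<in> RS"
  shows "impl (Go g (\<lambda>s u. if M s u \<and> s u \<noteq> 0 then MoveR else Stay)) (go_sem g M)"
proof (rule implI)
  fix ab :: "tape list" and V and s :: "'r \<times> (nat \<Rightarrow> nat)"
  assume *: "length ab = 2" "marked V" "in_range V s"
  have "scans V (snd s) u < ns" for u
  proof -
    obtain W where W: "V = lm # W" "set W \<subseteq> {1..<lm}" using *(2) by (auto simp: marked_def)
    have "W ! i < ns" if "i < length W" for i
      using subsetD[OF W(2) nth_mem[OF that]] by (auto simp: lm_def)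
    then have "i < length V \<Longrightarrow> V ! i < ns" for i
      using W(1) ns' by (cases i) (auto simp: lm_def)
    then show ?thesis using ns' by (auto simp: scans_def sym_def)
  qed
  then have g: "g (fst s) (scans V (snd s)) \<in> RS" using assms * by (auto simp: in_range_def)
  then show "in_range V (go_sem g M V s)"
    using * by (auto simp: in_range_def go_sem_def scans_def sym_def split: if_splits)
  let ?M = "\<lambda>s u. if M s u \<and> s u \<noteq> 0 then MoveR else Stay"
  have "shift (?M (scans V (snd s))) (snd s) = snd (go_sem g M V s)"
    by (auto simp: shift_def go_sem_def)
  then have "exec (Go g ?M) (conf ab V s) (Suc 0) (conf ab V (go_sem g M V s))"
    using exec_Go[of ab ?M V "snd s" g "fst s"] *(1) g by (simp add: go_sem_def split: if_splits)
  then show "\<exists>t \<le> poly [:1:] (length V). exec (Go g ?M) (conf ab V s) t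
      (conf ab V (go_sem g M V s))"
    by (intro exI[of _ "Suc 0"]) simp
qed

lemma impl_Seq:
  assumes "impl P F" "impl Q G"
  shows "impl (Seq P Q) (\<lambda>V s. G V (F V s))"
proof -
  obtain p where "\<And>ab V s. length ab = 2 \<Longrightarrow> marked V \<Longrightarrow> in_range V s \<Longrightarrow> runs p P F V ab s"
    by (rule implE[OF assms(1)], rule that)
  note p = this[unfolded runs_def]
  obtain q where "\<And>ab V s. length ab = 2 \<Longrightarrow> marked V \<Longrightarrow> in_range V s \<Longrightarrow> runs q Q G V ab s"
    by (rule implE[OF assms(2)], rule that)
  note q = this[unfolded runs_def]
  show ?thesis
  proof (rule implI[where p = "[:1:] + (p + q)"])
    fix ab :: "tape list" and V s
    assume *: "length ab = 2" "marked V" "in_range V s"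
    then show "in_range V (G V (F V s))" using p q by blast
    obtain t where t: "t \<le> poly p (length V)"
      "exec P (conf ab V s) t (conf ab V (F V s))"
      using p[OF *] by blast
    obtain t' where t': "t' \<le> poly q (length V)"
      "exec Q (conf ab V (F V s)) t' (conf ab V (G V (F V s)))"
      using q[OF *(1,2)] p[OF *] by blast
    show "\<exists>t \<le> poly ([:1:] + (p + q)) (length V). exec (Seq P Q) (conf ab V s) t
        (conf ab V (G V (F V s)))"
      using exec_Seq[OF t(2) t'(2)] t(1) t'(1) by (intro exI[of _ "Suc (t + t')"]) simp
  qed
qed

lemma impl_Cond:
  assumes "impl P F" "impl Q G"
  shows "impl (Cond (\<lambda>r syms. b r (head_syms syms)) P Q)
    (\<lambda>V s. if b (fst s) (scans V (snd s)) then F V s else G V s)"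
proof -
  obtain p where "\<And>ab V s. length ab = 2 \<Longrightarrow> marked V \<Longrightarrow> in_range V s \<Longrightarrow> runs p P F V ab s"
    by (rule implE[OF assms(1)], rule that)
  note p = this[unfolded runs_def]
  obtain q where "\<And>ab V s. length ab = 2 \<Longrightarrow> marked V \<Longrightarrow> in_range V s \<Longrightarrow> runs q Q G V ab s"
    by (rule implE[OF assms(2)], rule that)
  note q = this[unfolded runs_def]
  show ?thesis
  proof (rule implI[where p = "[:1:] + (p + q)"])
    fix ab :: "tape list" and V s
    assume *: "length ab = 2" "marked V" "in_range V s"
    then show "in_range V (if b (fst s) (scans V (snd s)) then F V s else G V s)" using p q by simp
    obtain t where t: "t \<le> poly p (length V)"
      "exec P (conf ab V s) t (conf ab V (F V s))"
      using p[OF *] by blast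
    obtain t' where t': "t' \<le> poly q (length V)"
      "exec Q (conf ab V s) t' (conf ab V (G V s))"
      using q[OF *] by blast
    show "\<exists>t \<le> poly ([:1:] + (p + q)) (length V).
        exec (Cond (\<lambda>r syms. b r (head_syms syms)) P Q) (conf ab V s) t
        (conf ab V (if b (fst s) (scans V (snd s)) then F V s else G V s))"
    proof (cases "b (fst s) (scans V (snd s))")
      case True
      then show ?thesis
        using exec_CondT[of "\<lambda>r syms. b r (head_syms syms)", OF _ t(2)] t(1) *(1)
        by (intro exI[of _ "Suc t"]) simp
    next
      case False
      then show ?thesis
        using exec_CondF[of "\<lambda>r syms. b r (head_syms syms)", OF _ t'(2)] t'(1) *(1)
        by (intro exI[of _ "Suc t'"]) simp
    qed
  qed
qed

lemma impl_Copy: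
  assumes "u < h" "v < h" "u \<noteq> v" "u \<noteq> 0" "v \<noteq> 0"
  shows "impl (Copy v u) (copy_sem v u)"
proof (rule implI[where p = "[:7, 8:]"])
  fix ab :: "tape list" and V and s :: "'r \<times> (nat \<Rightarrow> nat)"
  assume *: "length ab = 2" "marked V" "in_range V s"
  then show "in_range V (copy_sem v u V s)" using assms by (auto simp: in_range_def copy_sem_def)
  have "snd s u \<le> length V" "snd s v \<le> length V" "snd s 0 \<le> length V" "fst s \<in> RS"
    using *(3) assms h by (auto simp: in_range_def)
  then show "\<exists>t \<le> poly [:7, 8:] (length V). exec (Copy v u) (conf ab V s) t
      (conf ab V (copy_sem v u V s))"
    using exec_Copy[OF *(2,1), of "fst s" u v "snd s"] assms
    by (intro exI[of _ "2 * snd s v + 2 * snd s 0 + 4 * snd s u + 7"]) (auto simp: copy_sem_def)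
qed

lemma impl_For:
  assumes "impl P F" "u < h" "\<And>V s. marked V \<Longrightarrow> snd (F V s) u = snd s u"
  shows "impl (For u P) (for_sem u F)"
proof -
  obtain p where "\<And>ab V s. length ab = 2 \<Longrightarrow> marked V \<Longrightarrow> in_range V s \<Longrightarrow> runs p P F V ab s"
    by (rule implE[OF assms(1)], rule that)
  note p = this[unfolded runs_def]
  let ?loop = "While (\<lambda>r syms. head_syms syms u \<noteq> 0) (Seq P (Go (\<lambda>r s. r) (\<lambda>s. (\<lambda>_. Stay)(u := MoveR))))"
  have loop: "in_range V ((for_step u F V ^^ n) s) \<and>
      (\<exists>t \<le> n * (poly p (length V) + 3) + 1. exec ?loop (conf ab V s) t
        (conf ab V ((for_step u F V ^^ n) s)))"
    if *: "length ab = 2" "marked V" and "in_range V s" "snd s u + n = length V" for ab V s n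
    using that(3,4)
  proof (induction n arbitrary: s)
    case 0
    then have "scans V (snd s) u = 0" by (simp add: scans_def sym_def)
    then show ?case using 0 *(1) by (auto intro!: exI[of _ "Suc 0"] exec_WhileF)
  next
    case (Suc n)
    have nz: "scans V (snd s) u \<noteq> 0"
      using Suc.prems marked_facts(3)[OF *(2), of "snd s u"] assms(2) by (simp add: scans_def)
    obtain t where t: "t \<le> poly p (length V)" "in_range V (F V s)"
      "exec P (conf ab V s) t (conf ab V (F V s))"
      using p[OF * Suc.prems(1)] by blast
    have s': "in_range V (for_step u F V s)" "snd (for_step u F V s) u + n = length V"
      using t(2) Suc.prems assms(3)[OF *(2), of s] by (auto simp: for_step_def in_range_def split: prod.splits)
    have go: "exec (Go (\<lambda>r s. r) (\<lambda>s. (\<lambda>_. Stay)(u := MoveR))) (conf ab V (F V s)) (Suc 0)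
        (conf ab V (for_step u F V s))"
      using exec_Go[of ab "\<lambda>s. (\<lambda>_. Stay)(u := MoveR)" V "snd (F V s)" "\<lambda>r s. r" "fst (F V s)"] t(2) *(1)
      by (auto simp: for_step_def in_range_def split: prod.splits if_splits)
    obtain t' where t': "t' \<le> n * (poly p (length V) + 3) + 1"
       "exec ?loop (conf ab V (for_step u F V s)) t'
        (conf ab V ((for_step u F V ^^ n) (for_step u F V s)))"
      using Suc.IH[OF s'] by blast
    have "exec ?loop (conf ab V s) (Suc (Suc (t + Suc 0) + t'))
        (conf ab V ((for_step u F V ^^ n) (for_step u F V s)))"
      by (rule exec_WhileT[OF _ exec_Seq[OF t(3) go] t'(2)]) (use nz *(1) in simp)
    moreover have "Suc (Suc (t + Suc 0) + t') \<le> Suc n * (poly p (length V) + 3) + 1"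
      using t(1) t'(1) by simp
    ultimately show ?case using Suc.IH[OF s'] unfolding funpow_Suc_right comp_apply by blast
  qed
  show ?thesis
  proof (rule implI[where p = "[:0, 1:] * (p + [:3:]) + [:3, 2:]"])
    fix ab :: "tape list" and V s
    assume *: "length ab = 2" "marked V" "in_range V s"
    have s': "in_range V (fst s, (snd s)(u := 0))" using *(3) by (auto simp: in_range_def)
    note l = loop[OF *(1,2) s', of "length V", simplified, folded for_sem_def]
    then show "in_range V (for_sem u F V s)" by (simp add: for_sem_def)
    obtain t where t: "t \<le> length V * (poly p (length V) + 3) + 1"
      "exec ?loop (fst s, tps ab V ((snd s)(u := 0))) t (conf ab V (for_sem u F V s))"
      using l by (auto simp: for_sem_def)
    have "exec (To_lm u) (conf ab V s) (2 * snd s u + 1) (fst s, tps ab V ((snd s)(u := 0)))"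
      using exec_To_lm[OF *(2,1)] *(3) assms(2) by (simp add: in_range_def)
    moreover have "snd s u \<le> length V" using *(3) assms(2) by (simp add: in_range_def)
    ultimately show "\<exists>t \<le> poly ([:0, 1:] * (p + [:3:]) + [:3, 2:]) (length V).
        exec (For u P) (conf ab V s) t (conf ab V (for_sem u F V s))"
      using exec_Seq[OF _ t(2), of "To_lm u" "(conf ab V s)" "2 * snd s u + 1"] t(1)
      unfolding For_def
      by (intro exI[of _ "Suc (2 * snd s u + 1 + t)"] conjI) (simp_all add: algebra_simps)
  qed
qed

section \<open>Loading instance and witness\<close>

definition Load :: "('r \<Rightarrow> bool \<Rightarrow> bool \<Rightarrow> 'r \<times> nat option) \<Rightarrow> 'r prog" where
  "Load \<delta> = Seq
     (Act (\<lambda>r s. (r, (s ! 0, Stay) # (s ! 1, Stay) # replicate h (lm, MoveR))))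
     (While (\<lambda>r s. s ! 0 \<noteq> 0) (Act (\<lambda>r s.
        (fst (\<delta> r (s ! 0 = 2) (s ! 1 = 2)),
         (s ! 0, MoveR) # (s ! 1, MoveR) #
         replicate h (case snd (\<delta> r (s ! 0 = 2) (s ! 1 = 2)) of None \<Rightarrow> (0, Stay) | Some a \<Rightarrow> (a, MoveR))))))"

lemma mealy_closed:
  assumes "\<And>r b c. r \<in> RS \<Longrightarrow> fst (\<delta> r b c) \<in> RS" "r \<in> RS"
  shows "fst (mealy \<delta> r zs) \<in> RS"
  using assms(2) by (induction zs arbitrary: r)
    (auto split: prod.splits, metis assms(1) fst_conv)

lemma mealy_symbols:
  assumes "\<And>r b c a. snd (\<delta> r b c) = Some a \<Longrightarrow> a \<in> A"
  shows "set (snd (mealy \<delta> r zs)) \<subseteq> A"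
proof (induction zs arbitrary: r)
  case (Cons z zs)
  obtain b c where z: "z = (b, c)" by (cases z)
  show ?case using Cons.IH[of "fst (\<delta> r b c)"] assms[of r b c]
    by (auto simp: z Let_def split: prod.splits option.splits)
qed simp

lemma length_mealy: "length (snd (mealy \<delta> r zs)) \<le> length zs"
proof (induction zs arbitrary: r)
  case (Cons z zs)
  obtain b c where z: "z = (b, c)" by (cases z)
  show ?case using Cons.IH[of "fst (\<delta> r b c)"]
    by (auto simp: z Let_def split: prod.splits option.splits)
qed simp

text \<open>After the left end marker, a single pass over the instance writes the output of the
  transducer on all \<open>h\<close> tapes simultaneously. Where nothing is emitted the blank under
  the heads is rewritten, which changes nothing.\<close>

lemma exec_Load:
  fixes x w :: "bool list" and \<delta> r
  assumes \<delta>: "\<And>r b c. r \<in> RS \<Longrightarrow> fst (\<delta> r b c) \<in> RS"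
    "\<And>r b c a. snd (\<delta> r b c) = Some a \<Longrightarrow> a < ns" and r: "r \<in> RS"
  defines "m \<equiv> mealy \<delta> r (zip_pad x w)"
  defines "V \<equiv> lm # snd m"
  shows "\<exists>ab. length ab = 2 \<and> exec (Load \<delta>) (r, tape_of x # tape_of w # replicate h (tape_of []))
     (2 * length x + 3) (fst m, tps ab V (\<lambda>_. length V))"
proof -
  define cx cw where "cx = snd (tape_of x)" and "cw = snd (tape_of w)"
  let ?b = "\<lambda>r s. s ! 0 \<noteq> (0 :: nat)"
  let ?e = "\<lambda>r s. case snd (\<delta> r (s ! 0 = (2 :: nat)) (s ! 1 = 2)) of None \<Rightarrow> (0, Stay) | Some a \<Rightarrow> (a, MoveR)"
  let ?f = "\<lambda>r s. (fst (\<delta> r (s ! 0 = (2 :: nat)) (s ! 1 = 2)),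
         (s ! 0, MoveR) # (s ! 1, MoveR) # replicate h (?e r s))"
  have zeros: "cells U (int (length U)) = 0" for U by (simp add: sym_def)
  have loop: "exec (While ?b (Act ?f))
      (r, (int i, cx) # (int i, cw) # replicate h (int (length U), cells U)) (2 * n + 1)
      (let m = mealy \<delta> r (drop i (zip_pad x w)); U' = U @ snd m in
       (fst m, (int (length x), cx) # (int (length x), cw) # replicate h (int (length U'), cells U')))"
    if "r \<in> RS" "i + n = length x" for r i n U
    using that
  proof (induction n arbitrary: r i U)
    case 0
    then show ?case
      by (auto intro!: exec_WhileF simp: cx_def tape_of_def zip_pad_def)
  next
    case (Suc n)
    let ?tp = "(int i, cx) # (int i, cw) # replicate h (int (length U), cells U)"
    define b c where "b = x ! i" and "c = (i < length w \<and> w ! i)"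
    obtain r' e where re: "\<delta> r b c = (r', e)" by (cases "\<delta> r b c")
    have r': "r' \<in> RS" using \<delta>(1)[OF Suc.prems(1), of b c] re by simp
    have i: "i < length x" using Suc.prems by simp
    have scans: "map scan ?tp ! 0 = (if b then 2 else 1)" "(map scan ?tp ! 1 = 2) = c"
      using i by (auto simp: cx_def cw_def tape_of_def b_def c_def)
    define U' where "U' = U @ (case e of None \<Rightarrow> [] | Some a \<Rightarrow> [a])"
    have f: "?f r (map scan ?tp) = (r', (cx (int i), MoveR) # (cw (int i), MoveR) #
        replicate h (case e of None \<Rightarrow> (0, Stay) | Some a \<Rightarrow> (a, MoveR)))"
    proof -
      have "(map scan ?tp ! 0 = 2) = b" using scans(1) by auto
      then show ?thesis unfolding scans(2) re by (simp only: re) simp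
    qed
    have act: "exec (Act ?f) (r, ?tp) (Suc 0) (r', map2 act ?tp ((cx (int i), MoveR) # (cw (int i), MoveR) #
        replicate h (case e of None \<Rightarrow> (0, Stay) | Some a \<Rightarrow> (a, MoveR))))"
    proof (rule exec_Act[where f = ?f, OF f r'])
      show "fst ` set ((cx (int i), MoveR) # (cw (int i), MoveR) #
        replicate h (case e of None \<Rightarrow> (0, Stay) | Some a \<Rightarrow> (a, MoveR))) \<subseteq> {..<ns}"
        if "set (map scan ?tp) \<subseteq> {..<ns}"
        using that \<delta>(2)[of r b c] re ns' by (auto split: option.splits)
    qed (simp add: nt_h)
    have tp': "map2 act ?tp ((cx (int i), MoveR) # (cw (int i), MoveR) #
        replicate h (case e of None \<Rightarrow> (0, Stay) | Some a \<Rightarrow> (a, MoveR))) =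
        (int (Suc i), cx) # (int (Suc i), cw) # replicate h (int (length U'), cells U')"
    proof -
      have "(cells U)(int (length U) := 0) = cells U" using zeros[of U] by (metis fun_upd_triv)
      then show ?thesis
        by (simp add: zip_replicate U'_def cells_snoc split: option.splits)
    qed
    have drop: "drop i (zip_pad x w) = (b, c) # drop (Suc i) (zip_pad x w)"
      using i Cons_nth_drop_Suc[of i "zip_pad x w"] by (simp add: zip_pad_def b_def c_def)
    have rest: "(let m = mealy \<delta> r (drop i (zip_pad x w)); W = U @ snd m in
       (fst m, (int (length x), cx) # (int (length x), cw) # replicate h (int (length W), cells W))) =
      (let m = mealy \<delta> r' (drop (Suc i) (zip_pad x w)); W = U' @ snd m in
       (fst m, (int (length x), cx) # (int (length x), cw) # replicate h (int (length W), cells W)))"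
      by (simp add: drop re U'_def Let_def split: prod.splits)
    have "?b r (map scan ?tp)" using scans(1) by simp
    from exec_WhileT[of ?b, OF this act[unfolded tp'] Suc.IH[OF r', of "Suc i" U']] Suc.prems
    show ?case unfolding rest by simp
  qed
  let ?tp = "tape_of x # tape_of w # replicate h (tape_of [])"
  let ?as = "(scan (tape_of x), Stay) # (scan (tape_of w), Stay) # replicate h (lm, MoveR)"
  have init: "exec (Act (\<lambda>r s. (r, (s ! 0, Stay) # (s ! 1, Stay) # replicate h (lm, MoveR)))) (r, ?tp) (Suc 0)
     (r, map2 act ?tp ?as)"
    using r ns' by (intro exec_Act) (auto simp: nt_h lm_def)
  have "map2 act ?tp ?as = (int 0, cx) # (int 0, cw) # replicate h (int (length [lm]), cells [lm])"
  proof -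
    have "act tp (scan tp, Stay) = tp" for tp by (cases tp) auto
    moreover have "act (tape_of []) (lm, MoveR) = (1, cells [lm])"
      by (auto simp: tape_of_def cells_def fun_eq_iff)
    moreover have "tape_of x = (int 0, cx)" "tape_of w = (int 0, cw)"
      by (simp_all add: cx_def cw_def tape_of_def)
    ultimately show ?thesis by (simp add: zip_replicate)
  qed
  note init' = init[unfolded this]
  have "exec (Load \<delta>) (r, ?tp) (2 * length x + 3)
    (fst m, tps [(int (length x), cx), (int (length x), cw)] V (\<lambda>_. length V))"
  proof -
    have "2 * length x + 3 = Suc (Suc 0 + (2 * length x + 1))" by simp
    then show ?thesis
      using exec_Seq[OF init' loop[OF r, of 0 "length x"]] unfolding Load_def
      by (simp only:) (simp add: Let_def m_def V_def tps_def map_replicate_const)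
  qed
  then show ?thesis by (intro exI[of _ "[(int (length x), cx), (int (length x), cw)]"]) simp
qed

lemma halting_funpow: "halting M C \<Longrightarrow> (step M ^^ n) C = C"
  by (induction n) (auto simp: step_def)

theorem verifier_exists:
  assumes \<delta>: "\<And>r b c. r \<in> RS \<Longrightarrow> fst (\<delta> r b c) \<in> RS"
    "\<And>r b c a. snd (\<delta> r b c) = Some a \<Longrightarrow> a \<in> {1..<lm}" and r0: "r0 \<in> RS" and P: "impl P F"
  shows "\<exists>M. wf_tm M \<and> polytime M \<and> (\<forall>x w. accepts M x w \<longleftrightarrow>
     (let m = mealy \<delta> r0 (zip_pad x w); V = lm # snd m
      in accept (fst (F V (fst m, \<lambda>_. length V)))))"
proof -
  let ?P = "Seq (Load \<delta>) P"
  define M where "M = compile ?P r0 accept"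
  obtain p where "\<And>ab V s. length ab = 2 \<Longrightarrow> marked V \<Longrightarrow> in_range V s \<Longrightarrow> runs p P F V ab s"
    by (rule implE[OF P], rule that)
  note p = this[unfolded runs_def]
  \<comment> \<open>Loading takes 2 n + 3 steps, unwinding the outer sequence one, and turning the
    empty stack into a verdict another one. The loaded word has at most n + 1 symbols, the
    additional one being the left end marker.\<close>
  define T where "T n = 2 * n + 5 + poly p (n + 1)" for n
  have final: "halting M (run M x w (T (length x))) \<and> (fst (run M x w (T (length x))) = acc_state M \<longleftrightarrow>
     (let m = mealy \<delta> r0 (zip_pad x w); V = lm # snd m in accept (fst (F V (fst m, \<lambda>_. length V)))))" for x w
  proof -
    define m where "m = mealy \<delta> r0 (zip_pad x w)"
    define V where "V = lm # snd m"
    let ?s = "(fst m, \<lambda>_. length V)"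
    let ?tp = "tape_of x # tape_of w # replicate h (tape_of [])"
    have "a < ns" if "snd (\<delta> r b c) = Some a" for r b c a
      using \<delta>(2)[OF that] by (auto simp: lm_def)
    then obtain ab where ab: "length ab = 2"
      "exec (Load \<delta>) (r0, ?tp) (2 * length x + 3) (fst m, tps ab V (\<lambda>_. length V))"
      using exec_Load[of \<delta> r0 x w] \<delta>(1) r0 unfolding m_def V_def by metis
    have "set (snd m) \<subseteq> {1..<lm}" unfolding m_def by (rule mealy_symbols) (use \<delta> in blast)
    then have V: "marked V" by (simp add: marked_def V_def)
    have "in_range V ?s" using mealy_closed[of \<delta>, OF \<delta>(1) r0] by (simp add: in_range_def m_def)
    from p[OF ab(1) V this] obtain t where t: "t \<le> poly p (length V)" "in_range V (F V ?s)"
      "exec P (fst m, tps ab V (\<lambda>_. length V)) t (conf ab V (F V ?s))"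
      by auto
    let ?C = "(code ?P ([?P], r0), ?tp)"
    have init: "init_config M x w = ?C" 
      unfolding init_config_def M_def compile_def by (simp add: nt_h)
    have "([?P], r0) \<in> space ?P" using r0 self_in_conts[of ?P] by (simp add: space_def stacks_def)
    from exec_compile[OF exec_Seq[OF ab(2) t(3)], of "[]" ?P r0 accept] this
    have run: "(step M ^^ Suc (2 * length x + 3 + t)) ?C
        = (code ?P ([], fst (F V ?s)), tps ab V (snd (F V ?s)))"
      and sp: "([], fst (F V ?s)) \<in> space ?P"
      by (simp_all add: M_def nt_h)
    define C where "C = step M (code ?P ([], fst (F V ?s)), tps ab V (snd (F V ?s)))"
    have fstC: "fst C = (if accept (fst (F V ?s)) then acc_state M else rej_state M)"
      using code_less[OF sp] decode[OF sp]
      by (simp add: C_def step_def M_def compile_def halting_def)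
    then have halt: "halting M C" by (simp add: halting_def)
    have "length V \<le> length x + 1"
      using length_mealy[of \<delta> r0 "zip_pad x w"] by (simp add: V_def m_def zip_pad_def)
    then have "poly p (length V) \<le> poly p (length x + 1)" by (rule poly_nat_mono)
    then have "2 * length x + 5 + t \<le> T (length x)" using t(1) by (simp add: T_def)
    then obtain n where "T (length x) = 2 * length x + 5 + t + n" using le_Suc_ex by blast
    then have n: "T (length x) = n + Suc (Suc (2 * length x + 3 + t))" by simp
    have "run M x w (T (length x)) = (step M ^^ n) ((step M ^^ Suc (Suc (2 * length x + 3 + t))) ?C)"
      by (simp only: run_def init n funpow_add comp_apply)
    also have "(step M ^^ Suc (Suc (2 * length x + 3 + t))) ?C = C"
      by (simp only: funpow.simps(2)[of "Suc (2 * length x + 3 + t)"] comp_apply run C_def)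
    also have "(step M ^^ n) C = C" using halt by (rule halting_funpow)
    finally have "run M x w (T (length x)) = C" .
    moreover have "acc_state M \<noteq> rej_state M" by (simp add: M_def compile_def)
    ultimately show ?thesis using halt fstC by (simp add: m_def V_def Let_def)
  qed
  have mono: "run M x w t2 = run M x w t1" if halt: "halting M (run M x w t1)" and le: "t1 \<le> t2" for x w t1 t2
  proof -
    obtain n where n: "t2 = n + t1" using le by (metis le_iff_add add.commute)
    show ?thesis using halting_funpow[OF halt, of n] by (simp add: run_def n funpow_add)
  qed
  have "wf_tm M" unfolding M_def using r0 by (rule wf_compile)
  moreover have "polytime M"
    unfolding polytime_def
  proof (intro exI[of _ "[:5, 2:] + pcompose p [:1, 1:]"] allI)
    fix x w :: "bool list"
    have "poly p (length x + 1) \<le> poly p (length x + length w + 1)" by (rule poly_nat_mono) simp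
    then have "T (length x) \<le> poly ([:5, 2:] + pcompose p [:1, 1:]) (length x + length w)"
      by (simp add: T_def poly_pcompose algebra_simps)
    then show "halting M (run M x w (poly ([:5, 2:] + pcompose p [:1, 1:]) (length x + length w)))"
      using mono final by metis
  qed
  moreover have "accepts M x w \<longleftrightarrow> fst (run M x w (T (length x))) = acc_state M" for x w
  proof
    assume "accepts M x w"
    then obtain t where t: "fst (run M x w t) = acc_state M" by (auto simp: accepts_def)
    then have "halting M (run M x w t)" by (simp add: halting_def)
    then show "fst (run M x w (T (length x))) = acc_state M"
      using mono[of x w t "T (length x)"] mono[of x w "T (length x)" t] final t
      by (metis nle_le)
  qed (auto simp: accepts_def)
  ultimately show ?thesis using final by (intro exI[of _ M] conjI allI) simp_all
qed

end

section \<open>Finite-state queries to tuples of terms\<close>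

text \<open>Tape symbols: 1 and 2 are bits, 3 and 4 end an unmarked and a marked number, and 4 is added for
  the first symbol of a term. Symbol 9 is the left end.\<close>

definition is_bit :: "nat \<Rightarrow> bool" where "is_bit s \<longleftrightarrow> s \<in> {1, 2, 5, 6}"
definition bit_val :: "nat \<Rightarrow> bool" where "bit_val s \<longleftrightarrow> s \<in> {2, 6}"
definition is_first :: "nat \<Rightarrow> bool" where "is_first s \<longleftrightarrow> s \<in> {5, 6, 7, 8}"
definition is_marked :: "nat \<Rightarrow> bool" where "is_marked s \<longleftrightarrow> s \<in> {4, 8}"

datatype kind = Same | Below int int | Negative | Marked

text \<open>A level selects a term of the current tuple, a field one of the numbers in the encoding
  of that term.\<close>

datatype query = Query (level1: nat) (field1: nat) (level2: nat) (field2: nat) (kind: kind)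

text \<open>\<^term>\<open>Below D j\<close> reads a signed number \<open>a\<close> (sign bit first) and a number \<open>c\<close>, least
  significant bits first. After \<open>i\<close> steps the state holds the sign of \<open>a\<close> and the floor of
  \<open>2 * (j * c - D * a) / 2 ^ i\<close> for the prefixes of \<open>a\<close> and \<open>c\<close> read so far.\<close>

fun delta :: "kind \<Rightarrow> int \<times> int \<Rightarrow> nat \<Rightarrow> nat \<Rightarrow> int \<times> int" where
  "delta Same (e, v) x y = (if bit_val x = bit_val y then e else 1, v)"
| "delta (Below D j) (e, v) x y =
     (if e = 0 then (if bit_val x then -1 else 1, (v + 2 * j * of_bool (bit_val y)) div 2)
      else (e, (v + 2 * j * of_bool (bit_val y) - D * sgn e * of_bool (bit_val x)) div 2))"
| "delta Negative (e, v) x y = (if e = 0 then (if bit_val x then 1 else 2, v) else (e, v))"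
| "delta Marked (e, v) x y = (if is_bit x then 0 else if is_marked x then 1 else 2, v)"

fun verdict :: "kind \<Rightarrow> int \<times> int \<Rightarrow> bool" where
  "verdict Same (e, v) = (e = 0)"
| "verdict (Below D j) (e, v) = (v \<ge> 0)"
| "verdict Negative (e, v) = (e = 1)"
| "verdict Marked (e, v) = (e = 1)"

definition hd0 :: "nat list \<Rightarrow> nat" where
  "hd0 xs = (case xs of [] \<Rightarrow> 0 | x # _ \<Rightarrow> x)"

text \<open>A stream rests on the symbol that ends its number. There \<open>bit_val\<close> is
  False, so a finished number continues with leading zeros and numbers of different lengths can be
  processed together.\<close>

definition advance :: "nat list \<Rightarrow> nat list" where
  "advance xs = (if is_bit (hd0 xs) then tl xs else xs)"

fun stream :: "kind \<Rightarrow> nat \<Rightarrow> int \<times> int \<Rightarrow> nat list \<Rightarrow> nat list \<Rightarrow> int \<times> int" where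
  "stream k 0 a xs ys = a"
| "stream k (Suc n) a xs ys = stream k n (delta k a (hd0 xs) (hd0 ys)) (advance xs) (advance ys)"

definition skip :: "nat list \<Rightarrow> nat list" where
  "skip xs = tl (dropWhile is_bit xs)"

text \<open>Running for \<open>length V\<close> rounds exhausts every number in the word, so the end
  of a number need not be detected; a loop of the counter head supplies exactly this many
  rounds.\<close>

definition answer :: "nat list \<Rightarrow> (nat \<Rightarrow> nat) \<Rightarrow> query \<Rightarrow> bool" where
  "answer V P q = verdict (kind q) (stream (kind q) (length V) (0, 0)
     ((skip ^^ field1 q) (drop (P (level1 q)) V)) ((skip ^^ field2 q) (drop (P (level2 q)) V)))"

lemma not_is_bit_0 [simp]: "\<not> is_bit 0" by (simp add: is_bit_def)

lemma sym_hd0: "sym V p = hd0 (drop p V)"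
  by (auto simp: sym_def hd0_def hd_drop_conv_nth split: list.splits)
    (metis drop_eq_Nil2 leD list.distinct(1) nth_via_drop not_le)

lemma advance_funpow_skip:
  assumes "length xs \<le> n"
  shows "(advance ^^ n) xs = dropWhile is_bit xs"
  using assms
proof (induction n arbitrary: xs)
  case 0
  then show ?case by simp
next
  case (Suc n)
  have stuck: "(advance ^^ n) ys = ys" if "\<not> is_bit (hd0 ys)" for n ys
    using that by (induction n) (auto simp: advance_def)
  show ?case
  proof (cases xs)
    case Nil
    then show ?thesis using stuck[of "[]" "Suc n"] by (simp add: hd0_def)
  next
    case (Cons x xs')
    show ?thesis
    proof (cases "is_bit x")
      case True
      then show ?thesis using Suc Cons
        by (simp add: funpow_Suc_right advance_def hd0_def del: funpow.simps)
    next
      case False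
      then show ?thesis using stuck[of xs "Suc n"] Cons by (simp add: hd0_def)
    qed
  qed
qed

type_synonym reg = "(nat \<times> bool \<times> nat) \<times> (int \<times> int) \<times> query set \<times> bool"

text \<open>Head 0 is reserved for copying, heads 1 and 2 read the two streams, head 3 is a counter, and
  head \<open>4 + t\<close> points to the \<open>t\<close>-th term of a tuple.\<close>

locale checker =
  fixes K L :: nat and qs :: "query list" and B :: int and \<phi> :: "query set \<Rightarrow> bool"
  assumes levels: "q \<in> set qs \<Longrightarrow> level1 q < L \<and> level2 q < L"
    and coeffs: "q \<in> set qs \<Longrightarrow> kind q = Below D j \<Longrightarrow> \<bar>j\<bar> \<le> D \<and> 3 * D + 2 \<le> B"
    and B: "B \<ge> 2" and K: "K \<ge> 1"
begin

text \<open>The components are the state of the transducer, the state of the running query, the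
  queries recorded as positive, and whether all tuples so far have passed.\<close>

definition regs :: "reg set" where
  "regs = ({..K} \<times> UNIV \<times> {..2}) \<times> ({-B..B} \<times> {-B..B}) \<times> Pow (set qs) \<times> UNIV"

sublocale heads "4 + L" "6 + L" 10 regs
  by unfold_locales (auto simp: regs_def)

lemma lm9: "lm = 9" by (simp add: lm_def)

definition computable :: "reg sem \<Rightarrow> bool" where
  "computable F \<longleftrightarrow> (\<exists>P. impl P F)"

lemma computable_go:
  "(\<And>r s. r \<in> regs \<Longrightarrow> g r s \<in> regs) \<Longrightarrow> computable (go_sem g M)"
  unfolding computable_def by (rule exI, rule impl_go) blast

lemma computable_comp: "computable F \<Longrightarrow> computable G \<Longrightarrow> computable (\<lambda>V s. G V (F V s))"
  unfolding computable_def by (elim exE, rule exI, erule (1) impl_Seq)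

lemma computable_if: "computable F \<Longrightarrow> computable G \<Longrightarrow>
    computable (\<lambda>V s. if b (fst s) (scans V (snd s)) then F V s else G V s)"
  unfolding computable_def by (elim exE, rule exI, erule (1) impl_Cond)

lemma computable_copy: "u < 4 + L \<Longrightarrow> v < 4 + L \<Longrightarrow> u \<noteq> v \<Longrightarrow> u \<noteq> 0 \<Longrightarrow> v \<noteq> 0 \<Longrightarrow> computable (copy_sem v u)"
  unfolding computable_def by (rule exI, rule impl_Copy) auto

lemma computable_for: "computable F \<Longrightarrow> u < 4 + L \<Longrightarrow> (\<And>V s. marked V \<Longrightarrow> snd (F V s) u = snd s u) \<Longrightarrow> computable (for_sem u F)"
  unfolding computable_def by (elim exE, rule exI, erule impl_For) auto

section \<open>Evaluation of a single query by moving heads\<close>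

definition skip_sem :: "nat \<Rightarrow> reg sem" where
  "skip_sem v V s = go_sem (\<lambda>r _. r) (\<lambda>_ u. u = v) V
     (for_sem 3 (go_sem (\<lambda>r _. r) (\<lambda>s u. u = v \<and> is_bit (s v))) V s)"

lemma computable_skip: "v < 3 \<Longrightarrow> computable (skip_sem v)"
  unfolding skip_sem_def[abs_def]
  by (rule computable_comp[where G = "go_sem (\<lambda>r _. r) (\<lambda>_ u. u = v)"], rule computable_for;
      (rule computable_go)?) (auto simp: go_sem_def)

lemma skip_sem:
  assumes "v < 3"
  shows "fst (skip_sem v V s) = fst s" "u \<noteq> v \<Longrightarrow> u \<noteq> 3 \<Longrightarrow> snd (skip_sem v V s) u = snd s u"
    "0 \<notin> set V \<Longrightarrow> drop (snd (skip_sem v V s) v) V = skip (drop (snd s v) V)"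
proof -
  let ?F = "go_sem (\<lambda>r _. r) (\<lambda>s u. u = v \<and> is_bit (s v)) :: reg sem"
  have step: "fst (for_step 3 ?F V t) = fst t \<and> (\<forall>u. u \<noteq> v \<and> u \<noteq> 3 \<longrightarrow> snd (for_step 3 ?F V t) u = snd t u) \<and>
      drop (snd (for_step 3 ?F V t) v) V = advance (drop (snd t v) V)" for t
  proof -
    have sc: "scans V (snd t) v = hd0 (drop (snd t v) V)" using assms by (simp add: scans_def sym_hd0)
    have "hd0 (drop (snd t v) V) = 0 \<Longrightarrow> \<not> is_bit (hd0 (drop (snd t v) V))" by simp
    then have "snd (for_step 3 ?F V t) v = (if is_bit (hd0 (drop (snd t v) V)) then Suc (snd t v) else snd t v)"
      using assms sc by (auto simp: for_step_def go_sem_def)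
    then have "drop (snd (for_step 3 ?F V t) v) V = advance (drop (snd t v) V)"
      by (simp add: advance_def drop_Suc tl_drop)
    then show ?thesis using assms by (auto simp: for_step_def go_sem_def)
  qed
  have loop: "fst ((for_step 3 ?F V ^^ n) t) = fst t \<and>
      (\<forall>u. u \<noteq> v \<and> u \<noteq> 3 \<longrightarrow> snd ((for_step 3 ?F V ^^ n) t) u = snd t u) \<and>
      drop (snd ((for_step 3 ?F V ^^ n) t) v) V = (advance ^^ n) (drop (snd t v) V)" for n t
    using step by (induction n) auto
  let ?t = "for_sem 3 ?F V s"
  have t: "fst ?t = fst s" "\<And>u. u \<noteq> v \<Longrightarrow> u \<noteq> 3 \<Longrightarrow> snd ?t u = snd s u"
      "drop (snd ?t v) V = dropWhile is_bit (drop (snd s v) V)"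
    using loop[of "length V" "(fst s, (snd s)(3 := 0))"] assms
      advance_funpow_skip[of "drop (snd s v) V" "length V"] by (simp_all add: for_sem_def)
  show "fst (skip_sem v V s) = fst s" "u \<noteq> v \<Longrightarrow> u \<noteq> 3 \<Longrightarrow> snd (skip_sem v V s) u = snd s u"
    using t(1) t(2)[of u] by (simp_all add: skip_sem_def go_sem_def)
  have "scans V (snd ?t) v = hd0 (drop (snd ?t v) V)" using assms by (simp add: scans_def sym_hd0)
  moreover have "drop (snd ?t v) V = []" if "hd0 (drop (snd ?t v) V) = 0" "0 \<notin> set V"
    using that by (auto simp: hd0_def split: list.splits) (metis in_set_dropD list.set_intros(1))
  ultimately show "drop (snd (skip_sem v V s) v) V = skip (drop (snd s v) V)" if "0 \<notin> set V"
    using t(3) that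
    by (cases "hd0 (drop (snd ?t v) V) = 0")
      (auto simp: skip_sem_def go_sem_def skip_def drop_Suc simp del: dropWhile_eq_Nil_conv simp flip: tl_drop)
qed

lemma skips_sem:
  assumes "v < 3" "0 \<notin> set V"
  defines "F \<equiv> \<lambda>n. (skip_sem v V ^^ n)"
  shows "fst (F n s) = fst s \<and> (\<forall>u. u \<noteq> v \<and> u \<noteq> 3 \<longrightarrow> snd (F n s) u = snd s u) \<and>
    drop (snd (F n s) v) V = (skip ^^ n) (drop (snd s v) V)"
  unfolding F_def using skip_sem[OF assms(1)] assms(2)
  by (induction n) auto

lemma computable_skips: "v < 3 \<Longrightarrow> computable (\<lambda>V. skip_sem v V ^^ n)"
proof (induction n)
  case 0
  have "computable (go_sem (\<lambda>r _. r) (\<lambda>_ _. False))" by (intro computable_go) auto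
  moreover have "go_sem (\<lambda>r _. r) (\<lambda>_ _. False) = (\<lambda>V s. s)" by (auto simp: go_sem_def fun_eq_iff)
  ultimately show ?case by (simp add: id_def)
next
  case (Suc n)
  then show ?case
    using computable_comp[OF Suc.IH computable_skip] by (simp add: comp_def)
qed

fun set_state :: "reg \<Rightarrow> int \<times> int \<Rightarrow> reg" where
  "set_state (\<sigma>, _, R, ok) a = (\<sigma>, a, R, ok)"
fun get_state :: "reg \<Rightarrow> int \<times> int" where
  "get_state (\<sigma>, a, R, ok) = a"
fun record_answer :: "query \<Rightarrow> reg \<Rightarrow> reg" where
  "record_answer q (\<sigma>, a, R, ok) = (\<sigma>, a, if verdict (kind q) a then insert q R else R - {q}, ok)"
fun record_check :: "reg \<Rightarrow> reg" where
  "record_check (\<sigma>, a, R, ok) = (\<sigma>, a, R, ok \<and> \<phi> (R \<inter> set qs))"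
fun answers :: "reg \<Rightarrow> query set" where
  "answers (\<sigma>, a, R, ok) = R"
fun okay :: "reg \<Rightarrow> bool" where
  "okay (\<sigma>, a, R, ok) = ok"

lemma reg_simps [simp]:
  "get_state (set_state r a) = a" "answers (set_state r a) = answers r" "okay (set_state r a) = okay r"
  "answers (record_answer q r) = (if verdict (kind q) (get_state r) then insert q (answers r) else answers r - {q})"
  "okay (record_answer q r) = okay r"
  "okay (record_check r) \<longleftrightarrow> okay r \<and> \<phi> (answers r \<inter> set qs)"
  "answers (record_check r) = answers r"
  by (cases r; simp)+

definition consume :: "kind \<Rightarrow> reg sem" where
  "consume k = go_sem (\<lambda>r s. set_state r (delta k (get_state r) (s 1) (s 2)))
     (\<lambda>s u. (u = 1 \<or> u = 2) \<and> is_bit (s u))"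

definition query_sem :: "query \<Rightarrow> reg sem" where
  "query_sem q V s =
     go_sem (\<lambda>r _. record_answer q r) (\<lambda>_ _. False) V (for_sem 3 (consume (kind q)) V
       (go_sem (\<lambda>r _. set_state r (0, 0)) (\<lambda>_ _. False) V
         ((skip_sem 2 V ^^ field2 q) (copy_sem 2 (4 + level2 q) V
           ((skip_sem 1 V ^^ field1 q) (copy_sem 1 (4 + level1 q) V s))))))"

text \<open>Before halving, an update changes the carry by at most 3 * D: twice D through j and once
  D through the other summand. As B \<ge> 3 * D + 2, the interval from -B to B is preserved.\<close>

lemma delta_bounds:
  assumes "q \<in> set qs" "a \<in> {-B..B} \<times> {-B..B}"
  shows "delta (kind q) a x y \<in> {-B..B} \<times> {-B..B}"
proof (cases "kind q")
  case (Below D j)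
  obtain e v where a: "a = (e, v)" by (cases a)
  have D: "\<bar>j\<bar> \<le> D" "3 * D + 2 \<le> B" using coeffs[OF assms(1) Below] by auto
  have bound: "w div 2 \<in> {-B..B}" if "\<bar>w\<bar> \<le> B + 3 * D" for w
    using that D by auto
  have s: "\<bar>D * sgn e\<bar> \<le> D" using D by (auto simp: abs_mult sgn_if)
  have "\<bar>v + 2 * j * of_bool (bit_val y) - D * sgn e * of_bool (bit_val x)\<bar> \<le> B + 3 * D"
    "\<bar>v + 2 * j * of_bool (bit_val y)\<bar> \<le> B + 3 * D"
    using D s assms(2) a by (cases "bit_val x"; cases "bit_val y"; auto simp: abs_le_iff)+
  from this[THEN bound] show ?thesis using assms(2) B a Below by auto
qed (use assms(2) B in \<open>auto split: prod.splits\<close>)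

lemma computable_query:
  assumes "q \<in> set qs"
  shows "computable (query_sem q)"
proof -
  have c1: "computable (consume (kind q))"
    unfolding consume_def
    by (intro computable_go) (use delta_bounds[OF assms] in \<open>auto simp: regs_def simp del: delta.simps\<close>)
  have c2: "computable (for_sem 3 (consume (kind q)))"
    by (rule computable_for[OF c1]) (auto simp: consume_def go_sem_def)
  have c3: "computable (go_sem (\<lambda>r _. record_answer q r) (\<lambda>_ _. False))"
    using assms by (intro computable_go) (auto simp: regs_def)
  have c4: "computable (go_sem (\<lambda>r _. set_state r (0, 0)) (\<lambda>_ _. False))"
    using B by (intro computable_go) (auto simp: regs_def)
  have c5: "computable (copy_sem 1 (4 + level1 q))" and c6: "computable (copy_sem 2 (4 + level2 q))"
    using levels[OF assms] by (auto intro!: computable_copy)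
  have c7: "computable (\<lambda>V. skip_sem 1 V ^^ field1 q)" and c8: "computable (\<lambda>V. skip_sem 2 V ^^ field2 q)"
    by (rule computable_skips; simp)+
  show ?thesis
    unfolding query_sem_def[abs_def]
    by (rule computable_comp[OF computable_comp[OF computable_comp[OF computable_comp[OF
        computable_comp[OF computable_comp[OF c5 c7] c6] c8] c4] c2] c3])
qed

lemma query_sem:
  assumes "q \<in> set qs" "0 \<notin> set V"
  shows "okay (fst (query_sem q V s)) = okay (fst s)"
    "answers (fst (query_sem q V s)) = (if answer V (\<lambda>t. snd s (4 + t)) q then insert q (answers (fst s)) else answers (fst s) - {q})"
    "u \<ge> 4 \<Longrightarrow> snd (query_sem q V s) u = snd s u"
proof -
  define s1 where "s1 = (skip_sem 1 V ^^ field1 q) (copy_sem 1 (4 + level1 q) V s)"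
  define s2 where "s2 = (skip_sem 2 V ^^ field2 q) (copy_sem 2 (4 + level2 q) V s1)"
  let ?xs = "(skip ^^ field1 q) (drop (snd s (4 + level1 q)) V)"
  let ?ys = "(skip ^^ field2 q) (drop (snd s (4 + level2 q)) V)"
  have s1: "fst s1 = fst s" "\<And>u. u \<ge> 4 \<Longrightarrow> snd s1 u = snd s u" "drop (snd s1 1) V = ?xs"
    using skips_sem[OF _ assms(2), of 1 "field1 q" "copy_sem 1 (4 + level1 q) V s"]
    unfolding s1_def by (auto simp: copy_sem_def)
  have s2: "fst s2 = fst s" "\<And>u. u \<ge> 4 \<Longrightarrow> snd s2 u = snd s u" "drop (snd s2 1) V = ?xs" "drop (snd s2 2) V = ?ys"
    using skips_sem[OF _ assms(2), of 2 "field2 q" "copy_sem 2 (4 + level2 q) V s1"] s1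
    unfolding s2_def by (auto simp: copy_sem_def)
  have loop: "get_state (fst ((for_step 3 (consume (kind q)) V ^^ n) (r, pos))) =
        stream (kind q) n (get_state r) (drop (pos 1) V) (drop (pos 2) V) \<and>
      answers (fst ((for_step 3 (consume (kind q)) V ^^ n) (r, pos))) = answers r \<and>
      okay (fst ((for_step 3 (consume (kind q)) V ^^ n) (r, pos))) = okay r \<and>
      (\<forall>u\<ge>4. snd ((for_step 3 (consume (kind q)) V ^^ n) (r, pos)) u = pos u)" for n r pos
  proof (induction n arbitrary: r pos)
    case (Suc n)
    define r' where "r' = fst (for_step 3 (consume (kind q)) V (r, pos))"
    define pos' where "pos' = snd (for_step 3 (consume (kind q)) V (r, pos))"
    have eq: "for_step 3 (consume (kind q)) V (r, pos) = (r', pos')" by (simp add: r'_def pos'_def)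
    have sc: "scans V pos 1 = hd0 (drop (pos 1) V)" "scans V pos 2 = hd0 (drop (pos 2) V)"
      by (simp_all add: scans_def sym_hd0)
    have r': "get_state r' = delta (kind q) (get_state r) (hd0 (drop (pos 1) V)) (hd0 (drop (pos 2) V))"
      "answers r' = answers r" "okay r' = okay r"
      using sc by (simp_all add: r'_def for_step_def consume_def go_sem_def del: One_nat_def)
    have "hd0 (drop (pos u) V) = 0 \<Longrightarrow> \<not> is_bit (hd0 (drop (pos u) V))" for u by simp
    then have "pos' 1 = (if is_bit (hd0 (drop (pos 1) V)) then Suc (pos 1) else pos 1)"
      "pos' 2 = (if is_bit (hd0 (drop (pos 2) V)) then Suc (pos 2) else pos 2)"
      using sc by (auto simp: pos'_def for_step_def consume_def go_sem_def simp del: One_nat_def)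
    then have pos': "drop (pos' 1) V = advance (drop (pos 1) V)" "drop (pos' 2) V = advance (drop (pos 2) V)"
      by (simp_all add: advance_def drop_Suc tl_drop)
    have "\<forall>u\<ge>4. pos' u = pos u" by (auto simp: pos'_def for_step_def consume_def go_sem_def)
    then show ?case using Suc.IH[of r' pos'] r' pos'
      by (simp only: funpow_Suc_right comp_apply eq stream.simps) simp
  qed simp
  note l = loop[of "length V" "set_state (fst s) (0, 0)" "(snd s2)(3 := 0)"]
  have q: "query_sem q V s = go_sem (\<lambda>r _. record_answer q r) (\<lambda>_ _. False) V
     ((for_step 3 (consume (kind q)) V ^^ length V) (set_state (fst s) (0, 0), (snd s2)(3 := 0)))"
    unfolding query_sem_def s1_def[symmetric] s2_def[symmetric]
    by (simp add: for_sem_def go_sem_def s2(1))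
  show "okay (fst (query_sem q V s)) = okay (fst s)" "u \<ge> 4 \<Longrightarrow> snd (query_sem q V s) u = snd s u"
    "answers (fst (query_sem q V s)) = (if answer V (\<lambda>t. snd s (4 + t)) q then insert q (answers (fst s)) else answers (fst s) - {q})"
    using l s2 unfolding q by (simp_all add: go_sem_def answer_def)
qed

definition queries_sem :: "query list \<Rightarrow> reg sem" where
  "queries_sem qs' V = fold (\<lambda>q. query_sem q V) qs'"

lemma computable_queries: "set qs' \<subseteq> set qs \<Longrightarrow> computable (queries_sem qs')"
proof (induction qs')
  case Nil
  then show ?case using computable_skips[of 1 0] by (simp add: queries_sem_def[abs_def] id_def)
next
  case (Cons q qs')
  then show ?case using computable_comp[OF computable_query Cons.IH, of q]
    by (simp add: queries_sem_def[abs_def] comp_def)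
qed

lemma queries_sem:
  assumes "set qs' \<subseteq> set qs" "0 \<notin> set V"
  shows "okay (fst (queries_sem qs' V s)) = okay (fst s) \<and>
    (\<forall>u\<ge>4. snd (queries_sem qs' V s) u = snd s u) \<and>
    (\<forall>q. q \<in> answers (fst (queries_sem qs' V s)) \<longleftrightarrow>
      (if q \<in> set qs' then answer V (\<lambda>t. snd s (4 + t)) q else q \<in> answers (fst s)))"
  using assms(1)
proof (induction qs' arbitrary: s)
  case Nil
  then show ?case by (simp add: queries_sem_def)
next
  case (Cons q qs')
  have q: "q \<in> set qs" using Cons.prems by simp
  have eq: "queries_sem (q # qs') V s = queries_sem qs' V (query_sem q V s)"
    by (simp add: queries_sem_def)
  have "(\<lambda>t. snd (query_sem q V s) (4 + t)) = (\<lambda>t. snd s (4 + t))"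
    using query_sem(3)[OF q assms(2), where s = s] by auto
  then show ?case using Cons.IH[of "query_sem q V s"] Cons.prems query_sem[OF q assms(2), where s = s]
    unfolding eq by auto
qed

section \<open>Enumeration of all tuples of terms\<close>

definition body :: "reg sem" where
  "body V s = go_sem (\<lambda>r _. record_check r) (\<lambda>_ _. False) V (queries_sem qs V s)"

fun nest :: "nat \<Rightarrow> reg sem" where
  "nest 0 = body"
| "nest (Suc l) = for_sem (4 + l)
     (\<lambda>V s. if is_first (scans V (snd s) (4 + l)) then nest l V s
            else go_sem (\<lambda>r _. r) (\<lambda>_ _. False) V s)"

lemma body_sem:
  assumes "0 \<notin> set V"
  shows "okay (fst (body V s)) \<longleftrightarrow> okay (fst s) \<and> \<phi> {q \<in> set qs. answer V (\<lambda>t. snd s (4 + t)) q}"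
    "u \<ge> 4 \<Longrightarrow> snd (body V s) u = snd s u"
proof -
  have "answers (fst (queries_sem qs V s)) \<inter> set qs = {q \<in> set qs. answer V (\<lambda>t. snd s (4 + t)) q}"
    using queries_sem[OF subset_refl assms, of s] by auto
  then show "okay (fst (body V s)) \<longleftrightarrow> okay (fst s) \<and> \<phi> {q \<in> set qs. answer V (\<lambda>t. snd s (4 + t)) q}"
    using queries_sem[OF subset_refl assms, of s] by (simp add: body_def go_sem_def)
  show "u \<ge> 4 \<Longrightarrow> snd (body V s) u = snd s u"
    using queries_sem[OF subset_refl assms, of s] by (simp add: body_def go_sem_def)
qed

lemma marked_nonzero: "marked V \<Longrightarrow> 0 \<notin> set V"
  by (auto simp: marked_def lm9)

lemma all_ge_Suc: "(\<forall>t\<ge>l. Q t) \<longleftrightarrow> Q l \<and> (\<forall>t\<ge>Suc l. Q t)"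
  by (metis Suc_leD le_refl not_less_eq_eq le_antisym)

text \<open>The inner loops run over the levels below \<open>l\<close> while the enclosing loops
  hold the heads of the levels from \<open>l\<close> on. The flag \<open>okay\<close> accumulates a
  conjunction over the tuples visited.\<close>

lemma nest_sem:
  assumes "0 \<notin> set V" "l \<le> L"
  shows "(okay (fst (nest l V s)) \<longleftrightarrow> okay (fst s) \<and>
      (\<forall>P. (\<forall>t<l. P t < length V \<and> is_first (V ! P t)) \<and> (\<forall>t\<ge>l. P t = snd s (4 + t)) \<longrightarrow>
         \<phi> {q \<in> set qs. answer V P q})) \<and>
    (\<forall>u \<ge> 4 + l. snd (nest l V s) u = snd s u)"
  using assms(2)
proof (induction l arbitrary: s)
  case 0
  have "(\<forall>t. P t = snd s (4 + t)) \<longleftrightarrow> P = (\<lambda>t. snd s (4 + t))" for P by auto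
  then show ?case using body_sem[OF assms(1), where s = s] by simp
next
  case (Suc l)
  have l: "l \<le> L" "4 + l < 4 + L" using Suc.prems by simp_all
  note nest_l = Suc.IH[OF l(1)]
  let ?good = "\<lambda>s i. \<forall>P. (\<forall>t<l. P t < length V \<and> is_first (V ! P t)) \<and> P l = i \<and> (\<forall>t\<ge>Suc l. P t = snd s (4 + t)) \<longrightarrow>
         \<phi> {q \<in> set qs. answer V P q}"
  let ?F = "\<lambda>V s. if is_first (scans V (snd s) (4 + l)) then nest l V s
            else go_sem (\<lambda>r _. r) (\<lambda>_ _. False) V s"
  have loop: "(okay (fst ((for_step (4 + l) ?F V ^^ n) s)) \<longleftrightarrow> okay (fst s) \<and>
        (\<forall>i<n. is_first (V ! i) \<longrightarrow> ?good s i)) \<and>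
      snd ((for_step (4 + l) ?F V ^^ n) s) (4 + l) = n \<and>
      (\<forall>u>4 + l. snd ((for_step (4 + l) ?F V ^^ n) s) u = snd s u)"
    if "n \<le> length V" "snd s (4 + l) = 0" for n s
    using that
  proof (induction n)
    case (Suc n)
    let ?t = "(for_step (4 + l) ?F V ^^ n) s"
    have IH: "okay (fst ?t) \<longleftrightarrow> okay (fst s) \<and> (\<forall>i<n. is_first (V ! i) \<longrightarrow> ?good s i)"
      "snd ?t (4 + l) = n" "\<And>u. u > 4 + l \<Longrightarrow> snd ?t u = snd s u"
      using Suc by auto
    have first: "is_first (scans V (snd ?t) (4 + l)) = is_first (V ! n)"
      using IH(2) l Suc.prems by (simp add: scans_def sym_def)
    note nest = nest_l[of ?t]
    have good: "(\<forall>P. (\<forall>t<l. P t < length V \<and> is_first (V ! P t)) \<and> (\<forall>t\<ge>l. P t = snd ?t (4 + t)) \<longrightarrow>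
         \<phi> {q \<in> set qs. answer V P q}) \<longleftrightarrow> ?good s n"
    proof -
      have "(\<forall>t\<ge>l. P t = snd ?t (4 + t)) \<longleftrightarrow> P l = n \<and> (\<forall>t\<ge>Suc l. P t = snd s (4 + t))" for P
      proof -
        have "snd ?t (4 + t) = snd s (4 + t)" if "Suc l \<le> t" for t using IH(3) that by simp
        then show ?thesis unfolding all_ge_Suc[of l] IH(2) by simp
      qed
      then show ?thesis by simp
    qed
    have 1: "okay (fst (?F V ?t)) \<longleftrightarrow> okay (fst s) \<and> (\<forall>i<Suc n. is_first (V ! i) \<longrightarrow> ?good s i)"
      using nest first good IH(1) by (auto simp: go_sem_def less_Suc_eq)
    have 2: "snd (?F V ?t) u = snd ?t u" if "u \<ge> 4 + l" for u
      using nest that by (auto simp: go_sem_def)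
    have "(for_step (4 + l) ?F V ^^ Suc n) s = (fst (?F V ?t), (snd (?F V ?t))(4 + l := Suc (snd (?F V ?t) (4 + l))))"
      by (simp add: for_step_def split: prod.splits)
    then show ?case using 1 2 IH(2,3) by (simp del: funpow.simps)
  qed simp
  have "for_sem (4 + l) ?F V s = (for_step (4 + l) ?F V ^^ length V) (fst s, (snd s)(4 + l := 0))"
    by (simp add: for_sem_def)
  then have nest: "nest (Suc l) V s = (for_step (4 + l) ?F V ^^ length V) (fst s, (snd s)(4 + l := 0))"
    by simp
  note final = loop[of "length V" "(fst s, (snd s)(4 + l := 0))", OF order_refl, simplified]
  have "(\<forall>i<length V. is_first (V ! i) \<longrightarrow> ?good s i) \<longleftrightarrow>
      (\<forall>P. (\<forall>t<Suc l. P t < length V \<and> is_first (V ! P t)) \<and> (\<forall>t\<ge>Suc l. P t = snd s (4 + t)) \<longrightarrow>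
         \<phi> {q \<in> set qs. answer V P q})"
    by (auto simp: less_Suc_eq)
  then show ?case using final unfolding nest by auto
qed

lemma computable_nest: "l \<le> L \<Longrightarrow> computable (nest l)"
proof (induction l)
  case 0
  have "computable (go_sem (\<lambda>r _. record_check r) (\<lambda>_ _. False))"
    by (intro computable_go) (auto simp: regs_def)
  from computable_comp[OF computable_queries[OF subset_refl] this] show ?case
    by (simp add: body_def[abs_def])
next
  case (Suc l)
  have "computable (go_sem (\<lambda>r _. r) (\<lambda>_ _. False))" by (intro computable_go) auto
  from computable_if[OF Suc.IH this, of "\<lambda>_ s. is_first (s (4 + l))"] Suc.prems
  show ?case
    by (simp only: nest.simps) (rule computable_for; auto simp: go_sem_def nest_sem[OF marked_nonzero])
qed

text \<open>The state consists of the number of fields left in the current term, whether the next symbol is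
  the first of a term, and the first bit of the current pair (0 if none, otherwise 1 or 2).\<close>

fun tok :: "nat \<times> bool \<times> nat \<Rightarrow> bool \<Rightarrow> bool \<Rightarrow> (nat \<times> bool \<times> nat) \<times> nat option" where
  "tok (m, f, p) b c =
     (if p = 0 then ((m, f, if b then 2 else 1), None)
      else if p = 1 then ((m, False, 0), Some ((if b then 2 else 1) + (if f then 4 else 0)))
      else (if m \<le> 1 then (K, True, 0) else (m - 1, False, 0),
            Some ((if c then 4 else 3) + (if f then 4 else 0))))"

text \<open>The encoding starts with the number of qudits. The state \<open>(1, False, 0)\<close>
  treats it as a block of one field that does not open a term; from then on blocks have
  \<open>K\<close> fields.\<close>

definition tokens :: "bool list \<Rightarrow> bool list \<Rightarrow> nat list" where
  "tokens x w = 9 # snd (mealy tok (1, False, 0) (zip_pad x w))"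

theorem tuple_verifier:
  "\<exists>M. wf_tm M \<and> polytime M \<and> (\<forall>x w. accepts M x w \<longleftrightarrow>
     (\<forall>P. (\<forall>t<L. P t < length (tokens x w) \<and> is_first (tokens x w ! P t)) \<longrightarrow>
        \<phi> {q \<in> set qs. answer (tokens x w) P q}))"
proof -
  define \<delta> :: "reg \<Rightarrow> bool \<Rightarrow> bool \<Rightarrow> reg \<times> nat option" where
    "\<delta> = (\<lambda>(\<sigma>, rest) b c. ((fst (tok \<sigma> b c), rest), snd (tok \<sigma> b c)))"
  have mealy: "mealy \<delta> (\<sigma>, rest) zs = ((fst (mealy tok \<sigma> zs), rest), snd (mealy tok \<sigma> zs))" for \<sigma> rest zs
    by (induction zs arbitrary: \<sigma>) (auto simp: \<delta>_def Let_def simp del: tok.simps split: prod.splits)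
  have "fst (\<delta> r b c) \<in> regs" if "r \<in> regs" for r b c
    using that K by (auto simp: \<delta>_def regs_def split: if_splits)
  moreover have "a \<in> {1..<lm}" if "snd (\<delta> r b c) = Some a" for r b c a
    using that by (auto simp: \<delta>_def lm9 split: prod.splits if_splits)
  moreover have "((1, False, 0), (0, 0), {}, True) \<in> regs"
    using K B by (simp add: regs_def)
  moreover obtain P where "impl P (nest L)"
    using computable_nest[of L] by (auto simp: computable_def)
  ultimately obtain M where M: "wf_tm M" "polytime M"
    "\<And>x w. accepts M x w \<longleftrightarrow> (let m = mealy \<delta> ((1, False, 0), (0, 0), {}, True) (zip_pad x w); V = lm # snd m
      in okay (fst (nest L V (fst m, \<lambda>_. length V))))"
    using verifier_exists[of \<delta> "((1, False, 0), (0, 0), {}, True)" P "nest L" okay] by metis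
  have "accepts M x w \<longleftrightarrow> (\<forall>P. (\<forall>t<L. P t < length (tokens x w) \<and> is_first (tokens x w ! P t)) \<longrightarrow>
        \<phi> {q \<in> set qs. answer (tokens x w) P q})" (is "_ \<longleftrightarrow> ?rhs") for x w
  proof -
    let ?V = "tokens x w"
    have "set (snd (mealy tok (1, False, 0) (zip_pad x w))) \<subseteq> {1..8}"
      by (rule mealy_symbols) (auto split: if_splits)
    then have V: "0 \<notin> set ?V" by (auto simp: tokens_def)
    have "accepts M x w \<longleftrightarrow> (\<forall>P. (\<forall>t<L. P t < length ?V \<and> is_first (?V ! P t)) \<and>
       (\<forall>t\<ge>L. P t = length ?V) \<longrightarrow> \<phi> {q \<in> set qs. answer ?V P q})"
      using nest_sem[OF V order_refl, of "((fst (mealy tok (1, False, 0) (zip_pad x w)), (0, 0), {}, True), \<lambda>_. length ?V)"]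
      unfolding M(3) mealy Let_def fst_conv snd_conv lm9 tokens_def[symmetric] by simp
    also have "\<dots> \<longleftrightarrow> ?rhs"
    proof (intro iffI allI impI)
      fix P
      assume *: "\<forall>P. (\<forall>t<L. P t < length ?V \<and> is_first (?V ! P t)) \<and>
        (\<forall>t\<ge>L. P t = length ?V) \<longrightarrow> \<phi> {q \<in> set qs. answer ?V P q}"
        and P: "\<forall>t<L. P t < length ?V \<and> is_first (?V ! P t)"
      \<comment> \<open>Loading leaves all heads at the end of the word, and those of levels from
        \<open>L\<close> on stay there. No query looks at these levels, so fixing their positions
        does not change the answers.\<close>
      let ?P = "\<lambda>t. if t < L then P t else length ?V"
      have "answer ?V ?P q = answer ?V P q" if "q \<in> set qs" for q
        using levels[OF that] by (simp add: answer_def)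
      then have "{q \<in> set qs. answer ?V ?P q} = {q \<in> set qs. answer ?V P q}" by auto
      then show "\<phi> {q \<in> set qs. answer ?V P q}" using *[rule_format, of ?P] P by simp
    qed blast
    finally show ?thesis .
  qed
  then show ?thesis using M by blast
qed

end

section \<open>Tokens of an encoded Hamiltonian\<close>

text \<open>The flag of a first symbol is disregarded, so a number is represented in the same way at
  the start of a term and inside it.\<close>

fun rep :: "bool list \<Rightarrow> bool \<Rightarrow> nat list \<Rightarrow> bool" where
  "rep [] \<mu> xs \<longleftrightarrow> hd0 xs \<in> (if \<mu> then {4, 8} else {3, 7})"
| "rep (b # bs) \<mu> xs \<longleftrightarrow> hd0 xs \<in> (if b then {2, 6} else {1, 5}) \<and> rep bs \<mu> (tl xs)"

definition low :: "bool list \<Rightarrow> bool" where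
  "low bs \<longleftrightarrow> bs \<noteq> [] \<and> hd bs"

lemma rep_step:
  assumes "rep bs \<mu> xs"
  shows "bit_val (hd0 xs) = low bs" "is_bit (hd0 xs) \<longleftrightarrow> bs \<noteq> []" "rep (tl bs) \<mu> (advance xs)"
    "bs = [] \<Longrightarrow> is_marked (hd0 xs) = \<mu>"
  using assms
  by (cases bs; auto simp: low_def bit_val_def is_bit_def is_marked_def advance_def split: if_splits)+

fun val :: "bool list \<Rightarrow> nat" where
  "val [] = 0"
| "val (b # bs) = of_bool b + 2 * val bs"

lemma val_step: "val bs = of_bool (low bs) + 2 * val (tl bs)"
  by (cases bs) (auto simp: low_def)

lemma val_binary [simp]: "val (binary n) = n"
  by (induction n rule: binary.induct) (subst binary.simps, auto)

text \<open>Since an exhausted stream supplies zeros, agreement of all bits over \<open>n\<close>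
  rounds is equality of values even if the two numbers have different lengths.\<close>

lemma stream_Same:
  assumes "rep bs \<mu> xs" "rep bs' \<mu>' ys" "length bs \<le> n" "length bs' \<le> n"
  shows "fst (stream Same n (e, v) xs ys) = 0 \<longleftrightarrow> e = 0 \<and> val bs = val bs'"
  using assms
proof (induction n arbitrary: e bs bs' xs ys)
  case (Suc n)
  note x = rep_step[OF Suc.prems(1)] and y = rep_step[OF Suc.prems(2)]
  have "val bs = val bs' \<longleftrightarrow> low bs = low bs' \<and> val (tl bs) = val (tl bs')"
    unfolding val_step[of bs] val_step[of bs'] by (cases "low bs"; cases "low bs'"; simp; presburger)
  then show ?case
    using Suc.IH[OF x(3) y(3), of "if low bs = low bs' then e else 1"] x y Suc.prems(3,4)
    by auto
qed simp

text \<open>Dropping the lowest bit loses nothing: if the part still to be read contributes an even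
  integer 2 * X, then w + 2 * X is non-negative exactly when \<open>w div 2 + X\<close> is. The sign
  of the final floor therefore decides the exact inequality.\<close>

lemma stream_Below_signed:
  assumes "rep bs \<mu> xs" "rep bs' \<mu>' ys" "length bs \<le> n" "length bs' \<le> n" "e \<noteq> 0"
  shows "snd (stream (Below D j) n (e, v) xs ys) \<ge> 0 \<longleftrightarrow> v + 2 * j * int (val bs') - D * sgn e * int (val bs) \<ge> 0"
  using assms
proof (induction n arbitrary: v bs bs' xs ys)
  case (Suc n)
  note x = rep_step[OF Suc.prems(1)] and y = rep_step[OF Suc.prems(2)]
  define w where "w = v + 2 * j * of_bool (low bs') - D * sgn e * of_bool (low bs)"
  define X where "X = 2 * j * int (val (tl bs')) - D * sgn e * int (val (tl bs))"
  have "0 \<le> w div 2 + X \<longleftrightarrow> 0 \<le> w + 2 * X" by presburger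
  moreover have "w + 2 * X = v + 2 * j * int (val bs') - D * sgn e * int (val bs)"
    unfolding val_step[of bs] val_step[of bs'] w_def X_def by (simp add: algebra_simps)
  moreover have "snd (stream (Below D j) n (e, w div 2) (advance xs) (advance ys)) \<ge> 0 \<longleftrightarrow> w div 2 + X \<ge> 0"
    using Suc.IH[OF x(3) y(3), of "w div 2"] Suc.prems(3-5) by (simp add: X_def algebra_simps)
  moreover have "stream (Below D j) (Suc n) (e, v) xs ys = stream (Below D j) n (e, w div 2) (advance xs) (advance ys)"
    using x(1) y(1) Suc.prems(5) by (simp add: w_def)
  ultimately show ?case by simp
qed simp

text \<open>The sign bit of a takes up the first round, in which c already advances. From then on c
  is one bit ahead of the magnitude of a, and the factor 2 in front of j makes up for this
  shift.\<close>

lemma stream_Below: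
  assumes "rep (s # bs) \<mu> xs" "rep bs' \<mu>' ys" "length bs < n" "length bs' \<le> n"
  shows "verdict (Below D j) (stream (Below D j) n (0, 0) xs ys) \<longleftrightarrow>
    D * (if s then - int (val bs) else int (val bs)) \<le> j * int (val bs')"
proof -
  obtain n' where n: "n = Suc n'" using assms(3) by (cases n) auto
  note x = rep_step[OF assms(1)] and y = rep_step[OF assms(2)]
  let ?e = "if s then -1 else 1 :: int"
  have v: "verdict (Below D j) a \<longleftrightarrow> 0 \<le> snd a" for a by (cases a) simp
  have "stream (Below D j) n (0, 0) xs ys
      = stream (Below D j) n' (?e, j * of_bool (low bs')) (advance xs) (advance ys)"
    using x(1) y(1) by (simp add: n low_def)
  then have "verdict (Below D j) (stream (Below D j) n (0, 0) xs ys) \<longleftrightarrow>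
      0 \<le> j * of_bool (low bs') + 2 * j * int (val (tl bs')) - D * sgn ?e * int (val bs)"
    using stream_Below_signed[OF x(3) y(3), of n' ?e D j "j * of_bool (low bs')"] assms n v by simp
  then show ?thesis unfolding val_step[of bs'] by (simp add: algebra_simps)
qed

lemma stream_Negative:
  assumes "rep (s # bs) \<mu> xs" "0 < n"
  shows "verdict Negative (stream Negative n (0, 0) xs ys) \<longleftrightarrow> s"
proof -
  have stay: "fst (stream Negative n (e, v) xs ys) = e" if "e \<noteq> 0" for n e v xs ys
    using that by (induction n arbitrary: xs ys) auto
  have v: "verdict Negative a \<longleftrightarrow> fst a = 1" for a by (cases a) simp
  obtain n' where "n = Suc n'" using assms(2) by (cases n) auto
  then show ?thesis using rep_step(1)[OF assms(1)] stay[of "if s then 1 else 2" n' 0 "advance xs" "advance ys"]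
    by (auto simp: low_def v)
qed

lemma stream_Marked:
  assumes "rep bs \<mu> xs" "length bs < n"
  shows "verdict Marked (stream Marked n (0, 0) xs ys) \<longleftrightarrow> \<mu>"
proof -
  have "fst (stream Marked n (e, v) xs ys) = (if \<mu> then 1 else 2)"
    if "rep bs \<mu> xs" "length bs < n" for e v
    using that
  proof (induction n arbitrary: bs e xs ys)
    case (Suc n)
    note x = rep_step[OF Suc.prems(1)]
    show ?case
    proof (cases "n = 0")
      case True
      then show ?thesis using Suc.prems x by simp
    next
      case False
      then show ?thesis using Suc.IH[OF x(3)] Suc.prems(2) by simp
    qed
  qed simp
  from this[OF assms, of 0 0] show ?thesis
    by (cases "stream Marked n (0, 0) xs ys") (simp split: if_splits)
qed

section \<open>Transducer output on a sequence of numbers\<close>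

definition efield :: "bool list \<Rightarrow> bool list" where
  "efield bs = concat (map (\<lambda>b. [False, b]) bs) @ [True, True]"

lemma efield_simps [simp]:
  "efield [] = [True, True]" "efield (b # bs) = False # b # efield bs"
  by (simp_all add: efield_def)

lemma length_efield [simp]: "length (efield bs) = 2 * length bs + 2"
  by (induction bs) auto

fun ftoks :: "bool \<Rightarrow> bool list \<Rightarrow> bool \<Rightarrow> nat list" where
  "ftoks f [] \<mu> = [(if \<mu> then 4 else 3) + (if f then 4 else 0)]"
| "ftoks f (b # bs) \<mu> = ((if b then 2 else 1) + (if f then 4 else 0)) # ftoks False bs \<mu>"

lemma rep_ftoks: "rep bs \<mu> (ftoks f bs \<mu> @ r)"
  by (induction bs arbitrary: f) (auto simp: hd0_def)

lemma skip_ftoks: "skip (ftoks f bs \<mu> @ r) = r"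
proof -
  have "skip (ftoks f bs \<mu> @ r) = r" for f
    by (induction bs arbitrary: f) (auto simp: skip_def is_bit_def)
  then show ?thesis .
qed

lemma length_ftoks [simp]: "length (ftoks f bs \<mu>) = Suc (length bs)"
  by (induction bs arbitrary: f) auto

lemma not_first_ftoks: "s \<in> set (ftoks False bs \<mu>) \<Longrightarrow> \<not> is_first s"
  by (induction bs) (auto simp: is_first_def split: if_splits)

lemma first_ftoks:
  "is_first (ftoks True bs \<mu> ! 0)" "0 < j \<Longrightarrow> j < length (ftoks True bs \<mu>) \<Longrightarrow> \<not> is_first (ftoks True bs \<mu> ! j)"
proof -
  show "is_first (ftoks True bs \<mu> ! 0)" by (cases bs) (auto simp: is_first_def)
  show "0 < j \<Longrightarrow> j < length (ftoks True bs \<mu>) \<Longrightarrow> \<not> is_first (ftoks True bs \<mu> ! j)"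
    by (cases bs) (auto intro!: not_first_ftoks[OF nth_mem])
qed

fun meaning :: "kind \<Rightarrow> bool list \<times> bool \<Rightarrow> bool list \<times> bool \<Rightarrow> bool" where
  "meaning Same (bs, _) (bs', _) \<longleftrightarrow> val bs = val bs'"
| "meaning (Below D j) (bs, _) (bs', _) \<longleftrightarrow>
     D * (if hd bs then - int (val (tl bs)) else int (val (tl bs))) \<le> j * int (val bs')"
| "meaning Negative (bs, _) _ \<longleftrightarrow> hd bs"
| "meaning Marked (_, \<mu>) _ \<longleftrightarrow> \<mu>"

context checker
begin

fun toks :: "nat \<Rightarrow> bool \<Rightarrow> (bool list \<times> bool) list \<Rightarrow> nat list" where
  "toks m f [] = []"
| "toks m f ((bs, \<mu>) # fs) = ftoks f bs \<mu> @ (if m \<le> 1 then toks K True fs else toks (m - 1) False fs)"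

lemma mealy_Cons:
  "snd (mealy \<delta> r ((b, c) # zs)) =
    (case snd (\<delta> r b c) of None \<Rightarrow> [] | Some a \<Rightarrow> [a]) @ snd (mealy \<delta> (fst (\<delta> r b c)) zs)"
  by (simp add: Let_def split: prod.splits)

text \<open>The only witness bit that enters the tokens of a number is the one under the second bit
  of its closing pair, that is, the last one.\<close>

lemma mealy_field:
  assumes "length wl = length (efield bs)"
  shows "snd (mealy tok (m, f, 0) (zip (efield bs) wl @ zs)) =
     ftoks f bs (last wl) @ snd (mealy tok (if m \<le> 1 then (K, True, 0) else (m - 1, False, 0)) zs)"
  using assms
proof (induction bs arbitrary: wl f)
  case Nil
  then obtain c d where "wl = [c, d]" by (auto simp: numeral_2_eq_2 length_Suc_conv)
  then show ?case by (simp add: mealy_Cons del: mealy.simps)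
next
  case (Cons b bs)
  then obtain c d wl' where wl: "wl = c # d # wl'" "length wl' = length (efield bs)"
    by (auto simp: numeral_2_eq_2 length_Suc_conv)
  then have "wl' \<noteq> []" by auto
  then show ?case using Cons.IH[OF wl(2), of False] wl
    by (simp add: mealy_Cons del: mealy.simps)
qed

lemma mealy_fields_marks:
  "length wl = length (concat (map efield fs)) \<Longrightarrow>
     \<exists>ms. length ms = length fs \<and> snd (mealy tok (m, f, 0) (zip (concat (map efield fs)) wl)) = toks m f (zip fs ms)"
proof (induction fs arbitrary: wl m f)
  case (Cons bs fs)
  define w1 w2 where "w1 = take (length (efield bs)) wl" and "w2 = drop (length (efield bs)) wl"
  have len: "length w1 = length (efield bs)" "length w2 = length (concat (map efield fs))"
    using Cons.prems by (simp_all add: w1_def w2_def del: length_efield)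
  have wl: "zip (concat (map efield (bs # fs))) wl = zip (efield bs) w1 @ zip (concat (map efield fs)) w2"
    using len by (simp add: w1_def w2_def zip_append1 del: length_efield)
  let ?m = "if m \<le> 1 then K else m - 1"
  obtain ms where ms: "length ms = length fs"
    "snd (mealy tok (?m, m \<le> 1, 0) (zip (concat (map efield fs)) w2)) = toks ?m (m \<le> 1) (zip fs ms)"
    using Cons.IH[OF len(2), of ?m "m \<le> 1"] by blast
  have "snd (mealy tok (m, f, 0) (zip (concat (map efield (bs # fs))) wl)) = toks m f (zip (bs # fs) (last w1 # ms))"
    unfolding wl mealy_field[OF len(1)] using ms by (auto split: if_splits)
  then show ?case using ms(1) by (intro exI[of _ "last w1 # ms"]) simp
qed simp

text \<open>Conversely every choice of marks is realised, by a witness that is False except possibly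
  under the last bit of each number.\<close>

lemma mealy_fields_witness:
  "length ms = length fs \<Longrightarrow>
     \<exists>wl. length wl = length (concat (map efield fs)) \<and> snd (mealy tok (m, f, 0) (zip (concat (map efield fs)) wl)) = toks m f (zip fs ms)"
proof (induction fs arbitrary: ms m f)
  case (Cons bs fs)
  then obtain \<mu> ms' where ms: "ms = \<mu> # ms'" "length ms' = length fs" by (auto simp: length_Suc_conv)
  let ?m = "if m \<le> 1 then K else m - 1"
  obtain w2 where w2: "length w2 = length (concat (map efield fs))"
    "snd (mealy tok (?m, m \<le> 1, 0) (zip (concat (map efield fs)) w2)) = toks ?m (m \<le> 1) (zip fs ms')"
    using Cons.IH[OF ms(2), of ?m "m \<le> 1"] by blast
  define w1 where "w1 = replicate (2 * length bs + 1) False @ [\<mu>]"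
  have len: "length w1 = length (efield bs)" "last w1 = \<mu>" by (simp_all add: w1_def)
  have wl: "zip (concat (map efield (bs # fs))) (w1 @ w2) = zip (efield bs) w1 @ zip (concat (map efield fs)) w2"
    using len by (simp add: zip_append1 del: length_efield)
  have "snd (mealy tok (m, f, 0) (zip (concat (map efield (bs # fs))) (w1 @ w2))) = toks m f (zip (bs # fs) ms)"
    unfolding wl mealy_field[OF len(1)] using w2 len(2) ms by (auto split: if_splits)
  then show ?case using w2(1) len by (intro exI[of _ "w1 @ w2"]) simp
qed simp

lemma toks_append: "length C = m \<Longrightarrow> 1 \<le> m \<Longrightarrow> toks m f (C @ r) = toks m f C @ toks K True r"
proof (induction C arbitrary: m f)
  case (Cons x C)
  obtain bs \<mu> where x: "x = (bs, \<mu>)" by (cases x)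
  show ?case
  proof (cases "C = []")
    case True
    then show ?thesis using Cons.prems by (simp add: x)
  next
    case False
    then have "1 \<le> m - 1" "length C = m - 1" using Cons.prems by (auto simp: Suc_le_eq)
    moreover have "\<not> m \<le> 1" using calculation(1) by simp
    ultimately show ?thesis using Cons.IH[of "m - 1" False] by (simp add: x)
  qed
qed simp

lemma toks_concat: "(\<And>C. C \<in> set Cs \<Longrightarrow> length C = K) \<Longrightarrow> toks K True (concat Cs) = concat (map (toks K True) Cs)"
  using K by (induction Cs) (auto simp: toks_append)

lemma not_first_toks: "length C \<le> m \<Longrightarrow> s \<in> set (toks m False C) \<Longrightarrow> \<not> is_first s"
proof (induction C arbitrary: m)
  case (Cons x C)
  obtain bs \<mu> where x: "x = (bs, \<mu>)" by (cases x)
  show ?case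
  proof (cases "C = []")
    case True
    then show ?thesis using Cons.prems by (auto simp: x not_first_ftoks split: if_splits)
  next
    case False
    then have "length C \<le> m - 1" "\<not> m \<le> 1" using Cons.prems by (auto simp: Suc_le_eq neq_Nil_conv)
    then show ?thesis using Cons.IH[of "m - 1"] Cons.prems by (auto simp: x not_first_ftoks)
  qed
qed simp

lemma first_toks:
  assumes "length C = K"
  shows "toks K True C \<noteq> []" "is_first (toks K True C ! 0)"
    "0 < j \<Longrightarrow> j < length (toks K True C) \<Longrightarrow> \<not> is_first (toks K True C ! j)"
proof -
  obtain bs \<mu> C' where C: "C = (bs, \<mu>) # C'" using assms K by (cases C) auto
  let ?r = "if K \<le> 1 then toks K True C' else toks (K - 1) False C'"
  have t: "toks K True C = ftoks True bs \<mu> @ ?r" by (simp add: C)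
  have "\<not> is_first s" if "s \<in> set ?r" for s
  proof (cases "K \<le> 1")
    case True
    moreover have "Suc (length C') = K" using assms C by simp
    ultimately have "length C' = 0" by linarith
    then have "C' = []" by simp
    then show ?thesis using that True by simp
  next
    case False
    then show ?thesis using that assms not_first_toks[of C' "K - 1" s] by (simp add: C)
  qed
  then have r: "\<not> is_first (?r ! i)" if "i < length ?r" for i
    using nth_mem[OF that] by blast
  show "toks K True C \<noteq> []" by (simp add: t) (metis length_ftoks list.size(3) nat.distinct(1))
  show "is_first (toks K True C ! 0)" using first_ftoks(1) by (simp add: t nth_append)
  show "0 < j \<Longrightarrow> j < length (toks K True C) \<Longrightarrow> \<not> is_first (toks K True C ! j)"
    using first_ftoks(2)[of j bs \<mu>] r[of "j - length (ftoks True bs \<mu>)"]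
    unfolding t by (auto simp: nth_append simp del: length_ftoks)
qed

lemma skip_toks:
  "j < length C \<Longrightarrow> length C \<le> m \<Longrightarrow> \<exists>f r'. (skip ^^ j) (toks m f0 C @ r) = ftoks f (fst (C ! j)) (snd (C ! j)) @ r'"
proof (induction j arbitrary: C m f0)
  case 0
  then show ?case by (cases C) auto
next
  case (Suc j)
  then obtain bs \<mu> C' where C: "C = (bs, \<mu>) # C'" by (cases C) auto
  have "m > 1" using Suc.prems C by simp
  then have "(skip ^^ Suc j) (toks m f0 C @ r) = (skip ^^ j) (toks (m - 1) False C' @ r)"
    by (simp add: C funpow_Suc_right skip_ftoks del: funpow.simps)
  then show ?case using Suc.IH[of C' "m - 1" False] Suc.prems C by simp
qed

section \<open>Correspondence between token positions and terms\<close>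

definition suffix_toks :: "(bool list \<times> bool) list list \<Rightarrow> nat \<Rightarrow> nat list" where
  "suffix_toks Cs i = concat (map (toks K True) (drop i Cs))"

lemma suffix_toks_simps:
  "suffix_toks (C # Cs) 0 = toks K True C @ suffix_toks Cs 0"
  "suffix_toks (C # Cs) (Suc i) = suffix_toks Cs i"
  by (simp_all add: suffix_toks_def)

lemma first_position_block:
  assumes "\<And>C. C \<in> set Cs \<Longrightarrow> length C = K"
    and "p < length (suffix_toks Cs 0)" "is_first (suffix_toks Cs 0 ! p)"
  shows "\<exists>i<length Cs. drop p (suffix_toks Cs 0) = suffix_toks Cs i"
  using assms
proof (induction Cs arbitrary: p)
  case Nil
  then show ?case by (simp add: suffix_toks_def)
next
  case (Cons C Cs)
  have C: "length C = K" and IH: "\<And>C. C \<in> set Cs \<Longrightarrow> length C = K" using Cons.prems by simp_all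
  let ?b = "toks K True C"
  show ?case
  proof (cases "p < length ?b")
    case True
    then have "p = 0" using first_toks(3)[OF C, of p] Cons.prems(3)
      by (auto simp: nth_append suffix_toks_simps)
    then show ?thesis by auto
  next
    case False
    then obtain i where "i < length Cs" "drop (p - length ?b) (suffix_toks Cs 0) = suffix_toks Cs i"
      using Cons.IH[OF IH, of "p - length ?b"] Cons.prems(2,3) by (auto simp: nth_append suffix_toks_simps less_diff_conv2)
    then show ?thesis using False by (intro exI[of _ "Suc i"]) (simp add: suffix_toks_simps)
  qed
qed

lemma block_first_position:
  assumes "\<And>C. C \<in> set Cs \<Longrightarrow> length C = K" "i < length Cs"
  shows "\<exists>p<length (suffix_toks Cs 0). is_first (suffix_toks Cs 0 ! p) \<and>
      drop p (suffix_toks Cs 0) = suffix_toks Cs i"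
  using assms
proof (induction Cs arbitrary: i)
  case (Cons C Cs)
  have C: "length C = K" and IH: "\<And>C. C \<in> set Cs \<Longrightarrow> length C = K" using Cons.prems by simp_all
  let ?b = "toks K True C"
  show ?case
  proof (cases i)
    case 0
    then show ?thesis using first_toks(1,2)[OF C]
      by (intro exI[of _ 0]) (simp add: nth_append suffix_toks_simps)
  next
    case (Suc i')
    then obtain p where "p < length (suffix_toks Cs 0)" "is_first (suffix_toks Cs 0 ! p)"
      "drop p (suffix_toks Cs 0) = suffix_toks Cs i'"
      using Cons.IH[OF IH, of i'] Cons.prems(2) by auto
    then show ?thesis
      by (intro exI[of _ "length ?b + p"]) (simp add: nth_append Suc suffix_toks_simps)
  qed
qed simp

lemma length_skips: "length ((skip ^^ j) xs) \<le> length xs"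
proof (induction j)
  case (Suc j)
  have "length (skip ys) \<le> length ys" for ys
    using length_dropWhile_le[of is_bit ys] by (simp add: skip_def le_diff_conv)
  from order_trans[OF this Suc] show ?case by simp
qed simp

text \<open>The kinds \<open>Below\<close> and \<open>Negative\<close> interpret the first bit of a
  field as a sign; the last assumption makes sure that this bit exists and is not the closing
  symbol.\<close>

lemma answer_meaning:
  assumes C: "\<And>C. C \<in> set Cs \<Longrightarrow> length C = K"
    and q: "field1 q < K" "field2 q < K"
    and I: "I (level1 q) < length Cs" "I (level2 q) < length Cs"
    and P: "drop (P (level1 q)) V = suffix_toks Cs (I (level1 q))"
      "drop (P (level2 q)) V = suffix_toks Cs (I (level2 q))"
    and ne: "kind q = Negative \<or> (\<exists>D j. kind q = Below D j) \<Longrightarrow> fst (Cs ! I (level1 q) ! field1 q) \<noteq> []"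
  shows "answer V P q = meaning (kind q) (Cs ! I (level1 q) ! field1 q) (Cs ! I (level2 q) ! field2 q)"
proof -
  have rep: "rep bs \<mu> ((skip ^^ j) (drop p V))" "length bs < length V"
    if j: "j < K" and i: "i < length Cs" and p: "drop p V = suffix_toks Cs i" and b: "(bs, \<mu>) = Cs ! i ! j" for bs \<mu> i j p
  proof -
    have len: "length (Cs ! i) = K" using C i by simp
    have "suffix_toks Cs i = toks K True (Cs ! i) @ suffix_toks Cs (Suc i)"
      using i by (simp add: suffix_toks_def flip: Cons_nth_drop_Suc)
    moreover have "fst (Cs ! i ! j) = bs" "snd (Cs ! i ! j) = \<mu>" using b[symmetric] by simp_all
    ultimately obtain f r' where *: "(skip ^^ j) (drop p V) = ftoks f bs \<mu> @ r'"
      using skip_toks[of j "Cs ! i" K True "suffix_toks Cs (Suc i)"] j p len by auto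
    then show "rep bs \<mu> ((skip ^^ j) (drop p V))" by (simp add: rep_ftoks)
    have "length ((skip ^^ j) (drop p V)) \<le> length V"
      using length_skips[of j "drop p V"] by simp
    then show "length bs < length V" by (simp add: *)
  qed
  obtain bs \<mu> where x: "(bs, \<mu>) = Cs ! I (level1 q) ! field1 q" by (metis surj_pair)
  obtain bs' \<mu>' where y: "(bs', \<mu>') = Cs ! I (level2 q) ! field2 q" by (metis surj_pair)
  note rx = rep[OF q(1) I(1) P(1) x] and ry = rep[OF q(2) I(2) P(2) y]
  let ?xs = "(skip ^^ field1 q) (drop (P (level1 q)) V)"
  let ?ys = "(skip ^^ field2 q) (drop (P (level2 q)) V)"
  have "verdict (kind q) (stream (kind q) (length V) (0, 0) ?xs ?ys) = meaning (kind q) (bs, \<mu>) (bs', \<mu>')"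
  proof (cases "kind q")
    case Same
    then show ?thesis using stream_Same[OF rx(1) ry(1), of "length V" 0 0] rx(2) ry(2)
      by (cases "stream Same (length V) (0, 0) ?xs ?ys") auto
  next
    case (Below D j)
    then have "bs \<noteq> []" using ne x[symmetric] by simp
    then obtain s bs0 where "bs = s # bs0" by (cases bs) auto
    then show ?thesis using stream_Below[of s bs0 \<mu> ?xs bs' \<mu>' ?ys "length V" D j] rx ry
      by (simp add: Below del: verdict.simps)
  next
    case Negative
    then have "bs \<noteq> []" using ne x[symmetric] by simp
    then obtain s bs0 where "bs = s # bs0" by (cases bs) auto
    moreover have "0 < length V" using rx(2) by linarith
    ultimately show ?thesis using stream_Negative[of s bs0 \<mu> ?xs "length V" ?ys] rx(1)
      by (simp add: Negative del: verdict.simps rep.simps)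
  next
    case Marked
    then show ?thesis using stream_Marked[OF rx] by (simp del: verdict.simps)
  qed
  then show ?thesis by (simp add: answer_def x y)
qed

text \<open>First symbols are exactly the starts of blocks, the header contains none, and answers
  depend only on the suffixes of the word at these positions. So a universal check over flagged
  positions is one over tuples of terms.\<close>

lemma tuples_of_positions:
  assumes C: "\<And>C. C \<in> set Cs \<Longrightarrow> length C = K"
    and q: "\<And>q. q \<in> set qs \<Longrightarrow> field1 q < K \<and> field2 q < K"
    and ne: "\<And>q C. q \<in> set qs \<Longrightarrow> C \<in> set Cs \<Longrightarrow> kind q = Negative \<or> (\<exists>D j. kind q = Below D j) \<Longrightarrow>
       fst (C ! field1 q) \<noteq> []"
    and V: "V = 9 # ftoks False hb hm @ suffix_toks Cs 0"
  shows "(\<forall>P. (\<forall>t<L. P t < length V \<and> is_first (V ! P t)) \<longrightarrow> \<phi> {q \<in> set qs. answer V P q}) \<longleftrightarrow>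
    (\<forall>I. (\<forall>t<L. I t < length Cs) \<longrightarrow>
      \<phi> {q \<in> set qs. meaning (kind q) (Cs ! I (level1 q) ! field1 q) (Cs ! I (level2 q) ! field2 q)})"
proof -
  let ?h = "9 # ftoks False hb hm"
  have nofirst: "\<not> is_first s" if "s \<in> set ?h" for s
    using that not_first_ftoks by (auto simp: is_first_def[of 9])
  have pos: "\<exists>i<length Cs. drop p V = suffix_toks Cs i" if "p < length V" "is_first (V ! p)" for p
  proof -
    have V': "V = ?h @ suffix_toks Cs 0" by (simp add: V)
    have "\<not> p < length ?h"
    proof
      assume p: "p < length ?h"
      then have "V ! p = ?h ! p" unfolding V' by (simp only: nth_append if_True)
      then show False using nofirst[OF nth_mem[OF p]] that(2) by simp
    qed
    then obtain p' where p: "p = length ?h + p'" using le_Suc_ex not_less by blast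
    have "p' < length (suffix_toks Cs 0)" "is_first (suffix_toks Cs 0 ! p')"
      using that unfolding V' p nth_append_length_plus by simp_all
    from first_position_block[OF C this] show ?thesis
      unfolding V' p by (simp only: drop_append) simp
  qed
  have pos': "\<exists>p<length V. is_first (V ! p) \<and> drop p V = suffix_toks Cs i" if i: "i < length Cs" for i
  proof -
    obtain p where p: "p < length (suffix_toks Cs 0)" "is_first (suffix_toks Cs 0 ! p)"
      "drop p (suffix_toks Cs 0) = suffix_toks Cs i"
      using block_first_position[OF C i] by auto
    have V': "V = ?h @ suffix_toks Cs 0" by (simp add: V)
    show ?thesis unfolding V'
      by (intro exI[of _ "length ?h + p"], unfold nth_append_length_plus drop_append) (use p in simp)
  qed
  have eq: "{q \<in> set qs. answer V P q} =
      {q \<in> set qs. meaning (kind q) (Cs ! I (level1 q) ! field1 q) (Cs ! I (level2 q) ! field2 q)}"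
    if "\<And>t. t < L \<Longrightarrow> I t < length Cs \<and> drop (P t) V = suffix_toks Cs (I t)" for P I
    using answer_meaning[OF C, where I = I and P = P and V = V] q levels ne that by (auto 0 3)
  show ?thesis
  proof (intro iffI allI impI)
    fix I
    assume *: "\<forall>P. (\<forall>t<L. P t < length V \<and> is_first (V ! P t)) \<longrightarrow> \<phi> {q \<in> set qs. answer V P q}"
      and I: "\<forall>t<L. I t < length Cs"
    have "\<forall>t. \<exists>p. t < L \<longrightarrow> p < length V \<and> is_first (V ! p) \<and> drop p V = suffix_toks Cs (I t)"
      using pos' I by blast
    then obtain P where P: "\<And>t. t < L \<Longrightarrow> P t < length V \<and> is_first (V ! P t) \<and> drop (P t) V = suffix_toks Cs (I t)"
      by metis
    show "\<phi> {q \<in> set qs. meaning (kind q) (Cs ! I (level1 q) ! field1 q) (Cs ! I (level2 q) ! field2 q)}"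
      using *[rule_format, of P] eq[of I P] P I by auto
  next
    fix P
    assume *: "\<forall>I. (\<forall>t<L. I t < length Cs) \<longrightarrow>
      \<phi> {q \<in> set qs. meaning (kind q) (Cs ! I (level1 q) ! field1 q) (Cs ! I (level2 q) ! field2 q)}"
      and P: "\<forall>t<L. P t < length V \<and> is_first (V ! P t)"
    have "\<forall>t. \<exists>i. t < L \<longrightarrow> i < length Cs \<and> drop (P t) V = suffix_toks Cs i"
      using pos P by blast
    then obtain I where I: "\<And>t. t < L \<Longrightarrow> I t < length Cs \<and> drop (P t) V = suffix_toks Cs (I t)"
      by metis
    show "\<phi> {q \<in> set qs. answer V P q}"
      using *[rule_format, of I] eq[of I P] I by auto
  qed
qed

end

section \<open>Layout of an encoded Hamiltonian\<close>

definition int_field :: "int \<Rightarrow> bool list" where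
  "int_field z = (z < 0) # binary (nat \<bar>z\<bar>)"

fun entry_fields :: "entry \<Rightarrow> bool list list" where
  "entry_fields (a, b, c) = [int_field a, int_field b, binary c]"

definition term_fields :: "nat \<Rightarrow> nat \<Rightarrow> local_term \<Rightarrow> bool list list" where
  "term_fields q k t = map binary (qudits t) @
     concat (map (\<lambda>x. concat (map (\<lambda>y. entry_fields (entries t x y)) (List.n_lists k [0..<q])))
       (List.n_lists k [0..<q]))"

lemma enc_nat_efield: "enc_nat n = efield (binary n)"
  by (simp add: enc_nat_def efield_def)

lemma enc_entry_efield: "enc_entry e = concat (map efield (entry_fields e))"
  by (cases e) (simp add: enc_int_def enc_nat_efield int_field_def)

lemma concat_map_concat: "concat (map f (concat xss)) = concat (map (\<lambda>xs. concat (map f xs)) xss)"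
  by (induction xss) auto

lemma enc_term_efield: "enc_term q k t = concat (map efield (term_fields q k t))"
  by (simp add: enc_term_def term_fields_def concat_map_concat enc_nat_efield[abs_def] enc_entry_efield comp_def)

lemma encode_efield:
  "encode q k H = concat (map efield (binary (num_qudits H) # concat (map (term_fields q k) (local_terms H))))"
  by (simp add: encode_def enc_nat_efield concat_map_concat enc_term_efield[abs_def] comp_def)

definition num_fields :: "nat \<Rightarrow> nat \<Rightarrow> nat" where
  "num_fields q k = k + 3 * (q ^ k * q ^ k)"

definition row :: "nat \<Rightarrow> nat \<Rightarrow> nat list \<Rightarrow> nat" where
  "row q k x = (SOME i. i < q ^ k \<and> List.n_lists k [0..<q] ! i = x)"

text \<open>The \<open>k\<close> qudit indices are followed by the entries in row-major order, three
  numbers each. This is the position of the real numerator; the denominator follows at offset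
  2.\<close>

definition entry_pos :: "nat \<Rightarrow> nat \<Rightarrow> nat list \<Rightarrow> nat list \<Rightarrow> nat" where
  "entry_pos q k x y = k + 3 * (row q k x * q ^ k + row q k y)"

lemma row:
  assumes "x \<in> strings q k"
  shows "row q k x < q ^ k" "List.n_lists k [0..<q] ! row q k x = x"
proof -
  have "x \<in> set (List.n_lists k [0..<q])"
    using assms by (auto simp: strings_def set_n_lists)
  then have "\<exists>i. i < q ^ k \<and> List.n_lists k [0..<q] ! i = x"
    by (auto simp: in_set_conv_nth length_n_lists)
  then show "row q k x < q ^ k" "List.n_lists k [0..<q] ! row q k x = x"
    unfolding row_def by (metis (mono_tags, lifting) someI_ex)+
qed

lemma length_concat_uniform: "(\<And>xs. xs \<in> set xss \<Longrightarrow> length xs = l) \<Longrightarrow> length (concat xss) = length xss * l"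
  by (induction xss) auto

lemma nth_concat_uniform:
  "(\<And>xs. xs \<in> set xss \<Longrightarrow> length xs = l) \<Longrightarrow> i < length xss \<Longrightarrow> j < l \<Longrightarrow> concat xss ! (i * l + j) = xss ! i ! j"
proof (induction xss arbitrary: i)
  case (Cons xs xss)
  then show ?case by (cases i) (auto simp: nth_append)
qed simp

lemma length_entry_fields [simp]: "length (entry_fields e) = 3"
  by (cases e) simp

lemma length_term_fields: "length (qudits t) = k \<Longrightarrow> length (term_fields q k t) = num_fields q k"
  by (simp add: term_fields_def num_fields_def length_concat comp_def sum_list_triv length_n_lists)

lemma term_fields_qudit:
  "p < length (qudits t) \<Longrightarrow> term_fields q k t ! p = binary (qudits t ! p)"
  by (simp add: term_fields_def nth_append)

lemma entry_pos_less:
  assumes "x \<in> strings q k" "y \<in> strings q k" "r < 3"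
  shows "entry_pos q k x y + r < num_fields q k"
proof -
  have "Suc (row q k x) * q ^ k \<le> q ^ k * q ^ k"
    using row(1)[OF assms(1)] by (intro mult_right_mono) auto
  then have "row q k x * q ^ k + row q k y < q ^ k * q ^ k"
    using row(1)[OF assms(2)] by simp
  then show ?thesis using assms(3) by (simp add: entry_pos_def num_fields_def)
qed

lemma term_fields_entry:
  assumes "x \<in> strings q k" "y \<in> strings q k" "r < 3" "length (qudits t) = k"
  shows "term_fields q k t ! (entry_pos q k x y + r) = entry_fields (entries t x y) ! r"
proof -
  let ?N = "List.n_lists k [0..<q]"
  have N: "length ?N = q ^ k" by (simp add: length_n_lists)
  have "term_fields q k t ! (entry_pos q k x y + r) =
      concat (map (\<lambda>x. concat (map (\<lambda>y. entry_fields (entries t x y)) ?N)) ?N)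
        ! (row q k x * (q ^ k * 3) + (row q k y * 3 + r))"
    using assms(4) by (simp add: term_fields_def entry_pos_def nth_append algebra_simps)
  also have "\<dots> = concat (map (\<lambda>y. entry_fields (entries t x y)) ?N) ! (row q k y * 3 + r)"
    using row[OF assms(1)] row(1)[OF assms(2)] assms(3) N
    by (subst nth_concat_uniform[where l = "q ^ k * 3"]) (auto simp: length_concat comp_def sum_list_triv)
  also have "\<dots> = entry_fields (entries t x y) ! r"
    using row[OF assms(2)] assms(3) N by (subst nth_concat_uniform[where l = 3]) auto
  finally show ?thesis .
qed

lemma zip_concat:
  "length xss = length mss \<Longrightarrow> (\<And>i. i < length xss \<Longrightarrow> length (xss ! i) = length (mss ! i)) \<Longrightarrow>
     zip (concat xss) (concat mss) = concat (map2 zip xss mss)"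
proof (induction xss mss rule: list_induct2)
  case (Cons xs xss ms mss)
  have "length xs = length ms" using Cons.prems[of 0] by simp
  moreover have "zip (concat xss) (concat mss) = concat (map2 zip xss mss)"
    using Cons.prems[of "Suc _"] by (intro Cons.IH) simp
  ultimately show ?case by simp
qed simp

lemma split_uniform:
  "length ms = n * l \<Longrightarrow> \<exists>mss. length mss = n \<and> (\<forall>i<n. length (mss ! i) = l) \<and> ms = concat mss"
proof (induction n arbitrary: ms)
  case (Suc n)
  obtain mss where mss: "length mss = n" "\<forall>i<n. length (mss ! i) = l" "drop l ms = concat mss"
    using Suc.IH[of "drop l ms"] Suc.prems by auto
  show ?case
  proof (intro exI[of _ "take l ms # mss"] conjI allI impI)
    show "ms = concat (take l ms # mss)" by (simp flip: mss(3))
    show "length ((take l ms # mss) ! i) = l" if "i < Suc n" for i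
      using mss(2) that Suc.prems by (cases i) auto
  qed (simp add: mss(1))
qed simp

definition blocks :: "nat \<Rightarrow> nat \<Rightarrow> hamiltonian \<Rightarrow> bool list list \<Rightarrow> (bool list \<times> bool) list list" where
  "blocks q k H mss = map2 zip (map (term_fields q k) (local_terms H)) mss"

context checker
begin

lemma toks_blocks:
  assumes K: "K = num_fields q k" and H: "\<And>t. t \<in> set (local_terms H) \<Longrightarrow> length (qudits t) = k"
    and mss: "length mss = length (local_terms H)" "\<forall>i<length mss. length (mss ! i) = K"
  shows "toks 1 False (zip (binary (num_qudits H) # concat (map (term_fields q k) (local_terms H))) (hm # concat mss)) =
     ftoks False (binary (num_qudits H)) hm @ suffix_toks (blocks q k H mss) 0"
proof -
  have len: "length (map (term_fields q k) (local_terms H) ! i) = length (mss ! i)" if "i < length (local_terms H)" for i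
    using that mss H K by (simp add: length_term_fields)
  have blk: "length C = K" if C: "C \<in> set (blocks q k H mss)" for C
  proof -
    obtain i where i: "i < length (local_terms H)" "C = zip (term_fields q k (local_terms H ! i)) (mss ! i)"
      using C by (auto simp: blocks_def set_zip)
    then show ?thesis using len[OF i(1)] mss by simp
  qed
  have "zip (concat (map (term_fields q k) (local_terms H))) (concat mss) = concat (blocks q k H mss)"
    unfolding blocks_def by (rule zip_concat) (use len mss(1) in simp_all)
  then show ?thesis using toks_concat[of "blocks q k H mss", OF blk] by (simp add: suffix_toks_def)
qed

lemma length_fields:
  assumes "\<And>t. t \<in> set (local_terms H) \<Longrightarrow> length (qudits t) = k"
  shows "length (concat (map (term_fields q k) (local_terms H))) = length (local_terms H) * num_fields q k"
proof -
  have "length xs = num_fields q k" if "xs \<in> set (map (term_fields q k) (local_terms H))" for xs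
    using that assms by (auto simp: length_term_fields)
  then show ?thesis
    using length_concat_uniform[of "map (term_fields q k) (local_terms H)" "num_fields q k"] by simp
qed

text \<open>For soundness: whatever the witness, the verifier sees the terms of \<open>H\<close>
  with some marking of their numbers.\<close>

lemma tokens_encode:
  assumes K: "K = num_fields q k" and H: "\<And>t. t \<in> set (local_terms H) \<Longrightarrow> length (qudits t) = k"
  shows "\<exists>hm mss. length mss = length (local_terms H) \<and> (\<forall>i<length mss. length (mss ! i) = K) \<and>
     tokens (encode q k H) w = 9 # ftoks False (binary (num_qudits H)) hm @ suffix_toks (blocks q k H mss) 0"
proof -
  let ?x = "encode q k H" and ?fs = "binary (num_qudits H) # concat (map (term_fields q k) (local_terms H))"
  define wl where "wl = map (\<lambda>i. i < length w \<and> w ! i) [0..<length ?x]"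
  have "zip_pad ?x w = zip ?x wl"
    by (rule nth_equalityI) (auto simp: zip_pad_def wl_def)
  moreover have "length wl = length ?x" by (simp add: wl_def)
  ultimately obtain ms where ms: "length ms = length ?fs" "tokens ?x w = 9 # toks 1 False (zip ?fs ms)"
    using mealy_fields_marks[of wl ?fs 1 False] by (auto simp: tokens_def encode_efield)
  obtain hm ms' where ms': "ms = hm # ms'" "length ms' = length (local_terms H) * K"
    using ms(1) length_fields[of H k q, OF H] K by (auto simp: length_Suc_conv)
  obtain mss where "length mss = length (local_terms H)" "\<forall>i<length mss. length (mss ! i) = K" "ms' = concat mss"
    using split_uniform[OF ms'(2)] by auto
  then show ?thesis using toks_blocks[OF K H, where mss = mss and hm = hm] ms ms' by metis
qed

text \<open>For completeness: any prescribed marking of the terms can be produced by a witness as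
  long as the instance.\<close>

lemma tokens_witness:
  assumes K: "K = num_fields q k" and H: "\<And>t. t \<in> set (local_terms H) \<Longrightarrow> length (qudits t) = k"
    and mss: "length mss = length (local_terms H)" "\<forall>i<length mss. length (mss ! i) = K"
  shows "\<exists>w. length w = length (encode q k H) \<and>
     tokens (encode q k H) w = 9 # ftoks False (binary (num_qudits H)) False @ suffix_toks (blocks q k H mss) 0"
proof -
  let ?x = "encode q k H" and ?fs = "binary (num_qudits H) # concat (map (term_fields q k) (local_terms H))"
  have "length (concat mss) = length (local_terms H) * K"
    using length_concat_uniform[of mss K] mss by (auto simp: in_set_conv_nth)
  then have "length (False # concat mss) = length ?fs" using length_fields[of H k q, OF H] K by simp
  from mealy_fields_witness[OF this, of 1 False] obtain w where w: "length w = length ?x"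
    "snd (mealy tok (1, False, 0) (zip ?x w)) = toks 1 False (zip ?fs (False # concat mss))"
    unfolding encode_efield by blast
  have "zip_pad ?x w = zip ?x w" using w(1) by (intro nth_equalityI) (auto simp: zip_pad_def)
  then show ?thesis using w toks_blocks[OF K H mss, where hm = False] by (auto simp: tokens_def)
qed

end

section \<open>Moves, light cones and growth\<close>

definition restr :: "nat list \<Rightarrow> 'a list \<Rightarrow> 'a list" where
  "restr Q x = map ((!) x) Q"

definition upd :: "nat list \<Rightarrow> 'a list \<Rightarrow> 'a list \<Rightarrow> 'a list" where
  "upd Q x z = map (\<lambda>j. if j \<in> set Q then z ! (SOME p. p < length Q \<and> Q ! p = j) else x ! j) [0..<length x]"

lemma length_restr [simp]: "length (restr Q x) = length Q"
  by (simp add: restr_def)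

lemma nth_restr [simp]: "p < length Q \<Longrightarrow> restr Q x ! p = x ! (Q ! p)"
  by (simp add: restr_def)

lemma length_upd [simp]: "length (upd Q x z) = length x"
  by (simp add: upd_def)

lemma upd_out: "j < length x \<Longrightarrow> j \<notin> set Q \<Longrightarrow> upd Q x z ! j = x ! j"
  by (simp add: upd_def)

lemma upd_in:
  assumes "distinct Q" "p < length Q" "Q ! p < length x"
  shows "upd Q x z ! (Q ! p) = z ! p"
proof -
  have "(SOME p'. p' < length Q \<and> Q ! p' = Q ! p) = p"
    using assms by (intro some_equality) (auto simp: nth_eq_iff_index_eq)
  then show ?thesis using assms by (simp add: upd_def)
qed

lemma strings_length: "x \<in> strings q n \<Longrightarrow> length x = n"
  by (simp add: strings_def)

lemma strings_nth: "x \<in> strings q n \<longleftrightarrow> length x = n \<and> (\<forall>j<n. x ! j < q)"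
  by (auto simp: strings_def set_conv_nth)

lemma strings_n_lists: "strings q n = set (List.n_lists n [0..<q])"
  by (auto simp: strings_def set_n_lists)

lemma finite_strings [simp]: "finite (strings q n)"
  by (simp add: strings_n_lists)

lemma card_strings: "card (strings q n) = q ^ n"
  by (simp add: strings_n_lists distinct_card distinct_n_lists length_n_lists)

locale site =
  fixes n k :: nat and Q :: "nat list"
  assumes len: "length Q = k" and dist: "distinct Q" and sub: "set Q \<subseteq> {..<n}"
begin

lemma Q_less: "p < k \<Longrightarrow> Q ! p < n"
  using sub len nth_mem by (metis lessThan_iff subsetD)

lemma upd_nth: "length x = n \<Longrightarrow> p < k \<Longrightarrow> upd Q x z ! (Q ! p) = z ! p"
  using upd_in[of Q p x z] dist len Q_less by simp

lemma in_Q: "j \<in> set Q \<longleftrightarrow> (\<exists>p<k. j = Q ! p)"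
  using len by (auto simp: in_set_conv_nth)

lemma restr_strings: "x \<in> strings q n \<Longrightarrow> restr Q x \<in> strings q k"
  using Q_less len by (auto simp: strings_nth)

lemma upd_strings: "x \<in> strings q n \<Longrightarrow> z \<in> strings q k \<Longrightarrow> upd Q x z \<in> strings q n"
  unfolding strings_nth
proof (intro conjI allI impI)
  fix j assume x: "length x = n \<and> (\<forall>j<n. x ! j < q)" and z: "length z = k \<and> (\<forall>j<k. z ! j < q)" and j: "j < n"
  show "upd Q x z ! j < q"
  proof (cases "j \<in> set Q")
    case True
    then obtain p where "p < k" "j = Q ! p" by (auto simp: in_Q)
    then show ?thesis using x z by (simp add: upd_nth)
  next
    case False
    then show ?thesis using x j by (simp add: upd_out)
  qed
qed simp

lemma restr_upd [simp]: "length x = n \<Longrightarrow> length z = k \<Longrightarrow> restr Q (upd Q x z) = z"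
  using len by (intro nth_equalityI) (auto simp: upd_nth)

lemma upd_restr [simp]: "length x = n \<Longrightarrow> upd Q x (restr Q x) = x"
proof (intro nth_equalityI)
  fix j assume "length x = n" "j < length (upd Q x (restr Q x))"
  then show "upd Q x (restr Q x) ! j = x ! j"
    using len by (cases "j \<in> set Q") (auto simp: in_Q upd_nth upd_out)
qed simp

lemma upd_upd [simp]: "length x = n \<Longrightarrow> upd Q (upd Q x z) w = upd Q x w"
proof (intro nth_equalityI)
  fix j assume "length x = n" "j < length (upd Q (upd Q x z) w)"
  then show "upd Q (upd Q x z) w ! j = upd Q x w ! j"
    by (cases "j \<in> set Q") (auto simp: in_Q upd_nth upd_out)
qed simp

lemma upd_inj: "length x = n \<Longrightarrow> length z = k \<Longrightarrow> length w = k \<Longrightarrow> upd Q x z = upd Q x w \<Longrightarrow> z = w"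
  by (metis restr_upd)

lemma upd_of_agree:
  assumes "length x = n" "length y = n" "\<forall>j<n. j \<notin> set Q \<longrightarrow> x ! j = y ! j"
  shows "y = upd Q x (restr Q y)"
proof (rule nth_equalityI)
  fix j assume "j < length y"
  then show "y ! j = upd Q x (restr Q y) ! j"
    using assms len by (cases "j \<in> set Q") (auto simp: in_Q upd_nth upd_out)
qed (simp add: assms)

end

text \<open>The degree bound counts only terms that act non-trivially on a qudit. Conflicts and
  light cones are therefore measured by \<open>supp i\<close>, possibly smaller than
  \<open>set (Q i)\<close>; \<open>h_off_supp\<close> and \<open>h_cong\<close> express that the
  term is the identity on the remaining qudits.\<close>

locale walk =
  fixes q n k d m :: nat and Q :: "nat \<Rightarrow> nat list" and h :: "nat \<Rightarrow> nat list \<Rightarrow> nat list \<Rightarrow> real"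
    and supp :: "nat \<Rightarrow> nat set"
  assumes site: "i < m \<Longrightarrow> site n k (Q i)"
    and supp_sub: "i < m \<Longrightarrow> supp i \<subseteq> set (Q i)"
    and h_bounds: "i < m \<Longrightarrow> y \<in> strings q k \<Longrightarrow> z \<in> strings q k \<Longrightarrow> y \<noteq> z \<Longrightarrow> -1 \<le> h i y z \<and> h i y z \<le> 0"
    and h_off_supp: "i < m \<Longrightarrow> y \<in> strings q k \<Longrightarrow> z \<in> strings q k \<Longrightarrow> h i y z \<noteq> 0 \<Longrightarrow>
      p < k \<Longrightarrow> Q i ! p \<notin> supp i \<Longrightarrow> y ! p = z ! p"
    and h_cong: "i < m \<Longrightarrow> y \<in> strings q k \<Longrightarrow> z \<in> strings q k \<Longrightarrow> y' \<in> strings q k \<Longrightarrow> z' \<in> strings q k \<Longrightarrow>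
      \<forall>p<k. Q i ! p \<in> supp i \<longrightarrow> y ! p = y' ! p \<and> z ! p = z' ! p \<Longrightarrow>
      \<forall>p<k. Q i ! p \<notin> supp i \<longrightarrow> y ! p = z ! p \<and> y' ! p = z' ! p \<Longrightarrow> h i y z = h i y' z'"
    and degree: "v < n \<Longrightarrow> card {i. i < m \<and> v \<in> supp i} \<le> d"
begin

definition edge :: "nat \<Rightarrow> nat list \<Rightarrow> nat list \<Rightarrow> bool" where
  "edge i y z \<longleftrightarrow> z \<in> strings q k \<and> y \<noteq> z \<and> h i y z < 0"

definition move :: "nat \<Rightarrow> nat list \<Rightarrow> nat list \<Rightarrow> bool" where
  "move i x y \<longleftrightarrow> (\<exists>z. edge i (restr (Q i) x) z \<and> y = upd (Q i) x z)"

text \<open>The index is an upper bound on the number of moves, since \<open>reach_refl\<close>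
  holds for every \<open>c\<close>.\<close>

inductive reach :: "nat \<Rightarrow> nat list \<Rightarrow> nat list \<Rightarrow> bool" where
  reach_refl: "reach c x x"
| reach_step: "reach c x y \<Longrightarrow> i < m \<Longrightarrow> move i y y' \<Longrightarrow> reach (Suc c) x y'"

lemma reach_Suc: "reach c x y \<Longrightarrow> reach (Suc c) x y"
  by (induction rule: reach.induct) (auto intro: reach.intros)

lemma reach_mono:
  assumes "reach c x y" "c \<le> c'"
  shows "reach c' x y"
proof -
  have "reach (c + e) x y" for e using assms(1) by (induction e) (auto intro: reach_Suc)
  then show ?thesis using assms(2) le_Suc_ex by blast
qed

lemma move_strings: "i < m \<Longrightarrow> x \<in> strings q n \<Longrightarrow> move i x y \<Longrightarrow> y \<in> strings q n"
  using site.upd_strings[OF site] by (fastforce simp: move_def edge_def)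

lemma reach_strings: "reach c x y \<Longrightarrow> x \<in> strings q n \<Longrightarrow> y \<in> strings q n"
  by (induction rule: reach.induct) (auto intro: move_strings)

definition app :: "nat \<Rightarrow> nat list set \<Rightarrow> nat list set" where
  "app i S = S \<union> {y'. \<exists>y\<in>S. move i y y'}"

definition apps :: "nat list \<Rightarrow> nat list set \<Rightarrow> nat list set" where
  "apps l S = fold app l S"

lemma app_strings: "i < m \<Longrightarrow> S \<subseteq> strings q n \<Longrightarrow> app i S \<subseteq> strings q n"
  using move_strings by (auto simp: app_def)

lemma apps_strings: "set l \<subseteq> {..<m} \<Longrightarrow> S \<subseteq> strings q n \<Longrightarrow> apps l S \<subseteq> strings q n"
  by (induction l arbitrary: S) (auto simp: apps_def dest: app_strings)

definition agree :: "nat set \<Rightarrow> nat list \<Rightarrow> nat list \<Rightarrow> bool" where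
  "agree C x y \<longleftrightarrow> (\<forall>v\<in>C. v < n \<longrightarrow> x ! v = y ! v)"

lemma move_agree_off:
  assumes "i < m" "x \<in> strings q n" "move i x y" "supp i \<inter> C = {}"
  shows "agree C y x"
  unfolding agree_def
proof (intro ballI impI)
  interpret site n k "Q i" by (rule site[OF assms(1)])
  fix v assume v: "v \<in> C" "v < n"
  obtain z where z: "edge i (restr (Q i) x) z" "y = upd (Q i) x z" using assms(3) by (auto simp: move_def)
  have lx: "length x = n" using assms(2) by (rule strings_length)
  show "y ! v = x ! v"
  proof (cases "v \<in> set (Q i)")
    case True
    then obtain p where p: "p < k" "v = Q i ! p" by (auto simp: in_Q)
    have "restr (Q i) x ! p = z ! p"
      using h_off_supp[OF assms(1) restr_strings[OF assms(2)], of z p] z(1) assms(4) v p by (auto simp: edge_def)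
    then show ?thesis using p z(2) lx len by (simp add: upd_nth)
  qed (use z lx v in \<open>simp add: upd_out\<close>)
qed

text \<open>A move can be replayed from any string with the same view of its support: take the new
  letters on \<open>supp i\<close> and keep those of \<open>x'\<close> elsewhere. The matrix entry
  is then the same by \<open>h_cong\<close>.\<close>

lemma move_transfer:
  assumes i: "i < m" and x: "x \<in> strings q n" "x' \<in> strings q n" and mv: "move i x y"
    and ag: "agree (C \<union> supp i) x' x"
  shows "\<exists>y'. move i x' y' \<and> agree C y' y"
proof -
  interpret site n k "Q i" by (rule site[OF i])
  obtain z where z: "edge i (restr (Q i) x) z" "y = upd (Q i) x z" using mv by (auto simp: move_def)
  have zs: "z \<in> strings q k" using z by (simp add: edge_def)
  have lx: "length x = n" "length x' = n" using x by (auto intro: strings_length)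
  define z' where "z' = map (\<lambda>p. if Q i ! p \<in> supp i then z ! p else x' ! (Q i ! p)) [0..<k]"
  have z'n: "z' ! p = (if Q i ! p \<in> supp i then z ! p else x' ! (Q i ! p))" if "p < k" for p
    using that by (simp add: z'_def)
  have z's: "z' \<in> strings q k"
    using zs restr_strings[OF x(2)] len by (auto simp: z'_def strings_nth)
  have off: "restr (Q i) x ! p = z ! p" if "p < k" "Q i ! p \<notin> supp i" for p
    using h_off_supp[OF i restr_strings[OF x(1)] zs _ that] z(1) by (auto simp: edge_def)
  have on: "x' ! (Q i ! p) = x ! (Q i ! p)" if "p < k" "Q i ! p \<in> supp i" for p
    using ag Q_less[OF that(1)] that(2) by (auto simp: agree_def)
  have "h i (restr (Q i) x) z = h i (restr (Q i) x') z'"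
    using off on z'n len
    by (intro h_cong[OF i restr_strings[OF x(1)] zs restr_strings[OF x(2)] z's]) auto
  moreover have "restr (Q i) x' \<noteq> z'"
  proof
    assume eq: "restr (Q i) x' = z'"
    have "restr (Q i) x = z"
    proof (rule nth_equalityI)
      show "length (restr (Q i) x) = length z" using zs len by (simp add: strings_length)
      fix p assume "p < length (restr (Q i) x)"
      then have p: "p < k" using len by simp
      show "restr (Q i) x ! p = z ! p"
      proof (cases "Q i ! p \<in> supp i")
        case True
        then show ?thesis using arg_cong[OF eq, of "\<lambda>l. l ! p"] on[OF p] z'n[OF p] p len by simp
      qed (use off p in blast)
    qed
    then show False using z(1) by (simp add: edge_def)
  qed
  ultimately have mv': "move i x' (upd (Q i) x' z')"
    using z(1) z's by (auto simp: move_def edge_def)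
  have "agree C (upd (Q i) x' z') y"
    unfolding agree_def
  proof (intro ballI impI)
    fix v assume v: "v \<in> C" "v < n"
    then have eq: "x' ! v = x ! v" using ag by (auto simp: agree_def)
    show "upd (Q i) x' z' ! v = y ! v"
    proof (cases "v \<in> set (Q i)")
      case True
      then obtain p where p: "p < k" "v = Q i ! p" by (auto simp: in_Q)
      then show ?thesis using z(2) lx z'n off eq len by (auto simp: upd_nth)
    next
      case False
      then show ?thesis using z(2) lx v eq by (simp add: upd_out)
    qed
  qed
  then show ?thesis using mv' by blast
qed

section \<open>Layers and light cones\<close>

fun disjoint_supports :: "nat list \<Rightarrow> bool" where
  "disjoint_supports [] \<longleftrightarrow> True"
| "disjoint_supports (i # l) \<longleftrightarrow> (\<forall>j\<in>set l. supp i \<inter> supp j = {}) \<and> disjoint_supports l"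

lemma disjoint_supports_snoc:
  "disjoint_supports (l @ [i]) \<longleftrightarrow> disjoint_supports l \<and> (\<forall>j\<in>set l. supp j \<inter> supp i = {})"
  by (induction l) auto

definition touched :: "nat list \<Rightarrow> nat set \<Rightarrow> nat set" where
  "touched l C = {i \<in> set l. supp i \<inter> C \<noteq> {}}"

lemma finite_touched [simp]: "finite (touched l C)"
  by (simp add: touched_def)

text \<open>The layer is traced backwards. A last term that misses \<open>C\<close> can be omitted
  without changing the view of \<open>C\<close>. Otherwise its support joins \<open>C\<close>, but
  by disjointness it touches no earlier term of the layer, so the set of touched terms does not
  spread and each costs at most one move.\<close>

lemma light_cone_layer:
  assumes "disjoint_supports l" "set l \<subseteq> {..<m}" "S \<subseteq> strings q n" "x \<in> strings q n" "y \<in> apps l S"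
    and "\<And>y0. y0 \<in> S \<Longrightarrow> \<exists>y'. reach c x y' \<and> agree (C \<union> (\<Union>i\<in>touched l C. supp i)) y' y0"
  shows "\<exists>y'. reach (c + card (touched l C)) x y' \<and> agree C y' y"
  using assms
proof (induction l arbitrary: y C rule: rev_induct)
  case Nil
  then show ?case by (simp add: apps_def touched_def)
next
  case (snoc i l)
  have i: "i < m" and l: "set l \<subseteq> {..<m}" "disjoint_supports l" "\<forall>j\<in>set l. supp j \<inter> supp i = {}"
    using snoc.prems(1,2) by (auto simp: disjoint_supports_snoc)
  have "y \<in> app i (apps l S)" using snoc.prems(5) by (simp add: apps_def)
  then consider "y \<in> apps l S" | y0 where "y0 \<in> apps l S" "move i y0 y" by (auto simp: app_def)
  then have cases: "\<exists>y0\<in>apps l S. y = y0 \<or> move i y0 y" by cases auto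
  then obtain y0 where y0: "y0 \<in> apps l S" "y = y0 \<or> move i y0 y" by blast
  have y0s: "y0 \<in> strings q n" using y0(1) apps_strings[OF l(1) snoc.prems(3)] by blast
  show ?case
  proof (cases "supp i \<inter> C = {}")
    case True
    then have t: "touched (l @ [i]) C = touched l C" by (auto simp: touched_def)
    obtain y' where y': "reach (c + card (touched l C)) x y'" "agree C y' y0"
      using snoc.IH[OF l(2,1) snoc.prems(3,4) y0(1), of C] snoc.prems(6) unfolding t by blast
    have "agree C y y0"
      using y0(2) move_agree_off[OF i y0s _ True] by (auto simp: agree_def)
    then show ?thesis using y' unfolding t by (auto simp: agree_def)
  next
    case False
    have t: "touched l (C \<union> supp i) = touched l C" using l(3) by (auto simp: touched_def)
    have "i \<notin> touched l C" using l(3) False by (auto simp: touched_def)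
    moreover have t': "touched (l @ [i]) C = insert i (touched l C)" using False by (auto simp: touched_def)
    ultimately have card: "card (touched (l @ [i]) C) = Suc (card (touched l C))" by simp
    have "C \<union> (\<Union>j\<in>touched (l @ [i]) C. supp j) = C \<union> supp i \<union> (\<Union>j\<in>touched l C. supp j)"
      unfolding t' by auto
    then obtain y' where y': "reach (c + card (touched l C)) x y'" "agree (C \<union> supp i) y' y0"
      using snoc.IH[OF l(2,1) snoc.prems(3,4) y0(1), of "C \<union> supp i"] snoc.prems(6) unfolding t by metis
    show ?thesis
    proof (cases "y = y0")
      case True
      then show ?thesis using y'(2) reach_Suc[OF y'(1)] unfolding card by (auto simp: agree_def)
    next
      case False
      then obtain y'' where "move i y' y''" "agree C y'' y"
        using move_transfer[OF i y0s reach_strings[OF y'(1) snoc.prems(4)] _ y'(2)] y0(2) by blast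
      then show ?thesis using reach_step[OF y'(1) i] unfolding card by auto
    qed
  qed
qed

text \<open>The set may be exponentially large and its strings far from \<open>x\<close>, but each
  of its views through at most \<open>e\<close> qudits already occurs within \<open>c\<close>
  moves.\<close>

definition approx :: "nat list \<Rightarrow> nat list set \<Rightarrow> nat \<Rightarrow> nat \<Rightarrow> bool" where
  "approx x S c e \<longleftrightarrow> (\<forall>y\<in>S. \<forall>C. finite C \<and> card C \<le> e \<longrightarrow> (\<exists>y'. reach c x y' \<and> agree C y' y))"

text \<open>Choosing a point of \<open>C\<close> in the support of each touched term is injective
  because the supports are disjoint.\<close>

lemma card_touched:
  assumes "disjoint_supports l" "finite C"
  shows "card (touched l C) \<le> card C"
proof -
  define f where "f i = (SOME v. v \<in> supp i \<inter> C)" for i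
  have f: "f i \<in> supp i \<inter> C" if "i \<in> touched l C" for i
    unfolding f_def some_in_eq using that by (auto simp: touched_def)
  have disj: "supp i \<inter> supp j = {}" if "i \<in> set l" "j \<in> set l" "i \<noteq> j" for i j
    using assms(1) that
  proof (induction l)
    case (Cons a l)
    then show ?case by (cases "i = a"; cases "j = a") (auto simp: Int_commute)
  qed simp
  have "inj_on f (touched l C)"
  proof (rule inj_onI)
    fix i j assume ij: "i \<in> touched l C" "j \<in> touched l C" "f i = f j"
    then have "f i \<in> supp i \<inter> supp j" using f[of i] f[of j] by simp
    then show "i = j" using disj[of i j] ij(1,2) by (auto simp: touched_def)
  qed
  then show ?thesis using f assms(2) by (intro card_inj_on_le[of f]) auto
qed

text \<open>A view of \<open>e\<close> qudits touches at most \<open>e\<close> terms of the layer.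
  Their supports add at most \<open>k * e\<close> qudits to the view that is needed before the
  layer, and replaying them costs at most \<open>e\<close> moves.\<close>

lemma approx_layer:
  assumes "approx x S c (Suc k * e)" "disjoint_supports l" "set l \<subseteq> {..<m}" "S \<subseteq> strings q n" "x \<in> strings q n"
  shows "approx x (apps l S) (c + e) e"
  unfolding approx_def
proof (intro ballI allI impI)
  fix y and C :: "nat set" assume y: "y \<in> apps l S" and C: "finite C \<and> card C \<le> e"
  let ?C = "C \<union> (\<Union>i\<in>touched l C. supp i)"
  have fin: "finite (supp i)" "card (supp i) \<le> k" if "i \<in> touched l C" for i
  proof -
    have i: "i < m" using that assms(3) by (auto simp: touched_def)
    interpret site n k "Q i" by (rule site[OF i])
    show "finite (supp i)" "card (supp i) \<le> k"
      using supp_sub[OF i] len finite_subset card_mono[OF finite_set supp_sub[OF i]] card_length[of "Q i"]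
      by (auto intro: order_trans)
  qed
  have "card (touched l C) \<le> e" using card_touched[OF assms(2), of C] C by simp
  moreover have "card (\<Union>i\<in>touched l C. supp i) \<le> card (touched l C) * k"
    using card_UN_le[OF finite_touched[of l C], of supp] sum_bounded_above[of "touched l C" "\<lambda>i. card (supp i)" k, OF fin(2)] fin(2)
    by (auto intro: order_trans)
  ultimately have "card (\<Union>i\<in>touched l C. supp i) \<le> e * k" by (meson mult_right_mono order_trans zero_le)
  then have "card ?C \<le> Suc k * e"
    using card_Un_le[of C "\<Union>i\<in>touched l C. supp i"] C by (simp add: algebra_simps)
  moreover have "finite ?C" using C fin by auto
  ultimately have "\<exists>y'. reach c x y' \<and> agree ?C y' y0" if "y0 \<in> S" for y0
    using assms(1) that by (auto simp: approx_def)
  from light_cone_layer[OF assms(2,3,4,5) y this]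
  obtain y' where "reach (c + card (touched l C)) x y'" "agree C y' y" by blast
  then show "\<exists>y'. reach (c + e) x y' \<and> agree C y' y"
    using \<open>card (touched l C) \<le> e\<close> by (meson add_left_mono reach_mono)
qed

lemma approx_mono: "approx x S c e \<Longrightarrow> c \<le> c' \<Longrightarrow> e' \<le> e \<Longrightarrow> approx x S c' e'"
  unfolding approx_def by (meson order_trans reach_mono)

section \<open>Energy and expansion of sets of strings\<close>

definition row_sum :: "nat \<Rightarrow> nat list \<Rightarrow> real" where
  "row_sum i y = (\<Sum>w\<in>strings q k. h i y w)"

text \<open>This is the real part of the expectation of the lifted term in the subset state of
  \<open>S\<close>, multiplied by \<open>card S\<close>.\<close>

definition energy :: "nat \<Rightarrow> nat list set \<Rightarrow> real" where
  "energy i S = (\<Sum>y\<in>S. \<Sum>w | w \<in> strings q k \<and> upd (Q i) y w \<in> S. h i (restr (Q i) y) w)"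

definition leaving :: "nat \<Rightarrow> nat list set \<Rightarrow> nat list set" where
  "leaving i S = {y \<in> S. \<exists>w. edge i (restr (Q i) y) w \<and> upd (Q i) y w \<notin> S}"

text \<open>Each row sum splits into entries that stay in \<open>S\<close> and entries that lead out
  of it. The second part vanishes unless the string is leaving, and even then it is at least -q^k,
  as off-diagonal entries lie between -1 and 0.\<close>

lemma energy_le:
  assumes i: "i < m" and S: "S \<subseteq> strings q n" and row: "\<And>y. y \<in> S \<Longrightarrow> row_sum i (restr (Q i) y) \<le> \<delta>"
  shows "energy i S \<le> \<delta> * card S + q ^ k * card (leaving i S)"
proof -
  interpret site n k "Q i" by (rule site[OF i])
  have fS: "finite S" using S finite_subset finite_strings by blast
  have one: "(\<Sum>w | w \<in> strings q k \<and> upd (Q i) y w \<in> S. h i (restr (Q i) y) w)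
      \<le> \<delta> + (if y \<in> leaving i S then q ^ k else 0)" if y: "y \<in> S" for y
  proof -
    let ?r = "restr (Q i) y"
    have ly: "length y = n" using y S strings_length by blast
    have r: "?r \<in> strings q k" using y S restr_strings by blast
    let ?A = "{w. w \<in> strings q k \<and> upd (Q i) y w \<in> S}" and ?B = "{w \<in> strings q k. upd (Q i) y w \<notin> S}"
    have "row_sum i ?r = sum (h i ?r) ?A + sum (h i ?r) ?B"
      unfolding row_sum_def by (subst sum.union_disjoint[symmetric]) (auto intro!: sum.cong)
    then have eq: "sum (h i ?r) ?A \<le> \<delta> - sum (h i ?r) ?B" using row[OF y] by simp
    have ne: "?r \<noteq> w" if "w \<in> ?B" for w using that y ly by auto
    show ?thesis
    proof (cases "y \<in> leaving i S")
      case True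
      have "(\<Sum>w\<in>?B. -1) \<le> sum (h i ?r) ?B"
        by (rule sum_mono) (use h_bounds[OF i r] ne in auto)
      then have "- real (card ?B) \<le> sum (h i ?r) ?B" by simp
      moreover have "real (card ?B) \<le> real q ^ k"
        using card_mono[of "strings q k" ?B] by (simp add: card_strings flip: of_nat_power)
      ultimately have "sum (h i ?r) ?A \<le> \<delta> + real q ^ k" using eq by linarith
      then show ?thesis using True by simp
    next
      case False
      have "h i ?r w = 0" if "w \<in> ?B" for w
        using False that ne[OF that] h_bounds[OF i r, of w] y by (force simp: leaving_def edge_def)
      then show ?thesis using eq False by simp
    qed
  qed
  have "energy i S \<le> (\<Sum>y\<in>S. \<delta> + (if y \<in> leaving i S then q ^ k else 0))"
    unfolding energy_def by (rule sum_mono) (rule one)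
  also have "\<dots> = \<delta> * card S + q ^ k * card (leaving i S)"
  proof -
    have "(\<Sum>y\<in>S. if y \<in> leaving i S then real q ^ k else 0) = (\<Sum>y\<in>leaving i S. real q ^ k)"
      by (rule sum.mono_neutral_cong_right) (auto simp: leaving_def fS)
    then show ?thesis by (simp add: sum.distrib mult.commute if_distrib[of real] cong: if_cong)
  qed
  finally show ?thesis .
qed

text \<open>A leaving string can be recovered from the new string it leads to together with its own
  restriction to \<open>Q i\<close>, for which there are at most q^k choices.\<close>

lemma card_app:
  assumes i: "i < m" and S: "S \<subseteq> strings q n"
  shows "card (leaving i S) \<le> q ^ k * (card (app i S) - card S)"
proof -
  interpret site n k "Q i" by (rule site[OF i])
  have fA: "finite (app i S)" using app_strings[OF i S] finite_subset finite_strings by blast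
  define N where "N = app i S - S"
  have fN: "finite N" using fA by (simp add: N_def)
  have "leaving i S \<subseteq> (\<lambda>(u, w). upd (Q i) u w) ` (N \<times> strings q k)"
  proof
    fix y assume y: "y \<in> leaving i S"
    then obtain w where w: "edge i (restr (Q i) y) w" "upd (Q i) y w \<notin> S" "y \<in> S" by (auto simp: leaving_def)
    then have ly: "length y = n" and ys: "y \<in> strings q n" using S strings_length by auto
    have "upd (Q i) y w \<in> N" using w by (auto simp: N_def app_def move_def)
    moreover have "y = upd (Q i) (upd (Q i) y w) (restr (Q i) y)" using ly by simp
    ultimately show "y \<in> (\<lambda>(u, w). upd (Q i) u w) ` (N \<times> strings q k)"
      using restr_strings[OF ys] by force
  qed
  then have "card (leaving i S) \<le> card ((\<lambda>(u, w). upd (Q i) u w) ` (N \<times> strings q k))"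
    using fN by (intro card_mono) auto
  also have "\<dots> \<le> card (N \<times> strings q k)" using fN by (intro card_image_le) auto
  finally have "card (leaving i S) \<le> card (N \<times> strings q k)" .
  moreover have "card N = card (app i S) - card S"
    unfolding N_def using fA by (intro card_Diff_subset) (auto simp: app_def intro: finite_subset)
  ultimately show ?thesis by (simp add: card_cartesian_product card_strings mult.commute)
qed

lemma card_conflicts:
  assumes "U \<subseteq> {..<m}"
  shows "card {i. i < m \<and> (\<exists>j\<in>U. supp i \<inter> supp j \<noteq> {})} \<le> card U * (k * d)"
proof -
  have fU: "finite U" using assms finite_subset by blast
  have "{i. i < m \<and> (\<exists>j\<in>U. supp i \<inter> supp j \<noteq> {})} \<subseteq> (\<Union>j\<in>U. \<Union>v\<in>supp j. {i. i < m \<and> v \<in> supp i})"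
    by auto
  moreover have fin: "finite (supp j)" "card (supp j) \<le> k" "supp j \<subseteq> {..<n}" if "j \<in> U" for j
  proof -
    have j: "j < m" using that assms by auto
    interpret site n k "Q j" by (rule site[OF j])
    show "finite (supp j)" "card (supp j) \<le> k"
      using supp_sub[OF j] len finite_subset card_mono[OF finite_set supp_sub[OF j]] card_length[of "Q j"]
      by (auto intro: order_trans)
    show "supp j \<subseteq> {..<n}" using supp_sub[OF j] sub by auto
  qed
  ultimately have "card {i. i < m \<and> (\<exists>j\<in>U. supp i \<inter> supp j \<noteq> {})} \<le>
      card (\<Union>j\<in>U. \<Union>v\<in>supp j. {i. i < m \<and> v \<in> supp i})"
    using fU by (intro card_mono) auto
  also have "\<dots> \<le> (\<Sum>j\<in>U. card (\<Union>v\<in>supp j. {i. i < m \<and> v \<in> supp i}))"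
    by (rule card_UN_le[OF fU])
  also have "\<dots> \<le> (\<Sum>j\<in>U. k * d)"
  proof (rule sum_mono)
    fix j assume j: "j \<in> U"
    have "card (\<Union>v\<in>supp j. {i. i < m \<and> v \<in> supp i}) \<le> (\<Sum>v\<in>supp j. card {i. i < m \<and> v \<in> supp i})"
      by (rule card_UN_le[OF fin(1)[OF j]])
    also have "\<dots> \<le> (\<Sum>v\<in>supp j. d)" using fin(3)[OF j] degree by (intro sum_mono) auto
    also have "\<dots> \<le> k * d" using fin(2)[OF j] by simp
    finally show "card (\<Union>v\<in>supp j. {i. i < m \<and> v \<in> supp i}) \<le> k * d" .
  qed
  finally show ?thesis by simp
qed

text \<open>A row sum depends on the view of \<open>k\<close> qudits only, so a bound for the
  reachable strings extends to all of \<open>S\<close>.\<close>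

lemma approx_row_sum:
  assumes "approx x S c k" "y \<in> S" "i < m" "x \<in> strings q n"
    and rows: "\<And>y i. reach c x y \<Longrightarrow> i < m \<Longrightarrow> row_sum i (restr (Q i) y) \<le> \<delta>"
  shows "row_sum i (restr (Q i) y) \<le> \<delta>"
proof -
  interpret site n k "Q i" by (rule site[OF assms(3)])
  have "card (set (Q i)) \<le> k" using card_length[of "Q i"] len by simp
  then obtain y' where y': "reach c x y'" "agree (set (Q i)) y' y"
    using assms(1,2) by (auto simp: approx_def)
  have "restr (Q i) y' = restr (Q i) y"
    using y'(2) sub by (auto simp: restr_def agree_def)
  then show ?thesis using rows[OF y'(1) assms(3)] by simp
qed

text \<open>If every compatible term had at most \<open>\<epsilon> / (4 * q ^ k) * card S\<close>
  leaving strings, it would contribute at most \<epsilon>/4 through row sums and \<epsilon>/4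
  through leaving strings, relative to \<open>card S\<close>. The additional share of all
  conflicting terms is at most \<open>\<epsilon> * m / 4\<close>. This makes three quarters of the
  assumed energy. The second factor q^k in the growth rate converts leaving strings into new
  ones.\<close>

lemma grow:
  fixes \<epsilon> :: real
  assumes \<epsilon>: "\<epsilon> > 0" and S: "S \<subseteq> strings q n" "S \<noteq> {}" and q: "q \<ge> 1" and m: "m > 0"
    and energy: "\<epsilon> * m * card S \<le> (\<Sum>i<m. energy i S)"
    and rows: "\<And>y i. y \<in> S \<Longrightarrow> i < m \<Longrightarrow> row_sum i (restr (Q i) y) \<le> \<epsilon> / 4"
    and U: "U \<subseteq> {..<m}" "card U * (4 * real (k * d) * real q ^ k) \<le> \<epsilon> * m"
  shows "\<exists>i<m. (\<forall>j\<in>U. supp i \<inter> supp j = {}) \<and> (1 + \<epsilon> / (4 * real q ^ k * real q ^ k)) * card S \<le> card (app i S)"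
proof -
  let ?K = "real q ^ k"
  have fS: "finite S" using S finite_subset finite_strings by blast
  then have cS: "real (card S) > 0" using S by (simp add: card_gt_0_iff)
  have K: "?K > 0" using q by simp
  define conf where "conf = {i. i < m \<and> (\<exists>j\<in>U. supp i \<inter> supp j \<noteq> {})}"
  have fconf: "finite conf" "conf \<subseteq> {..<m}" by (auto simp: conf_def)
  have "\<exists>i<m. i \<notin> conf \<and> \<epsilon> / (4 * ?K) * card S \<le> card (leaving i S)"
  proof (rule ccontr)
    assume "\<not> ?thesis"
    then have no: "real (card (leaving i S)) \<le> \<epsilon> / (4 * ?K) * card S" if "i < m" "i \<notin> conf" for i
      using that by (meson linear)
    have e: "energy i S \<le> \<epsilon> / 2 * card S + (if i \<in> conf then ?K * card S else 0)" if i: "i < m" for i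
    proof -
      have le: "energy i S \<le> \<epsilon> / 4 * card S + ?K * card (leaving i S)"
        using energy_le[OF i S(1), of "\<epsilon> / 4"] rows i by simp
      show ?thesis
      proof (cases "i \<in> conf")
        case True
        have "card (leaving i S) \<le> card S" using fS by (intro card_mono) (auto simp: leaving_def)
        then have "?K * card (leaving i S) \<le> ?K * card S" using K by (intro mult_left_mono) auto
        moreover have "\<epsilon> / 4 * card S \<le> \<epsilon> / 2 * card S" using \<epsilon> by (intro mult_right_mono) auto
        ultimately show ?thesis using le True by simp
      next
        case False
        have "?K * card (leaving i S) \<le> ?K * (\<epsilon> / (4 * ?K) * card S)"
          using K no[OF i False] by (intro mult_left_mono) auto
        also have "\<dots> = \<epsilon> / 4 * card S" using K by simp
        finally show ?thesis using le False by simp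
      qed
    qed
    have "(\<Sum>i<m. energy i S) \<le> (\<Sum>i<m. \<epsilon> / 2 * card S + (if i \<in> conf then ?K * card S else 0))"
      by (rule sum_mono) (use e in simp)
    also have "\<dots> = m * (\<epsilon> / 2 * card S) + card conf * (?K * card S)"
    proof -
      have "(\<Sum>i<m. if i \<in> conf then ?K * card S else 0) = (\<Sum>i\<in>conf. ?K * card S)"
        by (rule sum.mono_neutral_cong_right) (use fconf in auto)
      then show ?thesis by (simp add: sum.distrib)
    qed
    also have "\<dots> \<le> m * (\<epsilon> / 2 * card S) + \<epsilon> * m / 4 * card S"
    proof -
      have "real (card conf) \<le> real (card U * (k * d))"
        using card_conflicts[OF U(1)] unfolding conf_def by (simp only: of_nat_le_iff)
      then have "card conf * ?K \<le> real (card U * (k * d)) * ?K" using K by (intro mult_right_mono) auto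
      also have "\<dots> \<le> \<epsilon> * m / 4" using U(2) by simp
      finally show ?thesis using cS by (simp add: mult.assoc[symmetric] mult_right_mono)
    qed
    also have "\<dots> < \<epsilon> * m * card S" using \<epsilon> m cS by (simp add: field_simps)
    finally show False using energy by simp
  qed
  then obtain i where i: "i < m" "i \<notin> conf" "\<epsilon> / (4 * ?K) * card S \<le> card (leaving i S)" by blast
  have fA: "finite (app i S)" using app_strings[OF i(1) S(1)] finite_subset finite_strings by blast
  have sub: "card S \<le> card (app i S)" using fA by (intro card_mono) (auto simp: app_def)
  have "real (card (leaving i S)) \<le> real (q ^ k * (card (app i S) - card S))"
    using card_app[OF i(1) S(1)] by (simp only: of_nat_le_iff)
  then have "\<epsilon> / (4 * ?K) * card S \<le> ?K * (real (card (app i S)) - card S)"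
    using i(3) sub by (simp add: of_nat_diff)
  then have "\<epsilon> / (4 * ?K * ?K) * card S \<le> real (card (app i S)) - card S"
    using K by (simp add: field_simps)
  then have "(1 + \<epsilon> / (4 * ?K * ?K)) * card S \<le> card (app i S)" by (simp add: algebra_simps)
  then show ?thesis using i(1,2) by (intro exI[of _ i]) (auto simp: conf_def)
qed

section \<open>Iterated growth in layers\<close>

context
  fixes \<epsilon> :: real and x :: "nat list" and lmax g :: nat
  assumes \<epsilon>: "\<epsilon> > 0" and q: "q \<ge> 1" and m: "m > 0"
    and energy: "\<And>S. S \<subseteq> strings q n \<Longrightarrow> S \<noteq> {} \<Longrightarrow> \<epsilon> * m * card S \<le> (\<Sum>i<m. energy i S)"
    and x: "x \<in> strings q n"
    and rows: "\<And>y i. reach lmax x y \<Longrightarrow> i < m \<Longrightarrow> row_sum i (restr (Q i) y) \<le> \<epsilon> / 4"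
    and g: "(real g - 1) * (4 * real (k * d) * real q ^ k) \<le> \<epsilon> * m"
begin

text \<open>Every partial list is itself one layer over the initial set, so the cost of its local
  views does not accumulate while the layer is built. A further term is chosen when at most
  \<open>g - 1\<close> are in use, hence the form of the assumption on \<open>g\<close>.\<close>

lemma grow_layer:
  assumes "S \<subseteq> strings q n" "S \<noteq> {}" "approx x S c (Suc k * k)" "c + k \<le> lmax" "j \<le> g"
  shows "\<exists>l. length l = j \<and> set l \<subseteq> {..<m} \<and> disjoint_supports l \<and>
    (1 + \<epsilon> / (4 * real q ^ k * real q ^ k)) ^ j * card S \<le> card (apps l S)"
  using assms(5)
proof (induction j)
  case 0
  show ?case by (intro exI[of _ "[]"]) (simp add: apps_def)
next
  case (Suc j)
  then obtain l where l: "length l = j" "set l \<subseteq> {..<m}" "disjoint_supports l"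
    "(1 + \<epsilon> / (4 * real q ^ k * real q ^ k)) ^ j * card S \<le> card (apps l S)" by auto
  let ?S = "apps l S"
  have "S \<subseteq> apps l S" for l by (induction l rule: rev_induct) (auto simp: apps_def app_def)
  then have ne: "?S \<noteq> {}" using assms(2) by auto
  have S: "?S \<subseteq> strings q n" by (rule apps_strings[OF l(2) assms(1)])
  have "approx x ?S (c + k) k" using approx_layer[OF assms(3) l(3,2) assms(1) x] .
  then have "approx x ?S lmax k" using approx_mono assms(4) by blast
  then have rows': "row_sum i (restr (Q i) y) \<le> \<epsilon> / 4" if "y \<in> ?S" "i < m" for y i
    using approx_row_sum[of x ?S lmax y i "\<epsilon> / 4"] that x rows by blast
  have "real (card (set l)) \<le> real g - 1" using Suc.prems l(1) card_length[of l] by simp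
  then have "card (set l) * (4 * real (k * d) * real q ^ k) \<le> (real g - 1) * (4 * real (k * d) * real q ^ k)"
    by (intro mult_right_mono) auto
  also have "\<dots> \<le> \<epsilon> * m" by (rule g)
  finally obtain i where i: "i < m" "\<forall>j\<in>set l. supp i \<inter> supp j = {}"
    "(1 + \<epsilon> / (4 * real q ^ k * real q ^ k)) * card ?S \<le> card (app i ?S)"
    using grow[OF \<epsilon> S ne q m energy[OF S ne] rows' l(2)] by blast
  have "(1 + \<epsilon> / (4 * real q ^ k * real q ^ k)) ^ Suc j * card S \<le> (1 + \<epsilon> / (4 * real q ^ k * real q ^ k)) * card ?S"
    using mult_left_mono[OF l(4), of "1 + \<epsilon> / (4 * real q ^ k * real q ^ k)"] \<epsilon> by (simp add: mult.assoc)
  then show ?case using i l(1-3)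
    by (intro exI[of _ "l @ [i]"]) (auto simp: disjoint_supports_snoc apps_def Int_commute)
qed

text \<open>By \<open>approx_layer\<close> the number of moves satisfies c(T + 1, e) = c(T, (k + 1)
  e) + e; the expression used here is a crude bound for the solution.\<close>

lemma grow_layers:
  assumes "T * Suc k ^ T * k \<le> lmax"
  shows "\<exists>S. S \<subseteq> strings q n \<and> S \<noteq> {} \<and> (\<forall>e. approx x S (T * Suc k ^ T * e) e) \<and>
    (1 + \<epsilon> / (4 * real q ^ k * real q ^ k)) ^ (g * T) \<le> card S"
  using assms
proof (induction T)
  case 0
  show ?case using x by (intro exI[of _ "{x}"]) (auto simp: approx_def agree_def intro: reach_refl)
next
  case (Suc T)
  let ?\<rho> = "1 + \<epsilon> / (4 * real q ^ k * real q ^ k)"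
  have le: "T * Suc k ^ T * (Suc k * e) + e \<le> Suc T * Suc k ^ Suc T * e" for e
  proof -
    have "1 * e \<le> Suc k ^ Suc T * e" by (intro mult_right_mono one_le_power) auto
    then show ?thesis by (simp add: algebra_simps)
  qed
  have "T * Suc k ^ T * k \<le> T * Suc k ^ T * (Suc k * k) + k" by (simp add: algebra_simps)
  then have "T * Suc k ^ T * k \<le> lmax" using le[of k] Suc.prems by linarith
  then obtain S where S: "S \<subseteq> strings q n" "S \<noteq> {}" "\<And>e. approx x S (T * Suc k ^ T * e) e"
    "?\<rho> ^ (g * T) \<le> card S" using Suc.IH by blast
  obtain l where l: "set l \<subseteq> {..<m}" "disjoint_supports l" "?\<rho> ^ g * card S \<le> card (apps l S)"
    using grow_layer[OF S(1,2,3), of g] le[of k] Suc.prems by fastforce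
  have "S \<subseteq> apps l S" for l by (induction l rule: rev_induct) (auto simp: apps_def app_def)
  then have "apps l S \<noteq> {}" using S(2) by auto
  moreover have "approx x (apps l S) (Suc T * Suc k ^ Suc T * e) e" for e
    using approx_mono[OF approx_layer[OF S(3) l(2,1) S(1) x] le] by blast
  moreover have "?\<rho> ^ (g * Suc T) \<le> card (apps l S)"
    using mult_left_mono[OF S(4), of "?\<rho> ^ g"] l(3) \<epsilon> by (simp add: power_add)
  ultimately show ?case using apps_strings[OF l(1) S(1)] by blast
qed

end

text \<open>A layer has more than \<open>\<gamma> * m\<close> terms, so \<open>T\<close> layers with \<open>\<rho> powr (\<gamma> * T) > q\<close> would produce
  more than \<open>q ^ m \<ge> q ^ n\<close> strings.\<close>

theorem bad_string_nearby:
  fixes \<epsilon> :: real and T :: nat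
  assumes \<epsilon>: "\<epsilon> > 0" and q: "q \<ge> 1" and m: "m > 0" "n \<le> m" and x: "x \<in> strings q n"
    and energy: "\<And>S. S \<subseteq> strings q n \<Longrightarrow> S \<noteq> {} \<Longrightarrow> \<epsilon> * m * card S \<le> (\<Sum>i<m. energy i S)"
    and T: "(1 + \<epsilon> / (4 * real q ^ k * real q ^ k)) powr (\<epsilon> / (4 * real (Suc (k * d)) * real q ^ k) * T) > q"
  shows "\<exists>y i. reach (T * Suc k ^ T * k) x y \<and> i < m \<and> row_sum i (restr (Q i) y) > \<epsilon> / 4"
proof (rule ccontr)
  let ?\<rho> = "1 + \<epsilon> / (4 * real q ^ k * real q ^ k)" and ?\<gamma> = "\<epsilon> / (4 * real (Suc (k * d)) * real q ^ k)"
  assume "\<not> ?thesis"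
  then have rows: "row_sum i (restr (Q i) y) \<le> \<epsilon> / 4" if "reach (T * Suc k ^ T * k) x y" "i < m" for y i
    using that by (meson not_le)
  have K: "real q ^ k > 0" using q by simp
  \<comment> \<open>The successor in \<open>Suc (k * d)\<close> keeps the denominator positive when
    \<open>k\<close> or \<open>d\<close> is 0.\<close>
  have \<gamma>: "?\<gamma> > 0" using \<epsilon> K by (intro divide_pos_pos mult_pos_pos) (auto simp: add_pos_nonneg)
  \<comment> \<open>Rounding down and adding one serves both sides: \<open>g\<close> is at least
    \<gamma> m, as the growth requires, and \<open>g - 1\<close> is at most \<gamma> m, as required
    for finding disjoint terms.\<close>
  define g where "g = nat \<lfloor>?\<gamma> * m\<rfloor> + 1"
  have g1: "real g - 1 \<le> ?\<gamma> * m" and g2: "?\<gamma> * m \<le> real g"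
  proof -
    have "0 \<le> ?\<gamma> * m" using \<gamma> by (intro mult_nonneg_nonneg) auto
    then have "real g = of_int \<lfloor>?\<gamma> * m\<rfloor> + 1" unfolding g_def by (simp only: of_nat_add of_nat_nat zero_le_floor)
    then show "real g - 1 \<le> ?\<gamma> * m" "?\<gamma> * m \<le> real g" by linarith+
  qed
  have "(real g - 1) * (4 * real (k * d) * real q ^ k) \<le> ?\<gamma> * m * (4 * real (Suc (k * d)) * real q ^ k)"
    using g1 \<gamma> K by (intro mult_mono) (auto simp: g_def)
  also have "\<dots> = \<epsilon> * m"
  proof -
    have "\<epsilon> / X * m * X = \<epsilon> * m" if "X \<noteq> 0" for X :: real using that by simp
    moreover have "4 * real (Suc (k * d)) * real q ^ k \<noteq> 0" using K by (simp del: of_nat_Suc)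
    ultimately show ?thesis by blast
  qed
  finally have g: "(real g - 1) * (4 * real (k * d) * real q ^ k) \<le> \<epsilon> * m" .
  obtain S where S: "S \<subseteq> strings q n" "?\<rho> ^ (g * T) \<le> card S"
    using grow_layers[OF \<epsilon> q m(1) energy x rows g order_refl] by blast
  have "\<epsilon> / (4 * real q ^ k * real q ^ k) > 0" using \<epsilon> K by (intro divide_pos_pos mult_pos_pos) auto
  then have \<rho>: "?\<rho> > 1" by simp
  have "real q ^ m < (?\<rho> powr (?\<gamma> * T)) ^ m"
    using T m(1) by (intro power_strict_mono) auto
  also have "\<dots> = ?\<rho> powr (?\<gamma> * m * T)"
    using \<rho> by (simp add: powr_powr mult.assoc mult.commute mult.left_commute flip: powr_realpow)
  also have "\<dots> \<le> ?\<rho> powr (real g * T)"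
    using \<rho> g2 by (intro powr_mono mult_right_mono) auto
  also have "\<dots> = ?\<rho> ^ (g * T)" using \<rho> by (simp add: powr_realpow flip: of_nat_mult)
  also have "\<dots> \<le> real q ^ n"
    using S(2) card_mono[OF finite_strings S(1)] by (simp add: card_strings flip: of_nat_power)
  also have "\<dots> \<le> real q ^ m" using q m(2) by (intro power_increasing) auto
  finally show False by simp
qed

end

section \<open>Energies and groundspaces\<close>

definition ind :: "nat list set \<Rightarrow> qvec" where
  "ind S = (\<lambda>x. if x \<in> S then 1 else 0)"

lemma ind_vecs: "S \<subseteq> strings q n \<Longrightarrow> ind S \<in> vecs q n"
  by (auto simp: ind_def vecs_def)

lemma expect_alt:
  "expect q n A v = (\<Sum>x\<in>strings q n. cnj (v x) * (\<Sum>y\<in>strings q n. A x y * v y))"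
  by (simp add: expect_def iprod_def mapply_def)

lemma sum_ind: "S \<subseteq> strings q n \<Longrightarrow> (\<Sum>y\<in>strings q n. f y * ind S y) = sum f S"
  by (rule sum.mono_neutral_cong_right) (auto simp: ind_def)

lemma expect_ind: "S \<subseteq> strings q n \<Longrightarrow> expect q n A (ind S) = (\<Sum>x\<in>S. \<Sum>y\<in>S. A x y)"
proof -
  assume S: "S \<subseteq> strings q n"
  show ?thesis
    unfolding expect_alt sum_ind[OF S]
    by (rule sum.mono_neutral_cong_right) (use S in \<open>auto simp: ind_def\<close>)
qed

lemma expect_scale: "expect q n A (\<lambda>x. c * v x) = (cnj c * c) * expect q n A v"
  by (simp add: expect_alt sum_distrib_left algebra_simps)

lemma subset_state_ind: "subset_state S = (\<lambda>x. of_real (1 / sqrt (card S)) * ind S x)"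
  by (auto simp: subset_state_def ind_def)

lemma subset_state_states:
  assumes "S \<subseteq> strings q n" "S \<noteq> {}"
  shows "subset_state S \<in> states q n"
proof -
  have "finite S" using assms(1) finite_subset finite_strings by blast
  then have "card S > 0" using assms(2) by (simp add: card_gt_0_iff)
  then have c: "of_real (1 / sqrt (card S)) * of_real (1 / sqrt (card S)) = (1 / of_nat (card S) :: complex)"
    by (simp flip: of_real_mult)
  have "iprod q n (subset_state S) (subset_state S) = (\<Sum>x\<in>strings q n. (1 / of_nat (card S)) * ind S x)"
    unfolding iprod_def subset_state_ind using c by (auto intro!: sum.cong simp: ind_def simp del: of_real_divide)
  also have "\<dots> = (1 :: complex)" unfolding sum_ind[OF assms(1)] using \<open>card S > 0\<close> by simp
  finally show ?thesis using ind_vecs[OF assms(1)] by (simp add: states_def subset_state_ind vecs_def)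
qed

lemma expect_subset_state:
  assumes "S \<subseteq> strings q n"
  shows "expect q n A (subset_state S) = (\<Sum>x\<in>S. \<Sum>y\<in>S. A x y) / of_nat (card S)"
proof -
  have "cnj (of_real (1 / sqrt (card S))) * of_real (1 / sqrt (card S)) = (1 / of_nat (card S) :: complex)"
    by (simp flip: of_real_mult)
  then show ?thesis
    unfolding subset_state_ind expect_scale expect_ind[OF assms] by simp
qed

text \<open>Indicator vectors are enough as test vectors: singletons bound the diagonal, and for a
  pair the sum of both diagonal entries, each at most 1, and twice the off-diagonal real part is
  non-negative.\<close>

lemma psd_entry_bounds:
  assumes "hermitian q k A" "mat_le q k zero_mat A" "mat_le q k A id_mat"
    and "y \<in> strings q k" "z \<in> strings q k"
  shows "Re (A y y) \<ge> 0" "Re (A y y) \<le> 1" "y \<noteq> z \<Longrightarrow> -1 \<le> Re (A y z)"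
proof -
  have pos: "0 \<le> Re (expect q k A (ind S))" if "S \<subseteq> strings q k" for S
    using assms(2) ind_vecs[OF that] by (simp add: mat_le_def psd_def zero_mat_def)
  have diag: "Re (A y y) \<le> 1" if "y \<in> strings q k" for y
    using assms(3) ind_vecs[of "{y}" q k] expect_ind[of "{y}" q k "\<lambda>x y. id_mat x y - A x y"] that
    by (auto simp: mat_le_def psd_def id_mat_def)
  show "Re (A y y) \<ge> 0" using pos[of "{y}"] assms(4) by (simp add: expect_ind)
  show "Re (A y y) \<le> 1" using diag assms(4) .
  show "-1 \<le> Re (A y z)" if "y \<noteq> z"
  proof -
    have "A z y = cnj (A y z)" using assms(1,4,5) unfolding hermitian_def by blast
    then have "Re (A z y) = Re (A y z)" by simp
    then show ?thesis using pos[of "{y, z}"] assms(4,5) that diag[OF assms(4)] diag[OF assms(5)]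
      by (simp add: expect_ind)
  qed
qed

lemma mapply_vecs: "mapply q n A v \<in> vecs q n"
  by (simp add: mapply_def vecs_def)

lemma iprod_hermitian:
  assumes "hermitian q n A"
  shows "iprod q n u (mapply q n A v) = iprod q n (mapply q n A u) v"
proof -
  have "iprod q n u (mapply q n A v) = (\<Sum>x\<in>strings q n. \<Sum>y\<in>strings q n. cnj (u x) * A x y * v y)"
    by (simp add: iprod_def mapply_def sum_distrib_left mult.assoc)
  also have "\<dots> = (\<Sum>y\<in>strings q n. \<Sum>x\<in>strings q n. cnj (u x) * A x y * v y)"
    by (rule sum.swap)
  also have "\<dots> = (\<Sum>y\<in>strings q n. \<Sum>x\<in>strings q n. cnj (A y x * u x) * v y)"
  proof (intro sum.cong refl)
    fix y x assume "y \<in> strings q n" "x \<in> strings q n"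
    then have "A x y = cnj (A y x)" using assms unfolding hermitian_def by blast
    then show "cnj (u x) * A x y * v y = cnj (A y x * u x) * v y" by simp
  qed
  also have "\<dots> = iprod q n (mapply q n A u) v"
    by (simp add: iprod_def mapply_def sum_distrib_right)
  finally show ?thesis .
qed

lemma iprod_add_right: "iprod q n u (\<lambda>x. v x + c * w x) = iprod q n u v + c * iprod q n u w"
  by (simp add: iprod_def algebra_simps sum.distrib sum_distrib_left)

lemma iprod_add_left: "iprod q n (\<lambda>x. v x + of_real c * w x) u = iprod q n v u + of_real c * iprod q n w u"
  by (simp add: iprod_def algebra_simps sum.distrib sum_distrib_left)

lemma mapply_add: "mapply q n A (\<lambda>x. v x + c * w x) = (\<lambda>x. mapply q n A v x + c * mapply q n A w x)"
  by (auto simp: mapply_def fun_eq_iff algebra_simps sum.distrib sum_distrib_left)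

lemma iprod_self: "iprod q n u u = of_real (\<Sum>x\<in>strings q n. (cmod (u x))\<^sup>2)"
  by (simp add: iprod_def complex_norm_square mult.commute del: of_real_power)

lemma iprod_self_eq_0:
  assumes "u \<in> vecs q n" "Re (iprod q n u u) \<le> 0"
  shows "u = (\<lambda>x. 0)"
proof
  fix x
  have "(\<Sum>x\<in>strings q n. (cmod (u x))\<^sup>2) \<le> 0" using assms(2) by (simp add: iprod_self)
  moreover have "0 \<le> (\<Sum>x\<in>strings q n. (cmod (u x))\<^sup>2)" by (simp add: sum_nonneg)
  ultimately have "(\<Sum>x\<in>strings q n. (cmod (u x))\<^sup>2) = 0" by linarith
  then have "\<forall>x\<in>strings q n. u x = 0" by (simp add: sum_nonneg_eq_0_iff)
  then show "u x = 0" using assms(1) by (cases "x \<in> strings q n") (auto simp: vecs_def)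
qed

text \<open>Positivity is used along the line through \<open>v\<close> in the direction u = A v. The
  linear coefficient of the resulting quadratic is twice the squared norm of u, and a small negative
  step would make the value negative unless this norm is 0.\<close>

lemma psd_kernel:
  assumes A: "psd q n A" and v: "v \<in> vecs q n" and 0: "Re (expect q n A v) \<le> 0"
  shows "mapply q n A v = (\<lambda>x. 0)"
proof -
  define u where "u = mapply q n A v"
  have u: "u \<in> vecs q n" by (simp add: u_def mapply_vecs)
  have herm: "hermitian q n A" using A by (simp add: psd_def)
  define N C where "N = Re (iprod q n u u)" and "C = Re (expect q n A u)"
  have C: "C \<ge> 0" using A u by (simp add: C_def psd_def)
  have N: "N \<ge> 0" by (simp add: N_def iprod_self sum_nonneg)
  have quad: "0 \<le> 2 * s * N + s\<^sup>2 * C" for s :: real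
  proof -
    let ?w = "\<lambda>x. v x + of_real s * u x"
    have "?w \<in> vecs q n" using u v by (simp add: vecs_def)
    then have "0 \<le> Re (expect q n A ?w)" using A by (simp add: psd_def)
    also have "expect q n A ?w = iprod q n v u + of_real s * iprod q n v (mapply q n A u)
        + of_real s * (iprod q n u u + of_real s * iprod q n u (mapply q n A u))"
      unfolding expect_def mapply_add iprod_add_left iprod_add_right u_def ..
    also have "iprod q n v (mapply q n A u) = iprod q n u u"
      using iprod_hermitian[OF herm, of v u] by (simp add: u_def)
    finally have "0 \<le> Re (iprod q n v u) + 2 * s * N + s\<^sup>2 * C"
      by (simp add: N_def C_def expect_def power2_eq_square algebra_simps)
    then show ?thesis using 0 by (simp add: expect_def u_def)
  qed
  have "N = 0"
  proof (rule ccontr)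
    assume "N \<noteq> 0"
    then have N': "N > 0" using N by simp
    \<comment> \<open>Close to the minimiser -N / C of the quadratic; the added 1 covers the case C
      = 0.\<close>
    define s where "s = - N / (C + 1)"
    have eq: "2 * s * N + s\<^sup>2 * C = - (N\<^sup>2 / (C + 1)) * (2 - C / (C + 1))"
      using C by (simp add: s_def power2_eq_square divide_simps) (simp add: algebra_simps)
    have "N\<^sup>2 / (C + 1) > 0" using N' C by simp
    moreover have "2 - C / (C + 1) > 0" using C by (simp add: field_simps)
    ultimately have "0 < N\<^sup>2 / (C + 1) * (2 - C / (C + 1))" by (rule mult_pos_pos)
    then show False using quad[of s] unfolding eq by simp
  qed
  then show ?thesis using iprod_self_eq_0[OF u] by (simp add: N_def u_def)
qed

text \<open>For a frustration-free term the support of a groundstate is a union of sets \<open>T\<close> of the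
  uniform decomposition, and the entries of the term vanish between \<open>T\<close> and its complement since
  the columns outside \<open>T\<close> sum to \<open>0\<close> over \<open>T\<close> and have no positive entries there.\<close>

lemma uniform_kernel:
  assumes A: "psd q k A" and st: "stoquastic_mat q k A" and un: "uniform_mat q k A"
    and v: "v \<in> vecs q k" "Re (expect q k A v) \<le> 0" and y: "y \<in> strings q k" "v y \<noteq> 0"
  shows "(\<Sum>z\<in>strings q k. A y z) = 0" "z \<in> strings q k \<Longrightarrow> A y z \<noteq> 0 \<Longrightarrow> v z = v y"
proof -
  have herm: "hermitian q k A" using A by (simp add: psd_def)
  have eig0: "v \<in> eigenspace q k A 0" using psd_kernel[OF A v] v(1) by (simp add: eigenspace_def)
  \<comment> \<open>As \<open>A\<close> is positive semidefinite and \<open>v\<close> is a nonzero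
    kernel vector, the minimal eigenvalue is 0, and the groundspace of the definition is the
    kernel.\<close>
  have "l \<ge> 0" if l: "is_eigenvalue q k A l" for l
  proof -
    obtain w where w: "w \<in> vecs q k" "mapply q k A w = (\<lambda>x. of_real l * w x)" "w \<noteq> (\<lambda>x. 0)"
      using l by (auto simp: is_eigenvalue_def eigenspace_def)
    have "expect q k A w = of_real l * iprod q k w w"
      by (simp add: expect_def w(2) iprod_def sum_distrib_left algebra_simps)
    then have "0 \<le> l * Re (iprod q k w w)" using A w(1) by (auto simp: psd_def)
    moreover have "0 < Re (iprod q k w w)" using iprod_self_eq_0[OF w(1)] w(3) by (meson not_le)
    ultimately show ?thesis by (simp add: zero_le_mult_iff)
  qed
  moreover have "is_eigenvalue q k A 0" unfolding is_eigenvalue_def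
    by (rule bexI[OF _ eig0]) (use y(2) in auto)
  ultimately have min0: "is_min_eigenvalue q k A 0" by (simp add: is_min_eigenvalue_def)
  have "l = 0" if "is_min_eigenvalue q k A l" for l
    using that min0 by (auto simp: is_min_eigenvalue_def intro: antisym)
  then have ground: "groundspace q k A = eigenspace q k A 0"
    using min0 by (auto simp: groundspace_def)
  obtain \<T> where T: "\<And>T. T \<in> \<T> \<Longrightarrow> T \<noteq> {} \<and> T \<subseteq> strings q k" "disjoint \<T>"
    and P: "is_orth_projector q k (\<lambda>x y. \<Sum>T\<in>\<T>. subset_state T x * cnj (subset_state T y)) (groundspace q k A)"
    using un by (auto simp: uniform_mat_def)
  let ?P = "\<lambda>x y. \<Sum>T\<in>\<T>. subset_state T x * cnj (subset_state T y)"
  have fT: "finite \<T>" by (rule finite_subset[of _ "Pow (strings q k)"]) (use T(1) in auto)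
  have Px: "mapply q k ?P u x = subset_state T x * iprod q k (subset_state T) u"
    if "T \<in> \<T>" "x \<in> T" for T x u
  proof -
    have x: "x \<in> strings q k" using that T(1) by blast
    have zero: "subset_state T' x = 0" if "T' \<in> \<T>" "T' \<noteq> T" for T'
      using \<open>disjoint \<T>\<close> that \<open>T \<in> \<T>\<close> \<open>x \<in> T\<close> by (auto simp: subset_state_def disjoint_def)
    have "mapply q k ?P u x = (\<Sum>y\<in>strings q k. subset_state T x * cnj (subset_state T y) * u y)"
    proof -
      have "?P x y = subset_state T x * cnj (subset_state T y)" for y
        using zero fT that(1) by (subst sum.remove[of _ T]) (auto intro!: sum.neutral)
      then show ?thesis using x by (simp add: mapply_def)
    qed
    then show ?thesis by (simp add: iprod_def sum_distrib_left mult.assoc)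
  qed
  have Pv: "mapply q k ?P v = v" using P eig0 ground by (auto simp: is_orth_projector_def)
  have "\<exists>T\<in>\<T>. y \<in> T"
  proof (rule ccontr)
    assume "\<not> ?thesis"
    then have "?P y z = 0" for z by (intro sum.neutral) (auto simp: subset_state_def)
    then have "mapply q k ?P v y = 0" by (simp add: mapply_def)
    then show False using Pv y(2) by simp
  qed
  then obtain T0 where T0: "T0 \<in> \<T>" "y \<in> T0" by blast
  have T0s: "T0 \<subseteq> strings q k" "T0 \<noteq> {}" using T(1) T0 by auto
  have const: "v z = v y" if "z \<in> T0" for z
    using Px[OF T0(1) that, of v] Px[OF T0, of v] Pv that T0(2) by (simp add: subset_state_def)
  define t where "t = subset_state T0"
  have tv: "t \<in> vecs q k" using T0s by (auto simp: t_def subset_state_def vecs_def)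
  have "finite T0" using T0s(1) finite_subset finite_strings by blast
  then have cT0: "card T0 > 0" using T0s(2) by (simp add: card_gt_0_iff)
  \<comment> \<open>The projector is specified only on the groundspace and on its orthogonal
    complement, so it has to be derived that \<open>t\<close> is a ground vector: \<open>A t\<close>
    is orthogonal to the kernel, hence sent to 0 by the projector, which forces the inner product of
    \<open>t\<close> and \<open>A t\<close> to vanish; then \<open>psd_kernel\<close>
    applies.\<close>
  have "iprod q k w (mapply q k A t) = 0" if "w \<in> groundspace q k A" for w
    using that iprod_hermitian[OF herm, of w t] by (simp add: ground eigenspace_def iprod_def)
  then have "mapply q k ?P (mapply q k A t) = (\<lambda>x. 0)"
    using P mapply_vecs by (auto simp: is_orth_projector_def)
  then have "subset_state T0 y * iprod q k t (mapply q k A t) = 0"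
    using Px[OF T0, of "mapply q k A t"] by (simp add: t_def)
  moreover have "subset_state T0 y \<noteq> 0" using T0(2) cT0 by (simp add: subset_state_def)
  ultimately have "expect q k A t = 0" by (simp add: expect_def)
  then have At: "mapply q k A t = (\<lambda>x. 0)" using psd_kernel[OF A tv] by simp
  have cols: "(\<Sum>z\<in>T0. A x z) = 0" if x: "x \<in> strings q k" for x
  proof -
    have "0 = (\<Sum>z\<in>strings q k. (of_real (1 / sqrt (card T0)) * A x z) * ind T0 z)"
      using fun_cong[OF At, of x] x by (simp add: mapply_def t_def subset_state_ind algebra_simps)
    also have "\<dots> = of_real (1 / sqrt (card T0)) * (\<Sum>z\<in>T0. A x z)"
      unfolding sum_ind[OF T0s(1)] by (simp add: sum_distrib_left)
    finally show ?thesis using cT0 by simp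
  qed
  have out: "A y x = 0" if x: "x \<in> strings q k" "x \<notin> T0" for x
  proof -
    have le: "A x z \<in> \<real> \<and> Re (A x z) \<le> 0" if "z \<in> T0" for z
      using st[unfolded stoquastic_mat_def, rule_format, of x z] x that T0s by auto
    have "(\<Sum>z\<in>T0. - Re (A x z)) = 0" using arg_cong[OF cols[OF x(1)], of Re] by (simp add: sum_negf)
    then have "\<forall>z\<in>T0. - Re (A x z) = 0"
      using le \<open>finite T0\<close> by (subst (asm) sum_nonneg_eq_0_iff) auto
    then have "A x y = 0" using le T0(2) by (auto simp: complex_eq_iff complex_is_Real_iff)
    then show ?thesis using herm x(1) y(1) by (metis complex_cnj_zero hermitian_def)
  qed
  have "(\<Sum>z\<in>strings q k. A y z) = (\<Sum>z\<in>T0. A y z)"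
    using out T0s(1) by (intro sum.mono_neutral_right) auto
  then show "(\<Sum>z\<in>strings q k. A y z) = 0" using cols[OF y(1)] by simp
  show "z \<in> strings q k \<Longrightarrow> A y z \<noteq> 0 \<Longrightarrow> v z = v y" using out const by blast
qed

section \<open>Restricting a state to the qudits of a term\<close>

context site
begin

lemma lift_sum:
  assumes x: "x \<in> strings q n"
  shows "(\<Sum>y\<in>strings q n. lift_mat n Q A x y * F y) = (\<Sum>w\<in>strings q k. A (restr Q x) w * F (upd Q x w))"
proof -
  have lx: "length x = n" using x by (rule strings_length)
  have inj: "inj_on (upd Q x) (strings q k)"
    using upd_inj[OF lx] by (auto simp: inj_on_def dest: strings_length)
  have lift: "lift_mat n Q A x (upd Q x w) = A (restr Q x) w" if "w \<in> strings q k" for w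
  proof -
    have "\<forall>j<n. j \<notin> set Q \<longrightarrow> x ! j = upd Q x w ! j" using lx by (simp add: upd_out)
    moreover have "map ((!) (upd Q x w)) Q = w"
      using restr_upd[OF lx strings_length[OF that]] by (simp add: restr_def)
    ultimately show ?thesis by (simp add: lift_mat_def restr_def)
  qed
  have "lift_mat n Q A x y = 0" if y: "y \<in> strings q n" "y \<notin> upd Q x ` strings q k" for y
  proof (rule ccontr)
    assume "\<not> ?thesis"
    then have "\<forall>j<n. j \<notin> set Q \<longrightarrow> x ! j = y ! j" by (auto simp: lift_mat_def split: if_splits)
    then have "y = upd Q x (restr Q y)" using upd_of_agree[OF lx strings_length[OF y(1)]] by blast
    then show False using y restr_strings[OF y(1)] by blast
  qed
  then have "(\<Sum>y\<in>strings q n. lift_mat n Q A x y * F y) = (\<Sum>y\<in>upd Q x ` strings q k. lift_mat n Q A x y * F y)"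
    using upd_strings[OF x] by (intro sum.mono_neutral_right) auto
  also have "\<dots> = (\<Sum>w\<in>strings q k. A (restr Q x) w * F (upd Q x w))"
    using inj lift by (subst sum.reindex) auto
  finally show ?thesis .
qed

text \<open>The map from (x, u) to the overwritten string and the overwritten letters is an
  involution. Averaging over it takes the place of splitting a string into its letters on
  \<open>Q\<close> and the others.\<close>

lemma sum_average:
  fixes f :: "nat list \<Rightarrow> complex"
  shows "of_nat (q ^ k) * (\<Sum>x\<in>strings q n. f x) = (\<Sum>x\<in>strings q n. \<Sum>u\<in>strings q k. f (upd Q x u))"
proof -
  have "(\<Sum>x\<in>strings q n. \<Sum>u\<in>strings q k. f (upd Q x u))
      = (\<Sum>(x, u)\<in>strings q n \<times> strings q k. f (upd Q x u))"
    by (simp add: sum.cartesian_product)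
  also have "\<dots> = (\<Sum>(x, u)\<in>strings q n \<times> strings q k. f x)"
    by (rule sum.reindex_bij_witness[of _ "\<lambda>(x, u). (upd Q x u, restr Q x)" "\<lambda>(x, u). (upd Q x u, restr Q x)"])
      (auto simp: strings_length upd_strings restr_strings)
  also have "\<dots> = of_nat (q ^ k) * (\<Sum>x\<in>strings q n. f x)"
    by (simp add: card_strings sum_distrib_left flip: sum.cartesian_product)
  finally show ?thesis by simp
qed

text \<open>The amplitudes of \<psi> on the strings that agree with \<open>x\<close> off
  \<open>Q\<close>, read as an unnormalised state of the qudits in \<open>Q\<close>.\<close>

definition slice :: "nat \<Rightarrow> qvec \<Rightarrow> nat list \<Rightarrow> qvec" where
  "slice q \<psi> x = (\<lambda>w. if w \<in> strings q k then \<psi> (upd Q x w) else 0)"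

lemma expect_lift:
  "of_nat (q ^ k) * expect q n (lift_mat n Q A) \<psi> = (\<Sum>x\<in>strings q n. expect q k A (slice q \<psi> x))"
proof -
  have "expect q n (lift_mat n Q A) \<psi>
      = (\<Sum>x\<in>strings q n. cnj (\<psi> x) * (\<Sum>w\<in>strings q k. A (restr Q x) w * \<psi> (upd Q x w)))"
    unfolding expect_alt by (intro sum.cong refl) (simp add: lift_sum)
  then have "of_nat (q ^ k) * expect q n (lift_mat n Q A) \<psi> = (\<Sum>x\<in>strings q n. \<Sum>u\<in>strings q k.
      cnj (\<psi> (upd Q x u)) * (\<Sum>w\<in>strings q k. A (restr Q (upd Q x u)) w * \<psi> (upd Q (upd Q x u) w)))"
    by (simp only: sum_average)
  also have "\<dots> = (\<Sum>x\<in>strings q n. expect q k A (slice q \<psi> x))"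
    unfolding expect_alt by (intro sum.cong refl) (simp add: slice_def strings_length)
  finally show ?thesis .
qed

text \<open>The energies of all slices are non-negative and by \<open>expect_lift\<close> they add
  up to 0.\<close>

lemma slice_expect_zero:
  assumes A: "psd q k A" and 0: "expect q n (lift_mat n Q A) \<psi> = 0" and x: "x \<in> strings q n"
  shows "Re (expect q k A (slice q \<psi> x)) = 0"
proof -
  have nonneg: "0 \<le> Re (expect q k A (slice q \<psi> x))" for x
    using A by (simp add: psd_def vecs_def slice_def)
  have "(\<Sum>x\<in>strings q n. Re (expect q k A (slice q \<psi> x))) = 0"
    using arg_cong[OF expect_lift[of q A \<psi>], of Re] 0 by simp
  then show ?thesis using nonneg x by (simp add: sum_nonneg_eq_0_iff)
qed

end

definition term_supp :: "nat \<Rightarrow> nat \<Rightarrow> local_term \<Rightarrow> nat set" where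
  "term_supp q k t = {v. acts_nontrivially_on q k t v}"

lemma trivial_entry:
  assumes "acts_trivially_at q k A p" "y \<in> strings q k" "z \<in> strings q k" "A y z \<noteq> 0"
  shows "y ! p = z ! p"
  using assms unfolding acts_trivially_at_def by metis

lemma remove_pos_cong:
  assumes "length x = length y" "\<And>j. j < length x \<Longrightarrow> j \<noteq> p \<Longrightarrow> x ! j = y ! j"
  shows "remove_pos p x = remove_pos p y"
proof -
  have "take p x = take p y" by (rule nth_equalityI) (use assms in auto)
  moreover have "drop (Suc p) x = drop (Suc p) y" by (rule nth_equalityI) (use assms in auto)
  ultimately show ?thesis by (simp add: remove_pos_def)
qed

text \<open>A hybrid argument that substitutes the primed strings coordinate by coordinate. In
  \<open>R\<close> a substitution changes nothing; outside it both strings carry equal letters,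
  replaced simultaneously by equal letters, which a trivially acting factor does not notice.\<close>

lemma trivial_entry_cong:
  assumes yz: "y \<in> strings q k" "z \<in> strings q k" "y' \<in> strings q k" "z' \<in> strings q k"
    and triv: "\<And>p. p < k \<Longrightarrow> p \<notin> R \<Longrightarrow> acts_trivially_at q k A p \<and> y ! p = z ! p \<and> y' ! p = z' ! p"
    and same: "\<And>p. p < k \<Longrightarrow> p \<in> R \<Longrightarrow> y ! p = y' ! p \<and> z ! p = z' ! p"
  shows "A y z = A y' z'"
proof -
  define mix where "mix j a b = map (\<lambda>p. if p < j then b ! p else a ! p) [0..<k]" for j and a b :: "nat list"
  have mix: "mix j a b \<in> strings q k" if "a \<in> strings q k" "b \<in> strings q k" for j a b
    using that by (auto simp: mix_def strings_nth)
  have "A (mix j y y') (mix j z z') = A y z" if "j \<le> k" for j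
    using that
  proof (induction j)
    case 0
    have "mix 0 a b = a" if "a \<in> strings q k" for a b
      using that by (intro nth_equalityI) (auto simp: mix_def strings_nth)
    then show ?case using yz by simp
  next
    case (Suc j)
    then have j: "j < k" by simp
    have "A (mix (Suc j) y y') (mix (Suc j) z z') = A (mix j y y') (mix j z z')"
    proof (cases "j \<in> R")
      case True
      have "mix (Suc j) y y' = mix j y y'" "mix (Suc j) z z' = mix j z z'"
        using same[OF j True] by (auto simp: mix_def less_Suc_eq)
      then show ?thesis by simp
    next
      case False
      obtain B where B: "\<And>x y. x \<in> strings q k \<Longrightarrow> y \<in> strings q k \<Longrightarrow>
          A x y = (if x ! j = y ! j then B (remove_pos j x) (remove_pos j y) else 0)"
        using triv[OF j False] unfolding acts_trivially_at_def by blast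
      have "remove_pos j (mix (Suc j) a b) = remove_pos j (mix j a b)" for a b
        by (rule remove_pos_cong) (auto simp: mix_def)
      moreover have "mix (Suc j) y y' ! j = mix (Suc j) z z' ! j" "mix j y y' ! j = mix j z z' ! j"
        using triv[OF j False] j by (simp_all add: mix_def)
      ultimately show ?thesis using B mix yz by simp
    qed
    then show ?case using Suc by simp
  qed
  moreover have "mix k a b = b" if "b \<in> strings q k" for a b
    using that by (intro nth_equalityI) (auto simp: mix_def strings_nth)
  ultimately show ?thesis using yz by (metis order_refl)
qed

section \<open>Instances as walks\<close>

locale instance_facts =
  fixes q k d :: nat and a b :: "nat poly" and H :: hamiltonian
  assumes inst: "H \<in> instances q k d a b" and q: "q \<ge> 1"
begin

abbreviation "n \<equiv> num_qudits H"
abbreviation "m \<equiv> length (local_terms H)"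
abbreviation "tm i \<equiv> local_terms H ! i"

definition h :: "nat \<Rightarrow> nat list \<Rightarrow> nat list \<Rightarrow> real" where
  "h i y z = Re (term_mat (tm i) y z)"

lemma n_le_m: "n \<le> m"
  using inst by (simp add: instances_def)

lemma term_facts:
  assumes "i < m"
  shows "local_term_ok q k n (tm i)" "stoquastic_mat q k (term_mat (tm i))" "uniform_mat q k (term_mat (tm i))"
  using inst nth_mem[OF assms] by (auto simp: instances_def stoquastic_def uniform_def)

lemma psd_term: "i < m \<Longrightarrow> psd q k (term_mat (tm i))"
  using term_facts(1)[of i] by (simp add: local_term_ok_def mat_le_def zero_mat_def)

sublocale walk q n k d m "\<lambda>i. qudits (tm i)" h "\<lambda>i. term_supp q k (tm i)"
proof (rule walk.intro)
  fix i assume i: "i < m"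
  have ok: "local_term_ok q k n (tm i)" by (rule term_facts(1)[OF i])
  show "site n k (qudits (tm i))"
    using ok by (simp add: site_def local_term_ok_def)
  show "term_supp q k (tm i) \<subseteq> set (qudits (tm i))"
    using ok by (auto simp: term_supp_def acts_nontrivially_on_def local_term_ok_def)
  have triv: "acts_trivially_at q k (term_mat (tm i)) p" if "p < k" "qudits (tm i) ! p \<notin> term_supp q k (tm i)" for p
    using that by (auto simp: term_supp_def acts_nontrivially_on_def)
  fix y z assume yz: "y \<in> strings q k" "z \<in> strings q k"
  show "-1 \<le> h i y z \<and> h i y z \<le> 0" if "y \<noteq> z"
    using psd_entry_bounds(3)[of q k "term_mat (tm i)" y z] ok term_facts(2)[OF i] yz that
    by (auto simp: h_def local_term_ok_def stoquastic_mat_def)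
  show "y ! p = z ! p" if "h i y z \<noteq> 0" "p < k" "qudits (tm i) ! p \<notin> term_supp q k (tm i)" for p
  proof -
    have "term_mat (tm i) y z \<noteq> 0" using that(1) by (auto simp: h_def)
    then show ?thesis using trivial_entry[OF triv[OF that(2,3)] yz] by blast
  qed
  fix y' z' assume yz': "y' \<in> strings q k" "z' \<in> strings q k"
    and on: "\<forall>p<k. qudits (tm i) ! p \<in> term_supp q k (tm i) \<longrightarrow> y ! p = y' ! p \<and> z ! p = z' ! p"
    and off: "\<forall>p<k. qudits (tm i) ! p \<notin> term_supp q k (tm i) \<longrightarrow> y ! p = z ! p \<and> y' ! p = z' ! p"
  show "h i y z = h i y' z'"
    unfolding h_def
    by (rule arg_cong[of _ _ Re],
        rule trivial_entry_cong[OF yz yz', where R = "{p. qudits (tm i) ! p \<in> term_supp q k (tm i)}"])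
      (use triv on off in auto)
next
  fix v assume "v < n"
  then show "card {i. i < m \<and> v \<in> term_supp q k (tm i)} \<le> d"
    using inst by (auto simp: instances_def bounded_degree_def term_supp_def)
qed

text \<open>Frustration is tested on the subset state of \<open>S\<close>; summation over the other
  qudits collapses by \<open>lift_sum\<close>.\<close>

lemma frustrated_energy:
  assumes fr: "frustrated q \<epsilon> H" and S: "S \<subseteq> strings q n" "S \<noteq> {}"
  shows "\<epsilon> * m * card S \<le> (\<Sum>i<m. energy i S)"
proof -
  have "finite S" using S(1) finite_subset finite_strings by blast
  then have cS: "card S > 0" using S(2) by (simp add: card_gt_0_iff)
  have "\<epsilon> \<le> Re (expect q n (ham_mat H) (subset_state S))"
    using fr subset_state_states[OF S] by (simp add: frustrated_def)
  also have "expect q n (ham_mat H) (subset_state S)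
      = (\<Sum>x\<in>S. \<Sum>y\<in>S. \<Sum>i<m. lifted_term H (tm i) x y) / of_nat m / of_nat (card S)"
    unfolding expect_subset_state[OF S(1)] ham_mat_def
    by (simp add: sum_divide_distrib sum_list_sum_nth lessThan_atLeast0)
  also have "(\<Sum>x\<in>S. \<Sum>y\<in>S. \<Sum>i<m. lifted_term H (tm i) x y)
      = (\<Sum>i<m. \<Sum>x\<in>S. \<Sum>y\<in>S. lifted_term H (tm i) x y)"
    by (simp add: sum.swap[of _ "{..<m}"])
  also have "Re (\<dots> / of_nat m / of_nat (card S)) = (\<Sum>i<m. energy i S) / m / card S"
  proof -
    have "Re (\<Sum>x\<in>S. \<Sum>y\<in>S. lifted_term H (tm i) x y) = energy i S" if i: "i < m" for i
    proof -
      interpret site n k "qudits (tm i)" by (rule site[OF i])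
      have "(\<Sum>y\<in>S. lifted_term H (tm i) x y) = (\<Sum>w | w \<in> strings q k \<and> upd (qudits (tm i)) x w \<in> S.
          term_mat (tm i) (restr (qudits (tm i)) x) w)" if x: "x \<in> S" for x
      proof -
        have "(\<Sum>y\<in>S. lifted_term H (tm i) x y) = (\<Sum>y\<in>strings q n. lifted_term H (tm i) x y * ind S y)"
          using sum_ind[OF S(1)] by simp
        also have "\<dots> = (\<Sum>w\<in>strings q k. term_mat (tm i) (restr (qudits (tm i)) x) w * ind S (upd (qudits (tm i)) x w))"
          unfolding lifted_term_def by (rule lift_sum) (use x S in auto)
        also have "\<dots> = (\<Sum>w | w \<in> strings q k \<and> upd (qudits (tm i)) x w \<in> S.
          term_mat (tm i) (restr (qudits (tm i)) x) w)"
          by (rule sum.mono_neutral_cong_right) (auto simp: ind_def)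
        finally show ?thesis .
      qed
      then show ?thesis by (simp add: energy_def h_def)
    qed
    then show ?thesis by (simp add: Re_divide_of_nat)
  qed
  finally have *: "\<epsilon> \<le> (\<Sum>i<m. energy i S) / m / card S" .
  show ?thesis
  proof (cases "m = 0")
    case False
    then show ?thesis using * cS by (simp add: field_simps)
  qed simp
qed

text \<open>Without terms \<open>ham_mat\<close> is a quotient by 0 and thus the zero matrix, whose
  energy is below every positive \<epsilon>.\<close>

lemma frustrated_nonempty:
  assumes "frustrated q \<epsilon> H" "\<epsilon> > 0"
  shows "m > 0"
proof (rule ccontr)
  assume "\<not> ?thesis"
  then have "ham_mat H = (\<lambda>x y. 0)" by (simp add: ham_mat_def)
  moreover have "replicate n 0 \<in> strings q n" using q by (auto simp: strings_def)
  then have "subset_state {replicate n 0} \<in> states q n" by (intro subset_state_states) auto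
  ultimately show False using assms by (force simp: frustrated_def expect_alt)
qed

text \<open>Around a string \<open>x\<close> in the support of the groundstate, the slice at
  \<open>x\<close> is a kernel vector of each term and nonzero at the restriction of
  \<open>x\<close>. So \<open>uniform_kernel\<close> yields both the vanishing row sum and equal
  amplitudes along moves.\<close>

lemma frustration_free_good:
  assumes "frustration_free q H"
  shows "\<exists>x\<in>strings q n. \<forall>c y i. reach c x y \<longrightarrow> i < m \<longrightarrow> row_sum i (restr (qudits (tm i)) y) = 0"
proof -
  obtain \<psi> where \<psi>: "\<psi> \<in> states q n" "\<And>i. i < m \<Longrightarrow> expect q n (lifted_term H (tm i)) \<psi> = 0"
    using assms by (auto simp: frustration_free_def)
  have good: "row_sum i (restr (qudits (tm i)) x) = 0 \<and> (\<forall>y. move i x y \<longrightarrow> \<psi> y \<noteq> 0)"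
    if i: "i < m" and x: "x \<in> strings q n" "\<psi> x \<noteq> 0" for i x
  proof -
    interpret site n k "qudits (tm i)" by (rule site[OF i])
    let ?r = "restr (qudits (tm i)) x"
    have lx: "length x = n" using x(1) by (rule strings_length)
    have r: "?r \<in> strings q k" using x by (simp add: restr_strings)
    have sr: "slice q \<psi> x ?r = \<psi> x" using r lx by (simp add: slice_def)
    have "Re (expect q k (term_mat (tm i)) (slice q \<psi> x)) = 0"
      using slice_expect_zero[OF psd_term[OF i] _ x(1)] \<psi>(2)[OF i] by (simp add: lifted_term_def)
    moreover have "slice q \<psi> x \<in> vecs q k" by (simp add: slice_def vecs_def)
    ultimately have *: "(\<Sum>z\<in>strings q k. term_mat (tm i) ?r z) = 0"
      "\<And>z. z \<in> strings q k \<Longrightarrow> term_mat (tm i) ?r z \<noteq> 0 \<Longrightarrow> slice q \<psi> x z = \<psi> x"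
      using uniform_kernel[OF psd_term[OF i] term_facts(2,3)[OF i], of "slice q \<psi> x" ?r] r x(2) sr by auto
    have "row_sum i ?r = 0" using arg_cong[OF *(1), of Re] by (simp add: row_sum_def h_def)
    moreover have "\<psi> y \<noteq> 0" if mv: "move i x y" for y
    proof -
      obtain z where z: "edge i ?r z" "y = upd (qudits (tm i)) x z" using mv by (auto simp: move_def)
      then have "term_mat (tm i) ?r z \<noteq> 0" by (auto simp: edge_def h_def)
      then show ?thesis using *(2)[of z] z x(2) by (simp add: edge_def slice_def)
    qed
    ultimately show ?thesis by blast
  qed
  have "\<exists>x\<in>strings q n. \<psi> x \<noteq> 0"
  proof (rule ccontr)
    assume "\<not> ?thesis"
    then have "iprod q n \<psi> \<psi> = 0" by (simp add: iprod_def)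
    then show False using \<psi>(1) by (simp add: states_def)
  qed
  then obtain x where x: "x \<in> strings q n" "\<psi> x \<noteq> 0" by blast
  have "\<psi> y \<noteq> 0" if "reach c x y" for c y
    using that x
  proof (induction rule: reach.induct)
    case (reach_step c x y i y')
    then show ?case using good[of i y] reach_strings by blast
  qed simp
  then show ?thesis using good x reach_strings by blast
qed

end

section \<open>The verifier\<close>

definition same_query :: "nat \<Rightarrow> nat \<Rightarrow> nat \<Rightarrow> nat \<Rightarrow> query" where
  "same_query t p s p' = Query t p s p' Same"

text \<open>The mark of row \<open>y\<close> sits on the real numerator of its diagonal entry, one
  fixed place for each row.\<close>

definition mark_query :: "nat \<Rightarrow> nat \<Rightarrow> nat \<Rightarrow> nat list \<Rightarrow> query" where
  "mark_query q k t y = Query t (entry_pos q k y y) t (entry_pos q k y y) Marked"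

definition edge_query :: "nat \<Rightarrow> nat \<Rightarrow> nat \<Rightarrow> nat list \<Rightarrow> nat list \<Rightarrow> query" where
  "edge_query q k t y z = Query t (entry_pos q k y z) t (entry_pos q k y z) Negative"

text \<open>For an entry with real part a / c this asks whether D a \<le> j c, that is, whether the
  real part is at most j / D; hence the fields at offsets 0 and 2.\<close>

definition below_query :: "nat \<Rightarrow> nat \<Rightarrow> nat \<Rightarrow> nat \<Rightarrow> nat list \<Rightarrow> nat list \<Rightarrow> int \<Rightarrow> query" where
  "below_query q k D t y z j = Query t (entry_pos q k y z) t (entry_pos q k y z + 2) (Below (int D) j)"

definition query_set :: "nat \<Rightarrow> nat \<Rightarrow> nat \<Rightarrow> nat \<Rightarrow> query set" where
  "query_set q k D L =
     (\<lambda>(t, p, s, p'). same_query t p s p') ` ({..L} \<times> {..<k} \<times> {..L} \<times> {..<k}) \<union>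
     (\<lambda>(t, y). mark_query q k t y) ` ({..L} \<times> strings q k) \<union>
     (\<lambda>(t, y, z). edge_query q k t y z) ` ({..L} \<times> strings q k \<times> strings q k) \<union>
     (\<lambda>(t, y, z, j). below_query q k D t y z j) ` ({..L} \<times> strings q k \<times> strings q k \<times> {- int D..int D})"

lemma finite_query_set: "finite (query_set q k D L)"
  by (simp add: query_set_def)

text \<open>\<open>f z / D\<close> is an upper bound on the entry, so a good row has sum at most \<open>q ^ k / D\<close>; rounding
  up the entries of a row with sum 0 gives a witness.\<close>

definition good_row :: "nat \<Rightarrow> nat \<Rightarrow> nat \<Rightarrow> query set \<Rightarrow> nat \<Rightarrow> nat list \<Rightarrow> bool" where
  "good_row q k D R t y \<longleftrightarrow> (\<exists>f. (\<forall>z\<in>strings q k. f z \<in> {- int D..int D} \<and> below_query q k D t y z (f z) \<in> R) \<and>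
     (\<Sum>z\<in>strings q k. f z) \<le> int (q ^ k))"

text \<open>After a move of the \<open>l\<close>-th term the new letters must appear in all
  restrictions containing the same qudits. Which positions coincide is known only from the equality
  answers.\<close>

definition move_local :: "nat \<Rightarrow> query set \<Rightarrow> nat \<Rightarrow> nat list \<Rightarrow> (nat \<Rightarrow> nat list) \<Rightarrow> nat \<Rightarrow> nat list" where
  "move_local k R l z Y t = map (\<lambda>p. if \<exists>p'<k. same_query t p l p' \<in> R
     then z ! (SOME p'. p' < k \<and> same_query t p l p' \<in> R) else Y t ! p) [0..<k]"

text \<open>\<open>Y t\<close> is the restriction of the current string to the qudits of the \<open>t\<close>-th term of the tuple. The
  terms \<open>l - 1, ..., 0\<close> are still available for a move; the last term \<open>L\<close> is then tested.\<close>

fun simulate :: "nat \<Rightarrow> nat \<Rightarrow> nat \<Rightarrow> nat \<Rightarrow> query set \<Rightarrow> nat \<Rightarrow> (nat \<Rightarrow> nat list) \<Rightarrow> bool" where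
  "simulate q k D L R 0 Y \<longleftrightarrow> good_row q k D R L (Y L)"
| "simulate q k D L R (Suc l) Y \<longleftrightarrow> simulate q k D L R l Y \<and>
     (\<forall>z\<in>strings q k. Y l \<noteq> z \<and> edge_query q k l (Y l) z \<in> R \<longrightarrow> simulate q k D L R l (move_local k R l z Y))"

text \<open>The restrictions \<open>Y\<close> are not extra data: exactly one marked row in each
  term determines them. Consistency is demanded for all pairs of positions that hold the same
  qudit.\<close>

definition check :: "nat \<Rightarrow> nat \<Rightarrow> nat \<Rightarrow> nat \<Rightarrow> query set \<Rightarrow> bool" where
  "check q k D L R \<longleftrightarrow> (\<exists>Y.
     (\<forall>t\<le>L. Y t \<in> strings q k \<and> (\<forall>y\<in>strings q k. mark_query q k t y \<in> R \<longleftrightarrow> y = Y t)) \<and>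
     (\<forall>t\<le>L. \<forall>s\<le>L. \<forall>p<k. \<forall>p'<k. same_query t p s p' \<in> R \<longrightarrow> Y t ! p = Y s ! p') \<and>
     simulate q k D L R L Y)"

abbreviation positives :: "nat \<Rightarrow> nat \<Rightarrow> nat \<Rightarrow> nat \<Rightarrow> (bool list \<times> bool) list list \<Rightarrow> (nat \<Rightarrow> nat) \<Rightarrow> query set" where
  "positives q k D L Cs I \<equiv> {x \<in> query_set q k D L.
     meaning (kind x) (Cs ! I (level1 x) ! field1 x) (Cs ! I (level2 x) ! field2 x)}"

lemma query_setI:
  "t \<le> L \<Longrightarrow> s \<le> L \<Longrightarrow> p < k \<Longrightarrow> p' < k \<Longrightarrow> same_query t p s p' \<in> query_set q k D L"
  "t \<le> L \<Longrightarrow> y \<in> strings q k \<Longrightarrow> mark_query q k t y \<in> query_set q k D L"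
  "t \<le> L \<Longrightarrow> y \<in> strings q k \<Longrightarrow> z \<in> strings q k \<Longrightarrow> edge_query q k t y z \<in> query_set q k D L"
  "t \<le> L \<Longrightarrow> y \<in> strings q k \<Longrightarrow> z \<in> strings q k \<Longrightarrow> j \<in> {- int D..int D} \<Longrightarrow>
     below_query q k D t y z j \<in> query_set q k D L"
  unfolding query_set_def
proof goal_cases
  case 1
  show ?case by (rule UnI1[OF UnI1[OF UnI1]], intro image_eqI[where x = "(t, p, s, p')"]) (use 1 in simp_all)
next
  case 2
  show ?case by (rule UnI1[OF UnI1[OF UnI2]], intro image_eqI[where x = "(t, y)"]) (use 2 in simp_all)
next
  case 3
  show ?case by (rule UnI1[OF UnI2], intro image_eqI[where x = "(t, y, z)"]) (use 3 in simp_all)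
next
  case 4
  show ?case by (rule UnI2, intro image_eqI[where x = "(t, y, z, j)"]) (use 4 in simp_all)
qed

lemma query_set_cases:
  assumes "x \<in> query_set q k D L"
  obtains t p s p' where "t \<le> L" "p < k" "s \<le> L" "p' < k" "x = same_query t p s p'"
  | t y where "t \<le> L" "y \<in> strings q k" "x = mark_query q k t y"
  | t y z where "t \<le> L" "y \<in> strings q k" "z \<in> strings q k" "x = edge_query q k t y z"
  | t y z j where "t \<le> L" "y \<in> strings q k" "z \<in> strings q k" "j \<in> {- int D..int D}" "x = below_query q k D t y z j"
  using assms unfolding query_set_def
proof (elim UnE imageE, goal_cases)
  case (1 u)
  then show ?case by (cases u) auto
next
  case (2 u)
  then show ?case by (cases u) auto
next
  case (3 u)
  then show ?case by (cases u) auto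
next
  case (4 u)
  then show ?case by (cases u) auto
qed

section \<open>Soundness and completeness of the check\<close>

context instance_facts
begin

abbreviation "Qs i \<equiv> qudits (tm i)"

definition good :: "nat \<Rightarrow> nat \<Rightarrow> nat list \<Rightarrow> bool" where
  "good D i y \<longleftrightarrow> (\<exists>f. (\<forall>z\<in>strings q k. f z \<in> {- int D..int D} \<and> D * h i y z \<le> f z) \<and>
     (\<Sum>z\<in>strings q k. f z) \<le> int (q ^ k))"

lemma good_row_sum:
  assumes "good D i y" "D > 0"
  shows "row_sum i y \<le> q ^ k / D"
proof -
  obtain f where f: "\<And>z. z \<in> strings q k \<Longrightarrow> D * h i y z \<le> real_of_int (f z)" "(\<Sum>z\<in>strings q k. f z) \<le> int (q ^ k)"
    using assms(1) unfolding good_def by blast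
  have "D * row_sum i y = (\<Sum>z\<in>strings q k. D * h i y z)" by (simp add: row_sum_def sum_distrib_left)
  also have "\<dots> \<le> (\<Sum>z\<in>strings q k. real_of_int (f z))" using f(1) by (rule sum_mono)
  also have "\<dots> = real_of_int (\<Sum>z\<in>strings q k. f z)" by simp
  also have "\<dots> \<le> real_of_int (int (q ^ k))" using f(2) by (simp only: of_int_le_iff)
  finally show ?thesis using assms(2) by (simp add: field_simps)
qed

lemma h_abs:
  assumes "i < m" "y \<in> strings q k" "z \<in> strings q k"
  shows "-1 \<le> h i y z" "h i y z \<le> 1"
proof -
  have "-1 \<le> h i y z \<and> h i y z \<le> 1"
  proof (cases "y = z")
    case True
    then show ?thesis
      using psd_entry_bounds(1,2)[of q k "term_mat (tm i)" y y] term_facts(1)[OF assms(1)] assms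
      by (auto simp: h_def local_term_ok_def)
  next
    case False
    then show ?thesis using h_bounds[OF assms False] by simp
  qed
  then show "-1 \<le> h i y z" "h i y z \<le> 1" by auto
qed

lemma good_if_row_sum:
  assumes "i < m" "y \<in> strings q k" "row_sum i y = 0"
  shows "good D i y"
  unfolding good_def
proof (intro exI[of _ "\<lambda>z. \<lceil>D * h i y z\<rceil>"] conjI ballI)
  fix z assume z: "z \<in> strings q k"
  have "real D * -1 \<le> D * h i y z" "D * h i y z \<le> real D * 1"
    using h_abs[OF assms(1,2) z] by (intro mult_left_mono; simp)+
  then show "\<lceil>D * h i y z\<rceil> \<in> {- int D..int D}" by (auto simp: le_ceiling_iff ceiling_le_iff)
  show "D * h i y z \<le> \<lceil>D * h i y z\<rceil>" by simp
next
  have "real_of_int (\<Sum>z\<in>strings q k. \<lceil>D * h i y z\<rceil>) \<le> (\<Sum>z\<in>strings q k. D * h i y z + 1)"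
    unfolding of_int_sum by (rule sum_mono) linarith
  also have "\<dots> = D * row_sum i y + q ^ k"
    by (simp add: sum.distrib card_strings row_sum_def sum_distrib_left)
  also have "\<dots> = real_of_int (int (q ^ k))" using assms(3) by simp
  finally show "(\<Sum>z\<in>strings q k. \<lceil>D * h i y z\<rceil>) \<le> int (q ^ k)" by (simp only: of_int_le_iff)
qed

text \<open>The counterpart of \<open>simulate\<close> on whole strings. Each move is optional, so
  shorter paths are covered as well.\<close>

fun safe :: "nat \<Rightarrow> nat \<Rightarrow> (nat \<Rightarrow> nat) \<Rightarrow> nat \<Rightarrow> nat list \<Rightarrow> bool" where
  "safe D L I 0 x \<longleftrightarrow> good D (I L) (restr (Qs (I L)) x)"
| "safe D L I (Suc l) x \<longleftrightarrow> safe D L I l x \<and> (\<forall>y. move (I l) x y \<longrightarrow> safe D L I l y)"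

lemma safe_cong: "(\<And>t. t < l \<or> t = L \<Longrightarrow> I t = I' t) \<Longrightarrow> safe D L I l x = safe D L I' l x"
proof (induction l arbitrary: x)
  case (Suc l)
  have "safe D L I l x = safe D L I' l x" for x by (rule Suc.IH) (use Suc.prems in auto)
  moreover have "I l = I' l" using Suc.prems by simp
  ultimately show ?case by simp
qed simp

lemma safe_if_rows:
  assumes "x0 \<in> strings q n" "\<And>c y i. reach c x0 y \<Longrightarrow> i < m \<Longrightarrow> row_sum i (restr (Qs i) y) = 0"
    and I: "\<And>t. t \<le> L \<Longrightarrow> I t < m" and "l \<le> L" "reach c x0 x"
  shows "safe D L I l x"
  using assms(4,5)
proof (induction l arbitrary: x c)
  case 0
  interpret site n k "Qs (I L)" by (rule site[OF I[OF order_refl]])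
  have "x \<in> strings q n" using 0(2) assms(1) by (rule reach_strings)
  then have "restr (Qs (I L)) x \<in> strings q k" by (rule restr_strings)
  then show ?case using good_if_row_sum[OF I] assms(2)[OF 0(2)] I by simp
next
  case (Suc l)
  have "I l < m" using I Suc.prems by simp
  then show ?case using Suc.IH[OF _ Suc.prems(2)] Suc.IH[OF _ reach_step[OF Suc.prems(2)]] Suc.prems(1) by auto
qed

text \<open>A path appears in the tuple that lists its terms, which is why all tuples are assumed
  safe. Its last term is placed at index \<open>l\<close>; by \<open>safe_cong\<close> this does not
  affect the remaining \<open>l\<close> moves or the final test.\<close>

lemma safe_reach:
  assumes "reach c x y" "\<And>I. \<forall>t\<le>L. I t < m \<Longrightarrow> safe D L I (c + l) x" "c + l \<le> L" "\<forall>t\<le>L. I t < m"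
  shows "safe D L I l y"
  using assms
proof (induction arbitrary: l I rule: reach.induct)
  case (reach_refl c x)
  have "safe D L I (c + l) x \<Longrightarrow> safe D L I l x" by (induction c) auto
  then show ?case using reach_refl by blast
next
  case (reach_step c x y i y')
  let ?I = "I(l := i)"
  have l: "l < L" using reach_step.prems(2) by simp
  have "safe D L ?I (Suc l) y"
  proof (rule reach_step.IH)
    show "safe D L J (c + Suc l) x" if "\<forall>t\<le>L. J t < m" for J
      using reach_step.prems(1)[OF that] by simp
  qed (use reach_step.prems reach_step.hyps(2) in auto)
  then have "safe D L ?I l y'" using reach_step.hyps(3) by simp
  moreover have "safe D L I l y' = safe D L ?I l y'" by (rule safe_cong) (use l in auto)
  ultimately show ?case by simp
qed

text \<open>\<open>R\<close> is the set of positive answers for the tuple \<open>I\<close> of terms, \<open>\<mu>\<close> the marking of rows.\<close>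

definition answers_of :: "nat \<Rightarrow> nat \<Rightarrow> (nat \<Rightarrow> nat list \<Rightarrow> bool) \<Rightarrow> (nat \<Rightarrow> nat) \<Rightarrow> query set \<Rightarrow> bool" where
  "answers_of D L \<mu> I R \<longleftrightarrow>
     (\<forall>t\<le>L. \<forall>s\<le>L. \<forall>p<k. \<forall>p'<k. same_query t p s p' \<in> R \<longleftrightarrow> Qs (I t) ! p = Qs (I s) ! p') \<and>
     (\<forall>t\<le>L. \<forall>y\<in>strings q k. mark_query q k t y \<in> R \<longleftrightarrow> \<mu> (I t) y) \<and>
     (\<forall>t\<le>L. \<forall>y\<in>strings q k. \<forall>z\<in>strings q k. edge_query q k t y z \<in> R \<longleftrightarrow> h (I t) y z < 0) \<and>
     (\<forall>t\<le>L. \<forall>y\<in>strings q k. \<forall>z\<in>strings q k. \<forall>j\<in>{- int D..int D}.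
        below_query q k D t y z j \<in> R \<longleftrightarrow> D * h (I t) y z \<le> j)"

text \<open>The invariant is that \<open>Y t\<close> is the restriction of the current string to the
  qudits of term \<open>I t\<close>. The equality answers describe all overlaps between terms, so
  \<open>move_local\<close> maintains it.\<close>

lemma simulate_safe:
  assumes R: "answers_of D L \<mu> I R" and I: "\<And>t. t \<le> L \<Longrightarrow> I t < m"
    and "l \<le> L" "x \<in> strings q n" "\<And>t. t \<le> L \<Longrightarrow> Y t = restr (Qs (I t)) x"
  shows "simulate q k D L R l Y \<longleftrightarrow> safe D L I l x"
  using assms(3-)
proof (induction l arbitrary: x Y)
  case 0
  interpret site n k "Qs (I L)" by (rule site[OF I[OF order_refl]])
  have y: "Y L \<in> strings q k" using 0 restr_strings by simp
  have "below_query q k D L (Y L) z j \<in> R \<longleftrightarrow> D * h (I L) (Y L) z \<le> j"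
    if "z \<in> strings q k" "j \<in> {- int D..int D}" for z j
    using R y that unfolding answers_of_def by blast
  then have "good_row q k D R L (Y L) \<longleftrightarrow> good D (I L) (Y L)"
    unfolding good_row_def good_def by (intro ex_cong1 conj_cong ball_cong refl) auto
  then show ?case using 0 by simp
next
  case (Suc l)
  have l: "l \<le> L" using Suc.prems by simp
  interpret site n k "Qs (I l)" by (rule site[OF I[OF l]])
  have lx: "length x = n" using Suc.prems(2) by (rule strings_length)
  have y: "Y l \<in> strings q k" using Suc.prems(2,3) l restr_strings by simp
  have "move_local k R l z Y t = restr (Qs (I t)) (upd (Qs (I l)) x z)"
    if t: "t \<le> L" and z: "z \<in> strings q k" for t z
  proof -
    interpret t: site n k "Qs (I t)" by (rule site[OF I[OF t]])
    show ?thesis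
    proof (rule nth_equalityI)
      show "length (move_local k R l z Y t) = length (restr (Qs (I t)) (upd (Qs (I l)) x z))"
        using t.len by (simp add: move_local_def)
      fix p assume "p < length (move_local k R l z Y t)"
      then have p: "p < k" by (simp add: move_local_def)
      have eq: "same_query t p l p' \<in> R \<longleftrightarrow> Qs (I t) ! p = Qs (I l) ! p'" if "p' < k" for p'
        using R t l p that unfolding answers_of_def by blast
      show "move_local k R l z Y t ! p = restr (Qs (I t)) (upd (Qs (I l)) x z) ! p"
      proof (cases "\<exists>p'<k. same_query t p l p' \<in> R")
        case True
        define p' where "p' = (SOME p'. p' < k \<and> same_query t p l p' \<in> R)"
        have "p' < k \<and> same_query t p l p' \<in> R" unfolding p'_def using True by (rule someI_ex)
        then have p': "p' < k" "Qs (I t) ! p = Qs (I l) ! p'" using eq by auto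
        have "move_local k R l z Y t ! p = z ! p'" using p True by (simp add: move_local_def p'_def)
        then show ?thesis using p' p t.len lx by (simp add: upd_nth)
      next
        case False
        then have "Qs (I t) ! p \<notin> set (Qs (I l))" using eq by (auto simp: in_Q)
        moreover have "move_local k R l z Y t ! p = Y t ! p" using p by (simp add: move_local_def if_not_P[OF False])
        ultimately show ?thesis using p t.len lx t.Q_less[OF p] Suc.prems(3)[OF t] by (simp add: upd_out)
      qed
    qed
  qed
  then have sub: "simulate q k D L R l (move_local k R l z Y) \<longleftrightarrow> safe D L I l (upd (Qs (I l)) x z)"
    if "z \<in> strings q k" for z
    using Suc.IH[OF l upd_strings[OF Suc.prems(2) that]] that by blast
  have "edge (I l) (restr (Qs (I l)) x) z \<longleftrightarrow> z \<in> strings q k \<and> Y l \<noteq> z \<and> edge_query q k l (Y l) z \<in> R" for z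
    using R l y Suc.prems(3)[OF l] unfolding answers_of_def edge_def by auto
  then show ?case using Suc.IH[OF l Suc.prems(2,3)] sub by (auto simp: move_def)
qed

lemma check_complete:
  assumes R: "answers_of D L \<mu> I R" and I: "\<And>t. t \<le> L \<Longrightarrow> I t < m" and x: "x \<in> strings q n"
    and rows: "\<And>c y i. reach c x y \<Longrightarrow> i < m \<Longrightarrow> row_sum i (restr (Qs i) y) = 0"
    and \<mu>: "\<And>i y. i < m \<Longrightarrow> y \<in> strings q k \<Longrightarrow> \<mu> i y \<longleftrightarrow> y = restr (Qs i) x"
  shows "check q k D L R"
  unfolding check_def
proof (intro exI[of _ "\<lambda>t. restr (Qs (I t)) x"] conjI allI impI ballI)
  fix t assume t: "t \<le> L"
  interpret site n k "Qs (I t)" by (rule site[OF I[OF t]])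
  show "restr (Qs (I t)) x \<in> strings q k" using x by (rule restr_strings)
  show "mark_query q k t y \<in> R \<longleftrightarrow> y = restr (Qs (I t)) x" if "y \<in> strings q k" for y
    using R t \<mu>[OF I[OF t] that] that unfolding answers_of_def by blast
next
  fix t s p p' assume a: "t \<le> L" "s \<le> L" "p < k" "p' < k" "same_query t p s p' \<in> R"
  interpret t: site n k "Qs (I t)" by (rule site[OF I[OF a(1)]])
  interpret s: site n k "Qs (I s)" by (rule site[OF I[OF a(2)]])
  have "Qs (I t) ! p = Qs (I s) ! p'"
    using R a unfolding answers_of_def by blast
  then show "restr (Qs (I t)) x ! p = restr (Qs (I s)) x ! p'"
    using a t.len s.len by simp
next
  have "safe D L I L x" using safe_if_rows[OF x rows I order_refl reach_refl[of 0]] .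
  then show "simulate q k D L R L (\<lambda>t. restr (Qs (I t)) x)"
    using simulate_safe[OF R I order_refl x] by simp
qed

text \<open>Checking all tuples forces the marked rows to be the restrictions of a single string.\<close>

lemma check_sound:
  assumes R: "\<And>I. (\<forall>t\<le>L. I t < m) \<Longrightarrow> answers_of D L \<mu> I (R I)" and L: "L \<ge> 1"
    and chk: "\<And>I. (\<forall>t\<le>L. I t < m) \<Longrightarrow> check q k D L (R I)"
  shows "\<exists>x\<in>strings q n. \<forall>c y i. reach c x y \<longrightarrow> c \<le> L \<longrightarrow> i < m \<longrightarrow> good D i (restr (Qs i) y)"
proof -
  have marks: "\<exists>Y. (\<forall>t\<le>L. Y t \<in> strings q k \<and> (\<forall>y\<in>strings q k. \<mu> (I t) y \<longleftrightarrow> y = Y t)) \<and>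
     (\<forall>t\<le>L. \<forall>s\<le>L. \<forall>p<k. \<forall>p'<k. Qs (I t) ! p = Qs (I s) ! p' \<longrightarrow> Y t ! p = Y s ! p') \<and>
     simulate q k D L (R I) L Y" if I: "\<forall>t\<le>L. I t < m" for I
  proof -
    have eq: "\<And>t y. t \<le> L \<Longrightarrow> y \<in> strings q k \<Longrightarrow> mark_query q k t y \<in> R I \<longleftrightarrow> \<mu> (I t) y"
      "\<And>t s p p'. t \<le> L \<Longrightarrow> s \<le> L \<Longrightarrow> p < k \<Longrightarrow> p' < k \<Longrightarrow>
        same_query t p s p' \<in> R I \<longleftrightarrow> Qs (I t) ! p = Qs (I s) ! p'"
      using R[OF I] unfolding answers_of_def by blast+
    obtain Y where Y: "\<forall>t\<le>L. Y t \<in> strings q k \<and> (\<forall>y\<in>strings q k. mark_query q k t y \<in> R I \<longleftrightarrow> y = Y t)"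
      "\<forall>t\<le>L. \<forall>s\<le>L. \<forall>p<k. \<forall>p'<k. same_query t p s p' \<in> R I \<longrightarrow> Y t ! p = Y s ! p'"
      "simulate q k D L (R I) L Y"
      using chk[OF I] unfolding check_def by blast
    have "\<forall>t\<le>L. Y t \<in> strings q k \<and> (\<forall>y\<in>strings q k. \<mu> (I t) y \<longleftrightarrow> y = Y t)"
      using Y(1) eq(1) by simp
    moreover have "\<forall>t\<le>L. \<forall>s\<le>L. \<forall>p<k. \<forall>p'<k. Qs (I t) ! p = Qs (I s) ! p' \<longrightarrow> Y t ! p = Y s ! p'"
      using Y(2) eq(2) by blast
    ultimately show ?thesis using Y(3) by blast
  qed
  define y where "y i = (SOME z. z \<in> strings q k \<and> \<mu> i z)" for i
  have y: "y i \<in> strings q k" "\<mu> i (y i)" if "i < m" for i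
  proof -
    have "\<exists>z. z \<in> strings q k \<and> \<mu> i z" using marks[of "\<lambda>_. i"] that by blast
    then have "y i \<in> strings q k \<and> \<mu> i (y i)" unfolding y_def by (rule someI_ex)
    then show "y i \<in> strings q k" "\<mu> i (y i)" by auto
  qed
  have consistent: "y i ! p = y i' ! p'"
    if "i < m" "i' < m" "p < k" "p' < k" "Qs i ! p = Qs i' ! p'" for i i' p p'
  proof -
    \<comment> \<open>As \<open>L \<ge> 1\<close>, indices 0 and 1 both belong to the tuple, so any
      two terms are compared by some check.\<close>
    let ?I = "\<lambda>t. if t = 0 then i else i'"
    have "\<forall>t\<le>L. ?I t < m" using that by simp
    from marks[OF this] obtain Y where Y:
      "\<forall>t\<le>L. Y t \<in> strings q k \<and> (\<forall>y\<in>strings q k. \<mu> (?I t) y \<longleftrightarrow> y = Y t)"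
      "\<forall>t\<le>L. \<forall>s\<le>L. \<forall>p<k. \<forall>p'<k. Qs (?I t) ! p = Qs (?I s) ! p' \<longrightarrow> Y t ! p = Y s ! p'"
      by blast
    have "y i = Y 0" "y i' = Y 1" using Y(1)[rule_format, of 0] Y(1)[rule_format, of 1] L y that by auto
    then show ?thesis using Y(2)[rule_format, of 0 1 p p'] L that by simp
  qed
  define val_at where "val_at v = (\<lambda>b. \<exists>i<m. \<exists>p<k. Qs i ! p = v \<and> b = y i ! p)" for v
  \<comment> \<open>A qudit in no term receives the letter 0, which exists because
    \<open>q \<ge> 1\<close>.\<close>
  define x where "x = map (\<lambda>v. if \<exists>b. val_at v b then (SOME b. val_at v b) else 0) [0..<n]"
  have x_nth: "x ! (Qs i ! p) = y i ! p" if "i < m" "p < k" for i p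
  proof -
    interpret site n k "Qs i" by (rule site[OF that(1)])
    let ?v = "Qs i ! p"
    have ex: "\<exists>b. val_at ?v b" using that by (auto simp: val_at_def)
    then have "val_at ?v (SOME b. val_at ?v b)" by (rule someI_ex)
    then obtain i' p' where "i' < m" "p' < k" "Qs i' ! p' = ?v" "(SOME b. val_at ?v b) = y i' ! p'"
      unfolding val_at_def[of ?v] by blast
    then have "(SOME b. val_at ?v b) = y i ! p" using consistent[of i' i p' p] that by simp
    then show ?thesis using ex Q_less[OF that(2)] by (simp add: x_def)
  qed
  have x: "x \<in> strings q n"
    unfolding strings_nth
  proof (intro conjI allI impI)
    fix v assume v: "v < n"
    show "x ! v < q"
    proof (cases "\<exists>b. val_at v b")
      case True
      then have "val_at v (SOME b. val_at v b)" by (rule someI_ex)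
      moreover have "x ! v = (SOME b. val_at v b)" using v True by (simp add: x_def)
      ultimately obtain i p where "i < m" "p < k" "x ! v = y i ! p" by (auto simp: val_at_def)
      then show ?thesis using y(1)[of i] by (simp add: strings_nth)
    next
      case False
      then have "x ! v = 0" using v by (auto simp: x_def)
      then show ?thesis using q by simp
    qed
  qed (simp add: x_def)
  have restr: "restr (Qs i) x = y i" if "i < m" for i
  proof -
    interpret site n k "Qs i" by (rule site[OF that])
    show ?thesis using x_nth[OF that] y(1)[OF that] len
      by (intro nth_equalityI) (auto simp: strings_length)
  qed
  have safe: "safe D L I L x" if I: "\<forall>t\<le>L. I t < m" for I
  proof -
    obtain Y where Y: "\<forall>t\<le>L. Y t \<in> strings q k \<and> (\<forall>y\<in>strings q k. \<mu> (I t) y \<longleftrightarrow> y = Y t)"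
      "simulate q k D L (R I) L Y" using marks[OF I] by blast
    have "Y t = restr (Qs (I t)) x" if "t \<le> L" for t
      using Y(1) I that y restr by metis
    then show ?thesis using simulate_safe[OF R[OF I] _ order_refl x, of Y] I Y(2) by blast
  qed
  have "good D i (restr (Qs i) z)" if "reach c x z" "c \<le> L" "i < m" for c z i
  proof -
    \<comment> \<open>The path is counted as one of \<open>L\<close> moves, so nothing but the test
      of the last term remains, and the constant tuple makes this term \<open>i\<close>.\<close>
    have "safe D L (\<lambda>_. i) 0 z"
    proof (rule safe_reach[OF reach_mono[OF that(1,2)]])
      show "safe D L I (L + 0) x" if "\<forall>t\<le>L. I t < m" for I using safe[OF that] by simp
    qed (use that in auto)
    then show ?thesis by simp
  qed
  then show ?thesis using x by blast
qed

section \<open>Answers read off the encoding\<close>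

lemma blocks_nth:
  assumes "length mss = m" "\<forall>i<m. length (mss ! i) = num_fields q k" "i < m" "f < num_fields q k"
  shows "blocks q k H mss ! i ! f = (term_fields q k (tm i) ! f, mss ! i ! f)"
proof -
  have "length (Qs i) = k" using term_facts(1)[OF assms(3)] by (simp add: local_term_ok_def)
  then show ?thesis using assms by (simp add: blocks_def length_term_fields)
qed

text \<open>Denominators are positive, so the sign of an entry is that of its numerator, and
  comparing with j / D amounts to an inequality of integers after clearing denominators.\<close>

lemma answers_of_blocks:
  assumes mss: "length mss = m" "\<forall>i<m. length (mss ! i) = num_fields q k" and I: "\<And>t. t \<le> L \<Longrightarrow> I t < m"
  shows "answers_of D L (\<lambda>i y. mss ! i ! entry_pos q k y y) I
    (positives q k D L (blocks q k H mss) I)" (is "answers_of _ _ _ _ ?R")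
  unfolding answers_of_def
proof (intro conjI allI impI ballI)
  have len: "length (Qs (I t)) = k" if "t \<le> L" for t
    using term_facts(1)[OF I[OF that]] by (simp add: local_term_ok_def)
  have val: "\<exists>a b c. entries (tm (I t)) y z = (a, b, c) \<and> c > 0 \<and> h (I t) y z = a / c"
    if "t \<le> L" "y \<in> strings q k" "z \<in> strings q k" for t y z
  proof -
    obtain a b c where "entries (tm (I t)) y z = (a, b, c)" by (metis prod_cases3)
    then show ?thesis using term_facts(1)[OF I[OF that(1)]] that(2,3)
      by (force simp: local_term_ok_def h_def term_mat_def)
  qed
  have pos0: "entry_pos q k y z < num_fields q k" if "y \<in> strings q k" "z \<in> strings q k" for y z
    using entry_pos_less[OF that, of 0] by simp
  have field0: "term_fields q k (tm (I t)) ! entry_pos q k y z = entry_fields (entries (tm (I t)) y z) ! 0"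
    if "t \<le> L" "y \<in> strings q k" "z \<in> strings q k" for t y z
    using term_fields_entry[OF that(2,3) _ len[OF that(1)], of 0] by simp
  show "same_query t p s p' \<in> ?R \<longleftrightarrow> Qs (I t) ! p = Qs (I s) ! p'"
    if "t \<le> L" "s \<le> L" "p < k" "p' < k" for t s p p'
  proof -
    have "same_query t p s p' \<in> query_set q k D L" using that by (simp add: query_setI)
    moreover have "p < num_fields q k" "p' < num_fields q k" using that by (simp_all add: num_fields_def)
    ultimately show ?thesis using that len
      by (simp add: same_query_def blocks_nth[OF mss] I term_fields_qudit)
  qed
  show "mark_query q k t y \<in> ?R \<longleftrightarrow> mss ! I t ! entry_pos q k y y"
    if "t \<le> L" "y \<in> strings q k" for t y
  proof -
    have "mark_query q k t y \<in> query_set q k D L" using that by (simp add: query_setI)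
    then show ?thesis using that pos0 by (simp add: mark_query_def blocks_nth[OF mss] I)
  qed
  fix t y z assume a: "t \<le> L" "y \<in> strings q k" "z \<in> strings q k"
  obtain a b c where e: "entries (tm (I t)) y z = (a, b, c)" "c > 0" "h (I t) y z = a / c"
    using val[OF a] by blast
  show "edge_query q k t y z \<in> ?R \<longleftrightarrow> h (I t) y z < 0"
  proof -
    have "edge_query q k t y z \<in> query_set q k D L" using a by (simp add: query_setI)
    moreover have "h (I t) y z < 0 \<longleftrightarrow> a < 0" using e by (simp add: divide_less_0_iff)
    ultimately show ?thesis using a e pos0
      by (simp add: edge_query_def blocks_nth[OF mss] I field0 int_field_def)
  qed
  fix j assume j: "j \<in> {- int D..int D}"
  show "below_query q k D t y z j \<in> ?R \<longleftrightarrow> D * h (I t) y z \<le> j"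
  proof -
    have "below_query q k D t y z j \<in> query_set q k D L" using a j by (simp add: query_setI)
    moreover have "entry_pos q k y z + 2 < num_fields q k" using entry_pos_less[OF a(2,3), of 2] by simp
    moreover have "term_fields q k (tm (I t)) ! (entry_pos q k y z + 2) = binary c"
      using term_fields_entry[OF a(2,3) _ len[OF a(1)], of 2] e by simp
    moreover have "term_fields q k (tm (I t)) ! entry_pos q k y z = int_field a"
      using field0[OF a] e by simp
    moreover have "D * h (I t) y z \<le> j \<longleftrightarrow> int D * a \<le> j * int c"
    proof -
      have "D * h (I t) y z \<le> j \<longleftrightarrow> real_of_int (int D * a) \<le> real_of_int (j * int c)"
      proof -
        have "D * h (I t) y z = real_of_int (int D * a) / c" using e(3) by simp
        then show ?thesis using e(2) by (simp add: pos_divide_le_eq)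
      qed
      then show ?thesis by (simp only: of_int_le_iff)
    qed
    moreover have "(if a < 0 then - int (nat \<bar>a\<bar>) else int (nat \<bar>a\<bar>)) = a" by simp
    ultimately show ?thesis using a pos0
      by (simp add: below_query_def blocks_nth[OF mss] I int_field_def del: nat_abs_int_diff)
  qed
qed

lemma blocks_facts:
  assumes mss: "length mss = m" "\<forall>i<m. length (mss ! i) = num_fields q k"
  shows "C \<in> set (blocks q k H mss) \<Longrightarrow> length C = num_fields q k"
    "x \<in> query_set q k D L \<Longrightarrow> field1 x < num_fields q k \<and> field2 x < num_fields q k"
    "x \<in> query_set q k D L \<Longrightarrow> C \<in> set (blocks q k H mss) \<Longrightarrow>
       kind x = Negative \<or> (\<exists>D j. kind x = Below D j) \<Longrightarrow> fst (C ! field1 x) \<noteq> []"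
proof -
  have pos: "entry_pos q k y z < num_fields q k" "entry_pos q k y z + 2 < num_fields q k"
    if "y \<in> strings q k" "z \<in> strings q k" for y z
    using entry_pos_less[OF that, of 0] entry_pos_less[OF that, of 2] by simp_all
  have lenQ: "length (Qs i) = k" if "i < m" for i
    using term_facts(1)[OF that] by (simp add: local_term_ok_def)
  have C: "\<exists>i<m. C = blocks q k H mss ! i \<and> C = zip (term_fields q k (tm i)) (mss ! i)" if inC: "C \<in> set (blocks q k H mss)" for C
  proof -
    have "length (blocks q k H mss) = m" using mss(1) by (simp add: blocks_def)
    then obtain i where "i < m" "C = blocks q k H mss ! i"
      using inC by (auto simp: in_set_conv_nth)
    then show ?thesis using mss(1) by (intro exI[of _ i]) (simp add: blocks_def)
  qed
  show "length C = num_fields q k" if "C \<in> set (blocks q k H mss)"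
    using C[OF that] mss lenQ by (auto simp: length_term_fields)
  show f: "field1 x < num_fields q k \<and> field2 x < num_fields q k" if "x \<in> query_set q k D L"
    using that
    by (cases rule: query_set_cases)
      (use pos in \<open>auto simp: same_query_def mark_query_def edge_query_def below_query_def num_fields_def\<close>)
  show "fst (C ! field1 x) \<noteq> []" if x: "x \<in> query_set q k D L" and inC: "C \<in> set (blocks q k H mss)"
    and kd: "kind x = Negative \<or> (\<exists>D j. kind x = Below D j)"
  proof -
    obtain i where i: "i < m" "C = blocks q k H mss ! i" using C[OF inC] by blast
    have "\<exists>y\<in>strings q k. \<exists>z\<in>strings q k. field1 x = entry_pos q k y z"
      using x kd by (cases rule: query_set_cases)
        (auto simp: same_query_def mark_query_def edge_query_def below_query_def)
    then obtain y z where yz: "y \<in> strings q k" "z \<in> strings q k" "field1 x = entry_pos q k y z" by blast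
    have "fst (C ! field1 x) = entry_fields (entries (tm i) y z) ! 0"
      using blocks_nth[OF mss i(1) pos(1)[OF yz(1,2)]] term_fields_entry[OF yz(1,2) _ lenQ[OF i(1)], of 0] i yz
      by simp
    then show ?thesis by (cases "entries (tm i) y z") (simp add: int_field_def)
  qed
qed

end

text \<open>On the diagonal, the position is an affine function of the row index with slope 3 * (q^k
  + 1), so marks of different rows cannot collide.\<close>

lemma entry_pos_diag:
  assumes "y \<in> strings q k" "z \<in> strings q k" "entry_pos q k y y = entry_pos q k z z"
  shows "y = z"
proof -
  have "row q k y * Suc (q ^ k) = row q k z * Suc (q ^ k)" using assms(3) by (simp add: entry_pos_def)
  then have "row q k y = row q k z" by (metis mult_right_cancel nat.distinct(1))
  then have "List.n_lists k [0..<q] ! row q k y = List.n_lists k [0..<q] ! row q k z" by simp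
  then show ?thesis unfolding row(2)[OF assms(1)] row(2)[OF assms(2)] .
qed

section \<open>Choice of the constants and the final verifier\<close>

lemma enough_layers:
  fixes \<rho> \<gamma> :: real
  assumes "\<rho> > 1" "\<gamma> > 0"
  shows "\<exists>T :: nat. b < \<rho> powr (\<gamma> * T)"
proof -
  have "\<rho> powr \<gamma> > 1" using assms by simp
  then obtain T where "b < (\<rho> powr \<gamma>) ^ T" using real_arch_pow by blast
  then show ?thesis using assms by (intro exI[of _ T]) (simp add: powr_powr flip: powr_realpow)
qed

theorem theorem1p1:
  fixes \<epsilon> :: real and q k d :: nat and a b :: "nat poly"
  assumes "q \<ge> 1" and "\<epsilon> > 0"
  shows "uniform_stoquastic_problem q \<epsilon> k d a b \<in> NP"
proof -
  let ?\<rho> = "1 + \<epsilon> / (4 * real q ^ k * real q ^ k)" and ?\<gamma> = "\<epsilon> / (4 * real (Suc (k * d)) * real q ^ k)"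
  have K: "real q ^ k > 0" using assms(1) by simp
  have "\<epsilon> / (4 * real q ^ k * real q ^ k) > 0" using K assms(2) by (intro divide_pos_pos mult_pos_pos) auto
  then have "?\<rho> > 1" by simp
  moreover have "?\<gamma> > 0" using K assms(2) by (intro divide_pos_pos mult_pos_pos) (auto simp: add_pos_nonneg)
  ultimately obtain T :: nat where T: "real q < ?\<rho> powr (?\<gamma> * T)" using enough_layers by blast
  \<comment> \<open>The first summand is the distance bound of \<open>bad_string_nearby\<close>. It
    can be 0, and the added 1 provides the two indices that \<open>check_sound\<close> needs for
    comparing terms.\<close>
  define L where "L = T * Suc k ^ T * k + 1"
  \<comment> \<open>With this precision an accepted row has sum at most q^k / D \<le> \<epsilon>/4,
    contradicting the bad row that lies within reach.\<close>
  obtain D :: nat where D: "real D > 4 * real q ^ k / \<epsilon>" using reals_Archimedean2 by blast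
  have "4 * real q ^ k / \<epsilon> > 0" using K assms(2) by simp
  then have "real D > 0" using D by linarith
  then have D0: "D > 0" by simp
  then have D4: "real q ^ k / D \<le> \<epsilon> / 4" using D assms(2) by (simp add: field_simps)
  obtain qs where qs: "set qs = query_set q k D L" using finite_list[OF finite_query_set] by blast
  \<comment> \<open>There are \<open>Suc L\<close> levels because a tuple consists of
    \<open>L\<close> terms for moves and one to be tested; \<open>3 * int D + 2\<close> is the least
    state bound that the precision allows in the locale.\<close>
  interpret checker "num_fields q k" "Suc L" qs "3 * int D + 2" "check q k D L"
  proof
    show "level1 x < Suc L \<and> level2 x < Suc L" if "x \<in> set qs" for x
      using that unfolding qs
      by (cases rule: query_set_cases)
        (auto simp: same_query_def mark_query_def edge_query_def below_query_def)
    show "\<bar>j\<bar> \<le> D' \<and> 3 * D' + 2 \<le> 3 * int D + 2" if "x \<in> set qs" "kind x = Below D' j" for x D' j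
      using that unfolding qs
      by (cases rule: query_set_cases)
        (auto simp: same_query_def mark_query_def edge_query_def below_query_def)
    have "q ^ k * q ^ k > 0" using assms(1) by simp
    then show "1 \<le> num_fields q k" unfolding num_fields_def by linarith
  qed (use D0 in simp)
  from tuple_verifier obtain M where M': "wf_tm M \<and> polytime M \<and> (\<forall>x w. accepts M x w \<longleftrightarrow>
     (\<forall>P. (\<forall>t<Suc L. P t < length (tokens x w) \<and> is_first (tokens x w ! P t)) \<longrightarrow>
        check q k D L {z \<in> set qs. answer (tokens x w) P z}))" ..
  then have M: "wf_tm M" "polytime M" by blast+
  note acc = M'[THEN conjunct2, THEN conjunct2, rule_format]
  define R where "R H mss I = positives q k D L (blocks q k H mss) I" for H mss and I :: "nat \<Rightarrow> nat"
  have acc_blocks: "accepts M (encode q k H) w \<longleftrightarrow>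
      (\<forall>I. (\<forall>t\<le>L. I t < length (local_terms H)) \<longrightarrow> check q k D L (R H mss I))"
    if H: "H \<in> instances q k d a b" and mss: "length mss = length (local_terms H)"
      "\<forall>i<length (local_terms H). length (mss ! i) = num_fields q k"
      and tok: "tokens (encode q k H) w = 9 # ftoks False hb hm @ suffix_toks (blocks q k H mss) 0" for H w mss hb hm
  proof -
    interpret instance_facts q k d a b H using H assms(1) by unfold_locales
    have "length (blocks q k H mss) = length (local_terms H)" using mss(1) by (simp add: blocks_def)
    then show ?thesis
      unfolding acc R_def
      using tuples_of_positions[OF blocks_facts(1)[OF mss] blocks_facts(2)[OF mss] blocks_facts(3)[OF mss] tok]
      by (simp add: qs less_Suc_eq_le)
  qed
  have yes: "\<exists>w. length w \<le> poly [:0, 1:] (length (encode q k H)) \<and> accepts M (encode q k H) w"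
    if H: "H \<in> instances q k d a b" "frustration_free q H" for H
  proof -
    interpret instance_facts q k d a b H using H(1) assms(1) by unfold_locales
    obtain x where x: "x \<in> strings q n"
      "\<And>c y i. reach c x y \<Longrightarrow> i < m \<Longrightarrow> row_sum i (restr (Qs i) y) = 0"
      using frustration_free_good[OF H(2)] by blast
    define y where "y i = restr (Qs i) x" for i
    \<comment> \<open>In each term exactly one number is marked: the diagonal numerator in the row
      of the restriction of \<open>x\<close>.\<close>
    define mss where "mss = map (\<lambda>i. map (\<lambda>f. f = entry_pos q k (y i) (y i)) [0..<num_fields q k]) [0..<m]"
    have mss: "length mss = m" "\<forall>i<m. length (mss ! i) = num_fields q k" by (simp_all add: mss_def)
    have "length (qudits t) = k" if "t \<in> set (local_terms H)" for t
      using H(1) that by (auto simp: instances_def local_term_ok_def)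
    from tokens_witness[where H = H, OF refl this mss(1)] mss obtain w where w: "length w = length (encode q k H)"
      "tokens (encode q k H) w = 9 # ftoks False (binary n) False @ suffix_toks (blocks q k H mss) 0"
      by auto
    have "check q k D L (R H mss I)" if I: "\<forall>t\<le>L. I t < m" for I
    proof (rule check_complete[OF _ _ x(1) x(2)])
      show "answers_of D L (\<lambda>i y. mss ! i ! entry_pos q k y y) I (R H mss I)"
        unfolding R_def using answers_of_blocks[OF mss] I by blast
      fix i z assume i: "i < m" and z: "z \<in> strings q k"
      interpret site n k "Qs i" by (rule site[OF i])
      have yi: "y i \<in> strings q k" unfolding y_def using x(1) by (rule restr_strings)
      have "mss ! i ! entry_pos q k z z \<longleftrightarrow> entry_pos q k z z = entry_pos q k (y i) (y i)"
        using i entry_pos_less[OF z z, of 0] by (simp add: mss_def)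
      then show "mss ! i ! entry_pos q k z z \<longleftrightarrow> z = restr (Qs i) x"
        using entry_pos_diag[OF z yi] by (auto simp: y_def)
    qed (use I in auto)
    then have "accepts M (encode q k H) w" using acc_blocks[OF H(1) mss w(2)] by blast
    then show ?thesis using w(1) by (intro exI[of _ w]) simp
  qed
  \<comment> \<open>Valid for witnesses of every length, since the tokens see at most as many
    witness bits as the instance has.\<close>
  have no: "\<not> accepts M (encode q k H) w" if H: "H \<in> instances q k d a b" "frustrated q \<epsilon> H" for H w
  proof
    assume accepts: "accepts M (encode q k H) w"
    interpret instance_facts q k d a b H using H(1) assms(1) by unfold_locales
    have "length (qudits t) = k" if "t \<in> set (local_terms H)" for t
      using H(1) that by (auto simp: instances_def local_term_ok_def)
    from tokens_encode[where H = H and w = w, OF refl this] obtain hm mss where mss: "length mss = m"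
      "\<forall>i<m. length (mss ! i) = num_fields q k"
      and tok: "tokens (encode q k H) w = 9 # ftoks False (binary n) hm @ suffix_toks (blocks q k H mss) 0"
      by auto
    have chk: "check q k D L (R H mss I)" if "\<forall>t\<le>L. I t < m" for I
      using accepts acc_blocks[OF H(1) mss tok] that by blast
    have "answers_of D L (\<lambda>i y. mss ! i ! entry_pos q k y y) I (R H mss I)" if "\<forall>t\<le>L. I t < m" for I
      unfolding R_def using answers_of_blocks[OF mss] that by blast
    from check_sound[OF this _ chk] obtain x where x: "x \<in> strings q n"
      "\<And>c y i. reach c x y \<Longrightarrow> c \<le> L \<Longrightarrow> i < m \<Longrightarrow> good D i (restr (Qs i) y)"
      by (auto simp: L_def)
    have "\<exists>y i. reach (T * Suc k ^ T * k) x y \<and> i < m \<and> row_sum i (restr (Qs i) y) > \<epsilon> / 4"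
      using bad_string_nearby[OF assms(2,1) frustrated_nonempty[OF H(2) assms(2)] n_le_m x(1)
          frustrated_energy[OF H(2)] T] .
    then obtain y i where y: "reach (T * Suc k ^ T * k) x y" "i < m" "row_sum i (restr (Qs i) y) > \<epsilon> / 4"
      by blast
    have "good D i (restr (Qs i) y)" using x(2)[OF y(1) _ y(2)] by (simp add: L_def)
    then have "row_sum i (restr (Qs i) y) \<le> real q ^ k / D" using good_row_sum D0 by simp
    then show False using y(3) D4 by simp
  qed
  show ?thesis
    unfolding uniform_stoquastic_problem_def NP_def
    using M yes no by (auto intro!: exI[of _ M] exI[of _ "[:0, 1:]"])
qed

end
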